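(* Let $n\ge 1$ and let $V_n=\bigoplus_{k\ge0}V_n(k)\subseteq\mathbb{C}[x_1,\dots,x_{n+1}]$ be the graded $S_{n+1}$-module spanned by the polynomials $p(G)$, $G$ a slim subgraph of $K_{n+1}$. Then: $V_n(0)$ carries the trivial representation of $S_{n+1}$; $V_n(1)$ carries the reflection representation of $S_{n+1}$ (the irreducible representation indexed by $(n,1)$); for every $k<n$, $V_n(k)=\mathrm{Sym}^k(V_n(1))$, i.e. $V_n(k)$ equals the span of all products of $k$ elements of $V_n(1)$; and the top degree component $V_n\big(\binom{n}{2}\big)$ is isomorphic as an $S_{n+1}$-module to $\mathrm{Lie}_n\otimes\mathrm{sign}$.
   Context: $K_{n+1}$ is the complete graph on $[n+1]$. For an edge $e=\{i<j\}$, $p(e)=x_i-x_j$, and for a subgraph $G$ (edge set), $p(G)=\prod_{e\in G}p(e)$. $G$ is slim if $K_{n+1}-G$ is a connected graph on vertex set $[n+1]$. $V_n(k)$ denotes the homogeneous degree-$k$ part of $V_n$; $S_{n+1}$ acts by permuting variables. $C_{n+1}$ is the cyclic subgroup of $S_{n+1}$ generated by $c=(1,2,\dots,n+1)$, $\zeta$ is the one-dimensional representation of $C_{n+1}$ sending $c$ to $e^{2\pi i/(n+1)}$, and $\mathrm{Lie}_n:=\mathrm{Ind}_{C_{n+1}}^{S_{n+1}}(\zeta)$. $\mathrm{sign}$ is the sign representation of $S_{n+1}$.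
   Formalization: The clause that V_n(1) carries the reflection representation is stated only for n ≥ 2, because for n = 1 the only slim subgraph of K_2 is empty, so V_1(1) = 0 while the representation indexed by (1,1) is one-dimensional; all other clauses hold for n ≥ 1. *)

theory Defs
  imports
    Complex_Main
    "HOL-Library.Poly_Mapping"
    "HOL-Library.Function_Algebras"
    "HOL-Algebra.Sym_Groups"
begin

section \<open>Representations over the complex numbers\<close>

record ('g, 'v) rep =
  rep_scale :: "complex \<Rightarrow> 'v \<Rightarrow> 'v"
  rep_space :: "'v set"
  rep_act :: "'g \<Rightarrow> 'v \<Rightarrow> 'v"

text \<open>The representation space is a linear subspace of the ambient type; the action is only
  constrained on that subspace.\<close>

definition representation ::
    "('g, 'm) monoid_scheme \<Rightarrow> ('g, 'v::ab_group_add) rep \<Rightarrow> bool" where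
  "representation G R \<longleftrightarrow>
     group G \<and> vector_space (rep_scale R) \<and> module.subspace (rep_scale R) (rep_space R) \<and>
     (\<forall>g\<in>carrier G. \<forall>v\<in>rep_space R. rep_act R g v \<in> rep_space R) \<and>
     (\<forall>g\<in>carrier G. \<forall>v\<in>rep_space R. \<forall>w\<in>rep_space R.
        rep_act R g (v + w) = rep_act R g v + rep_act R g w) \<and>
     (\<forall>g\<in>carrier G. \<forall>a. \<forall>v\<in>rep_space R.
        rep_act R g (rep_scale R a v) = rep_scale R a (rep_act R g v)) \<and>
     (\<forall>v\<in>rep_space R. rep_act R \<one>\<^bsub>G\<^esub> v = v) \<and>
     (\<forall>g\<in>carrier G. \<forall>h\<in>carrier G. \<forall>v\<in>rep_space R.
        rep_act R (g \<otimes>\<^bsub>G\<^esub> h) v = rep_act R g (rep_act R h v))"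

definition rep_isomorphic ::
    "('g, 'm) monoid_scheme \<Rightarrow> ('g, 'v::ab_group_add) rep \<Rightarrow> ('g, 'w::ab_group_add) rep \<Rightarrow> bool"
  where
  "rep_isomorphic G R S \<longleftrightarrow>
     representation G R \<and> representation G S \<and>
     (\<exists>\<phi>. bij_betw \<phi> (rep_space R) (rep_space S) \<and>
        (\<forall>v\<in>rep_space R. \<forall>w\<in>rep_space R. \<phi> (v + w) = \<phi> v + \<phi> w) \<and>
        (\<forall>a. \<forall>v\<in>rep_space R. \<phi> (rep_scale R a v) = rep_scale S a (\<phi> v)) \<and>
        (\<forall>g\<in>carrier G. \<forall>v\<in>rep_space R. \<phi> (rep_act R g v) = rep_act S g (\<phi> v)))"

definition irreducible_rep ::
    "('g, 'm) monoid_scheme \<Rightarrow> ('g, 'v::ab_group_add) rep \<Rightarrow> bool" where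
  "irreducible_rep G R \<longleftrightarrow>
     representation G R \<and> rep_space R \<noteq> {0} \<and>
     (\<forall>W. module.subspace (rep_scale R) W \<and> W \<subseteq> rep_space R \<and>
          (\<forall>g\<in>carrier G. \<forall>w\<in>W. rep_act R g w \<in> W) \<longrightarrow> W = {0} \<or> W = rep_space R)"

definition char_rep :: "('g \<Rightarrow> complex) \<Rightarrow> ('g, complex) rep" where
  "char_rep \<chi> = \<lparr>rep_scale = (*), rep_space = UNIV, rep_act = (\<lambda>g z. \<chi> g * z)\<rparr>"

text \<open>The tensor product with the one-dimensional representation \<open>char_rep \<chi>\<close>, on the
  space of \<open>R\<close> itself (via \<open>v \<otimes> 1 \<mapsto> v\<close>).\<close>

definition tensor_char :: "('g, 'v) rep \<Rightarrow> ('g \<Rightarrow> complex) \<Rightarrow> ('g, 'v) rep" where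
  "tensor_char R \<chi> =
     \<lparr>rep_scale = rep_scale R, rep_space = rep_space R,
      rep_act = (\<lambda>g v. rep_scale R (\<chi> g) (rep_act R g v))\<rparr>"

text \<open>The representation of \<open>G\<close> induced from the representation \<open>R\<close> of the subgroup \<open>H\<close>:
  maps \<open>f\<close> from \<open>G\<close> to \<open>R\<close> with \<open>f (g h) = h\<inverse> (f g)\<close> for \<open>h \<in> H\<close>, where \<open>s \<in> G\<close> acts by
  \<open>(s f) g = f (s\<inverse> g)\<close>. (This is the usual model for finite \<open>G\<close>; the maps are extended
  by \<open>0\<close> outside the carrier.)\<close>

definition induced_rep ::
    "('g, 'm) monoid_scheme \<Rightarrow> 'g set \<Rightarrow> ('g, 'w::zero) rep \<Rightarrow> ('g, 'g \<Rightarrow> 'w) rep" where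
  "induced_rep G H R =
     \<lparr>rep_scale = (\<lambda>a f g. rep_scale R a (f g)),
      rep_space = {f. (\<forall>g\<in>carrier G. f g \<in> rep_space R) \<and> (\<forall>g. g \<notin> carrier G \<longrightarrow> f g = 0) \<and>
        (\<forall>g\<in>carrier G. \<forall>h\<in>H. f (g \<otimes>\<^bsub>G\<^esub> h) = rep_act R (inv\<^bsub>G\<^esub> h) (f g))},
      rep_act = (\<lambda>s f g. if g \<in> carrier G then f (inv\<^bsub>G\<^esub> s \<otimes>\<^bsub>G\<^esub> g) else 0)\<rparr>"


section \<open>Representations of the symmetric group\<close>

definition sign_char :: "(nat \<Rightarrow> nat) \<Rightarrow> complex" where
  "sign_char \<sigma> = of_int (sign \<sigma>)"

text \<open>The reflection representation of \<open>S\<^sub>N\<close>: the vectors in \<open>\<complex>\<^sup>N\<close> with coordinate sum \<open>0\<close>,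
  with \<open>\<sigma> e\<^sub>i = e\<^sub>\<sigma>\<^sub>i\<close>.\<close>

definition reflection_rep :: "nat \<Rightarrow> (nat \<Rightarrow> nat, nat \<Rightarrow> complex) rep" where
  "reflection_rep N =
     \<lparr>rep_scale = (\<lambda>a v i. a * v i),
      rep_space = {v. (\<forall>i. i \<notin> {1..N} \<longrightarrow> v i = 0) \<and> (\<Sum>i=1..N. v i) = 0},
      rep_act = (\<lambda>\<sigma> v i. v (inv' \<sigma> i))\<rparr>"

text \<open>Specht modules. A partition is given by its list of parts, cells are pairs (row, column)
  counted from \<open>0\<close>, and a tabloid is the map sending a row index to its set of entries.
  The permutation module on tabloids consists of complex functions of tabloids.\<close>

definition cells :: "nat list \<Rightarrow> (nat \<times> nat) set" where
  "cells lam = {(r, c). r < length lam \<and> c < lam ! r}"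

definition tableaux :: "nat list \<Rightarrow> (nat \<times> nat \<Rightarrow> nat) set" where
  "tableaux lam = {T. bij_betw T (cells lam) {1..sum_list lam}}"

definition tabloid :: "nat list \<Rightarrow> (nat \<times> nat \<Rightarrow> nat) \<Rightarrow> nat \<Rightarrow> nat set" where
  "tabloid lam T r = {T (r, c) |c. (r, c) \<in> cells lam}"

definition tableau_column :: "nat list \<Rightarrow> (nat \<times> nat \<Rightarrow> nat) \<Rightarrow> nat \<Rightarrow> nat set" where
  "tableau_column lam T c = {T (r, c) |r. (r, c) \<in> cells lam}"

definition column_stabilizer :: "nat list \<Rightarrow> (nat \<times> nat \<Rightarrow> nat) \<Rightarrow> (nat \<Rightarrow> nat) set" where
  "column_stabilizer lam T =
     {\<pi>. \<pi> permutes {1..sum_list lam} \<and> (\<forall>c. \<pi> ` tableau_column lam T c = tableau_column lam T c)}"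

definition tabloid_act :: "(nat \<Rightarrow> nat) \<Rightarrow> (nat \<Rightarrow> nat set) \<Rightarrow> nat \<Rightarrow> nat set" where
  "tabloid_act \<sigma> t r = \<sigma> ` t r"

definition polytabloid :: "nat list \<Rightarrow> (nat \<times> nat \<Rightarrow> nat) \<Rightarrow> (nat \<Rightarrow> nat set) \<Rightarrow> complex" where
  "polytabloid lam T t =
     (\<Sum>\<pi>\<in>column_stabilizer lam T. if tabloid_act \<pi> (tabloid lam T) = t then sign_char \<pi> else 0)"

definition specht_rep :: "nat list \<Rightarrow> (nat \<Rightarrow> nat, (nat \<Rightarrow> nat set) \<Rightarrow> complex) rep" where
  "specht_rep lam =
     \<lparr>rep_scale = (\<lambda>a f t. a * f t),
      rep_space = module.span (\<lambda>a f t. a * f t) (polytabloid lam ` tableaux lam),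
      rep_act = (\<lambda>\<sigma> f t. f (tabloid_act (inv' \<sigma>) t))\<rparr>"

definition long_cycle :: "nat \<Rightarrow> nat \<Rightarrow> nat" where
  "long_cycle N = cycle_of_list [1..<Suc N]"

definition cyclic_subgroup :: "nat \<Rightarrow> (nat \<Rightarrow> nat) set" where
  "cyclic_subgroup N = generate (sym_group N) {long_cycle N}"

text \<open>The character \<open>c ^ k \<mapsto> exp (2 \<pi> i k / N)\<close> of the cyclic subgroup.\<close>

definition zeta :: "nat \<Rightarrow> (nat \<Rightarrow> nat) \<Rightarrow> complex" where
  "zeta N \<sigma> = exp (2 * of_real pi * \<i> / of_nat N) ^ (LEAST k. \<sigma> = long_cycle N ^^ k)"

lemma long_cycle_funpow_eq_iff:
  assumes "N \<ge> 1"
  shows "long_cycle N ^^ j = long_cycle N ^^ k \<longleftrightarrow> j mod N = k mod N"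
proof
  let ?c = "[1..<Suc N]"
  have rot: "map (long_cycle N ^^ k) ?c = rotate k ?c" for k
    unfolding long_cycle_def by (rule cyclic_rotation) simp
  have hd: "(long_cycle N ^^ k) 1 = Suc (k mod N)" for k
  proof -
    have "(long_cycle N ^^ k) 1 = map (long_cycle N ^^ k) ?c ! 0"
      using assms by (simp add: nth_map nth_append del: upt_Suc)
    also have "\<dots> = rotate k ?c ! 0" by (simp only: rot)
    also have "\<dots> = Suc (k mod N)"
      using assms by (subst nth_rotate) (simp_all del: upt_Suc)
    finally show ?thesis .
  qed
  show "j mod N = k mod N" if "long_cycle N ^^ j = long_cycle N ^^ k"
    using hd[of j] hd[of k] that by simp
  show "long_cycle N ^^ j = long_cycle N ^^ k" if "j mod N = k mod N"
  proof -
    have id: "long_cycle N ^^ N = id"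
      using cycle_is_id_root[of ?c] unfolding long_cycle_def by (simp del: upt_Suc)
    have "long_cycle N ^^ k = long_cycle N ^^ (k mod N)" for k
    proof -
      have "long_cycle N ^^ k = long_cycle N ^^ (N * (k div N) + k mod N)" by simp
      also have "\<dots> = (long_cycle N ^^ N) ^^ (k div N) \<circ> long_cycle N ^^ (k mod N)"
        by (simp only: funpow_add funpow_mult)
      finally show ?thesis by (simp add: id)
    qed
    then show ?thesis using that by metis
  qed
qed

lemma zeta_long_cycle_funpow:
  assumes "N \<ge> 1"
  shows "zeta N (long_cycle N ^^ k) = exp (2 * of_real pi * \<i> / of_nat N) ^ k"
proof -
  let ?w = "exp (2 * of_real pi * \<i> / of_nat N) :: complex"
  have w: "?w ^ N = 1"
    using assms by (simp flip: exp_of_nat_mult add: exp_two_pi_i)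
  have red: "?w ^ j = ?w ^ (j mod N)" for j
  proof -
    have "?w ^ j = ?w ^ (N * (j div N) + j mod N)" by simp
    also have "\<dots> = (?w ^ N) ^ (j div N) * ?w ^ (j mod N)" by (simp only: power_add power_mult)
    finally show ?thesis by (simp only: w power_one mult_1)
  qed
  define l where "l = (LEAST j. long_cycle N ^^ k = long_cycle N ^^ j)"
  have "long_cycle N ^^ k = long_cycle N ^^ l"
    unfolding l_def by (rule LeastI) (rule refl)
  then have "k mod N = l mod N" using long_cycle_funpow_eq_iff[OF assms] by blast
  then have "?w ^ l = ?w ^ k" using red by metis
  then show ?thesis by (simp add: zeta_def l_def)
qed

definition Lie_rep :: "nat \<Rightarrow> (nat \<Rightarrow> nat, (nat \<Rightarrow> nat) \<Rightarrow> complex) rep" where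
  "Lie_rep n = induced_rep (sym_group (n + 1)) (cyclic_subgroup (n + 1)) (char_rep (zeta (n + 1)))"


section \<open>Polynomials\<close>

type_synonym cpoly = "(nat \<Rightarrow>\<^sub>0 nat) \<Rightarrow>\<^sub>0 complex"

definition poly_var :: "nat \<Rightarrow> cpoly" where
  "poly_var i = Poly_Mapping.single (Poly_Mapping.single i 1) 1"

definition poly_const :: "complex \<Rightarrow> cpoly" where
  "poly_const a = Poly_Mapping.single 0 a"

definition poly_scale :: "complex \<Rightarrow> cpoly \<Rightarrow> cpoly" where
  "poly_scale a p = poly_const a * p"

definition homogeneous :: "nat \<Rightarrow> cpoly \<Rightarrow> bool" where
  "homogeneous k p \<longleftrightarrow>
     (\<forall>m\<in>Poly_Mapping.keys p. (\<Sum>i\<in>Poly_Mapping.keys m. Poly_Mapping.lookup m i) = k)"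

text \<open>Substitution of \<open>x\<^sub>\<sigma>\<^sub>i\<close> for \<open>x\<^sub>i\<close>.\<close>

definition permute_vars :: "(nat \<Rightarrow> nat) \<Rightarrow> cpoly \<Rightarrow> cpoly" where
  "permute_vars \<sigma> p =
     (\<Sum>m\<in>Poly_Mapping.keys p. poly_const (Poly_Mapping.lookup p m) *
        (\<Prod>i\<in>Poly_Mapping.keys m. poly_var (\<sigma> i) ^ Poly_Mapping.lookup m i))"


section \<open>Slim subgraphs\<close>

definition complete_edges :: "nat \<Rightarrow> nat set set" where
  "complete_edges N = {e. e \<subseteq> {1..N} \<and> card e = 2}"

definition connected_graph :: "nat set \<Rightarrow> nat set set \<Rightarrow> bool" where
  "connected_graph A E \<longleftrightarrow> (\<forall>u\<in>A. \<forall>v\<in>A. (u, v) \<in> {(a, b). {a, b} \<in> E}\<^sup>*)"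

definition slim :: "nat \<Rightarrow> nat set set \<Rightarrow> bool" where
  "slim n G \<longleftrightarrow>
     G \<subseteq> complete_edges (n + 1) \<and> connected_graph {1..n + 1} (complete_edges (n + 1) - G)"

definition edge_poly :: "nat set \<Rightarrow> cpoly" where
  "edge_poly e = poly_var (Min e) - poly_var (Max e)"

definition graph_poly :: "nat set set \<Rightarrow> cpoly" where
  "graph_poly G = (\<Prod>e\<in>G. edge_poly e)"

definition slim_module :: "nat \<Rightarrow> cpoly set" where
  "slim_module n = module.span poly_scale {graph_poly G |G. slim n G}"

definition V_deg :: "nat \<Rightarrow> nat \<Rightarrow> cpoly set" where
  "V_deg n k = {p \<in> slim_module n. homogeneous k p}"

definition V_rep :: "nat \<Rightarrow> nat \<Rightarrow> (nat \<Rightarrow> nat, cpoly) rep" where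
  "V_rep n k = \<lparr>rep_scale = poly_scale, rep_space = V_deg n k, rep_act = permute_vars\<rparr>"

lemma vector_space_poly_scale: "vector_space poly_scale"
  by unfold_locales
    (simp_all add: poly_scale_def poly_const_def distrib_left distrib_right single_add mult_single
      flip: mult.assoc)

lemma homogeneous_mult:
  assumes "homogeneous j p" "homogeneous k q"
  shows "homogeneous (j + k) (p * q)"
  unfolding homogeneous_def
proof
  let ?d = "\<lambda>m :: nat \<Rightarrow>\<^sub>0 nat. \<Sum>i\<in>Poly_Mapping.keys m. Poly_Mapping.lookup m i"
  have d_add: "?d (a + b) = ?d a + ?d b" for a b
  proof -
    let ?K = "Poly_Mapping.keys a \<union> Poly_Mapping.keys b"
    have d: "?d m = (\<Sum>i\<in>?K. Poly_Mapping.lookup m i)" if "Poly_Mapping.keys m \<subseteq> ?K" for m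
      using that by (intro sum.mono_neutral_left) (auto simp: in_keys_iff)
    show ?thesis
      using d[of a] d[of b] d[of "a + b"] keys_add[of a b] by (simp add: lookup_add sum.distrib)
  qed
  fix m assume "m \<in> Poly_Mapping.keys (p * q)"
  then obtain a b where "m = a + b" "a \<in> Poly_Mapping.keys p" "b \<in> Poly_Mapping.keys q"
    using keys_mult[of p q] by blast
  then show "?d m = j + k"
    using assms d_add[of a b] by (auto simp: homogeneous_def)
qed

lemma homogeneous_edge_poly: "homogeneous 1 (edge_poly e)"
  using keys_diff[of "poly_var (Min e)" "poly_var (Max e)"]
  by (auto simp: homogeneous_def edge_poly_def poly_var_def)

lemma homogeneous_graph_poly:
  assumes "finite G"
  shows "homogeneous (card G) (graph_poly G)"
  using assms
proof (induction G rule: finite_induct)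
  case empty
  show ?case by (simp add: homogeneous_def graph_poly_def)
next
  case (insert e G)
  then show ?case
    using homogeneous_mult[OF homogeneous_edge_poly, of "card G" "graph_poly G" e]
    by (simp add: graph_poly_def)
qed

lemma slim_module_graded: "slim_module n = module.span poly_scale (\<Union>k. V_deg n k)"
proof -
  interpret vector_space poly_scale by (rule vector_space_poly_scale)
  have "graph_poly G \<in> V_deg n (card G)" if "slim n G" for G
  proof -
    have "finite G"
      using that by (intro finite_subset[of G "Pow {1..n+1}"]) (auto simp: slim_def complete_edges_def)
    then show ?thesis
      using that homogeneous_graph_poly[of G] by (auto simp: V_deg_def slim_module_def intro: span_base)
  qed
  then have "{graph_poly G |G. slim n G} \<subseteq> (\<Union>k. V_deg n k)" by blast
  then have "slim_module n \<subseteq> span (\<Union>k. V_deg n k)"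
    unfolding slim_module_def by (rule span_mono)
  moreover have "span (\<Union>k. V_deg n k) \<subseteq> slim_module n"
    unfolding slim_module_def
    by (rule span_minimal) (auto simp: V_deg_def slim_module_def subspace_span)
  ultimately show ?thesis by blast
qed

end

theory Submission
  imports Defs "HOL-Algebra.Multiplicative_Group"
begin

text \<open>In degree \<open>k < n\<close> every graph with \<open>k\<close> edges is slim, and a repeated edge can be replaced by
  a detour through an unused vertex, so products of \<open>k\<close> linear forms are spanned by slim graphs.

  In top degree the complement of \<open>G\<close> is a spanning tree, so up to the Vandermonde product (which
  accounts for the sign) the module is spanned by the inverses of the products of \<open>x\<^sub>i - x\<^sub>j\<close> over
  the edges of a tree. Partial fractions reduce these to the paths starting at \<open>1\<close>, which are
  linearly independent. With \<open>N = n + 1\<close> and \<open>\<omega> = exp (2 \<pi> i / N)\<close>, the map sending a path \<open>w\<close> to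
  \<open>\<omega>\<close> to the power \<open>- maj w\<close> respects partial fractions, because up to a constant it is the
  restriction to paths of a product over the edges of a tree. As adding \<open>1\<close> modulo \<open>N\<close> to
  all letters lowers \<open>maj\<close> by \<open>1\<close>, this functional defines by Frobenius reciprocity a map to the
  induced representation. Rotating the positions of \<open>w\<close> changes \<open>maj\<close> by the number of cyclic
  descents, which is \<open>1\<close> only for the rotations of the identity; hence the \<open>\<omega>\<close>-twisted sum over
  these rotations is mapped to a generator of the induced representation (Klyachko's argument),
  and both sides have dimension \<open>n!\<close>.\<close>

section \<open>Linear algebra\<close>

abbreviation (input) fun_scale :: "complex \<Rightarrow> ('a \<Rightarrow> complex) \<Rightarrow> 'a \<Rightarrow> complex" where
  "fun_scale \<equiv> (\<lambda>a f x. a * f x)"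

interpretation fun_space: vector_space "fun_scale :: complex \<Rightarrow> ('a \<Rightarrow> complex) \<Rightarrow> 'a \<Rightarrow> complex"
  by unfold_locales (auto simp: algebra_simps)

lemma vector_space_complex: "vector_space ((*) :: complex \<Rightarrow> complex \<Rightarrow> complex)"
  by unfold_locales (simp_all add: algebra_simps)

interpretation cpoly: vector_space poly_scale
  by (rule vector_space_poly_scale)

lemma (in vector_space) independent_family:
  assumes "finite I"
    and zero: "\<And>a i. (\<Sum>i\<in>I. scale (a i) (f i)) = 0 \<Longrightarrow> i \<in> I \<Longrightarrow> a i = 0"
  shows "inj_on f I" "independent (f ` I)"
proof -
  show inj: "inj_on f I"
  proof (rule inj_onI, rule ccontr)
    fix i j assume indices: "i \<in> I" "j \<in> I" "f i = f j" "i \<noteq> j"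
    let ?a = "\<lambda>k. if k = i then 1 else if k = j then - 1 else 0"
    have "(\<Sum>k\<in>I. scale (?a k) (f k)) = (\<Sum>k\<in>{i, j}. scale (?a k) (f k))"
      using indices assms(1) by (intro sum.mono_neutral_right) auto
    also have "\<dots> = 0" using indices by simp
    finally show False using zero[of ?a i] indices(1) by simp
  qed
  show "independent (f ` I)"
  proof (rule independent_if_scalars_zero)
    fix g x assume g: "(\<Sum>x\<in>f ` I. scale (g x) x) = 0" and "x \<in> f ` I"
    then obtain i where i_in: "i \<in> I" "x = f i" by blast
    have "(\<Sum>i\<in>I. scale (g (f i)) (f i)) = 0" using g by (simp add: sum.reindex[OF inj])
    from zero[OF this i_in(1)] show "g x = 0" using i_in by simp
  qed (use assms(1) in simp)
qed

lemma (in vector_space_pair) linear_extend_family: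
  assumes "inj_on f I" "vs1.independent (f ` I)"
  obtains g where "Vector_Spaces.linear s1 s2 g" "\<And>i. i \<in> I \<Longrightarrow> g (f i) = h i"
proof -
  obtain g where "Vector_Spaces.linear s1 s2 g" "\<forall>x\<in>f ` I. g x = h (inv_into I f x)"
    using linear_independent_extend[OF assms(2), of "\<lambda>x. h (inv_into I f x)"] by blast
  then show ?thesis using that assms(1) by (simp add: inv_into_f_f)
qed

lemma (in vector_space) independent_if_card_le_spanned_independent:
  assumes "finite B" "independent C" "C \<subseteq> span B" "card B \<le> card C"
  shows "independent B"
proof
  assume "dependent B"
  then obtain b where b_in: "b \<in> B" "b \<in> span (B - {b})" unfolding dependent_def by blast
  then have "C \<subseteq> span (B - {b})" using assms(3) span_redundant[OF b_in(2)]
    by (simp add: insert_absorb)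
  then have "card C \<le> card (B - {b})"
    using independent_span_bound[of "B - {b}" C] assms(1,2) by simp
  then show False using card_Diff1_less[OF assms(1) b_in(1)] assms(4) by simp
qed

lemma (in vector_space) span_eq_if_card_le_independent:
  assumes "finite B" "independent C" "C \<subseteq> span B" "card B \<le> card C"
  shows "span C = span B"
proof
  show "span C \<subseteq> span B" using assms(3) by (rule span_minimal) (rule subspace_span)
  have "b \<in> span C" if b_in: "b \<in> B" for b
  proof (rule ccontr)
    assume notin: "b \<notin> span C"
    then have "independent (insert b C)" using assms(2) by (simp add: independent_insert)
    then have "card (insert b C) \<le> card B"
      using independent_span_bound[OF assms(1)] assms(3) span_base[OF b_in] by blast
    moreover have "finite C" using independent_span_bound[OF assms(1-3)] ..
    moreover have "b \<notin> C" using notin span_base by blast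
    ultimately show False using assms(4) by simp
  qed
  then show "span B \<subseteq> span C" by (intro span_minimal subspace_span) blast
qed

lemma (in Vector_Spaces.linear) bij_betw_span_if_card_le_independent:
  assumes "finite B" "vs2.independent C" "C \<subseteq> f ` vs1.span B" "card B \<le> card C"
  shows "bij_betw f (vs1.span B) (vs2.span C)"
proof -
  have C_spanned: "C \<subseteq> vs2.span (f ` B)" using assms(3) by (simp add: span_image)
  have "card C \<le> card (f ` B)"
    using vs2.independent_span_bound[of "f ` B" C] assms(1,2) C_spanned by simp
  then have card: "card (f ` B) = card B" "card (f ` B) \<le> card C"
    using card_image_le[OF assms(1), of f] assms(4) by simp_all
  have "vs2.independent (f ` B)"
    using vs2.independent_if_card_le_spanned_independent[OF _ assms(2) C_spanned card(2)] assms(1)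
    by simp
  then have "inj_on f (vs1.span B)"
    using inj_on_span_independent_image eq_card_imp_inj_on[OF assms(1) card(1)] by blast
  moreover have "f ` vs1.span B = vs2.span C"
    using vs2.span_eq_if_card_le_independent[OF _ assms(2) C_spanned card(2)] assms(1)
    by (simp add: span_image)
  ultimately show ?thesis by (simp add: bij_betw_def)
qed

section \<open>Representations\<close>

lemma
  assumes "representation G R"
  shows representation_group: "group G"
    and representation_vector_space: "vector_space (rep_scale R)"
    and representation_subspace: "module.subspace (rep_scale R) (rep_space R)"
    and representation_act_closed:
      "\<And>g v. g \<in> carrier G \<Longrightarrow> v \<in> rep_space R \<Longrightarrow> rep_act R g v \<in> rep_space R"
    and representation_act_add: "\<And>g v w. g \<in> carrier G \<Longrightarrow> v \<in> rep_space R \<Longrightarrow> w \<in> rep_space R \<Longrightarrow>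
      rep_act R g (v + w) = rep_act R g v + rep_act R g w"
    and representation_act_scale: "\<And>g a v. g \<in> carrier G \<Longrightarrow> v \<in> rep_space R \<Longrightarrow>
      rep_act R g (rep_scale R a v) = rep_scale R a (rep_act R g v)"
    and representation_act_one: "\<And>v. v \<in> rep_space R \<Longrightarrow> rep_act R \<one>\<^bsub>G\<^esub> v = v"
    and representation_act_mult: "\<And>g h v. g \<in> carrier G \<Longrightarrow> h \<in> carrier G \<Longrightarrow> v \<in> rep_space R \<Longrightarrow>
      rep_act R (g \<otimes>\<^bsub>G\<^esub> h) v = rep_act R g (rep_act R h v)"
  using assms by (simp_all add: representation_def)

definition rep_iso ::
    "('g, 'm) monoid_scheme \<Rightarrow> ('g, 'v::ab_group_add) rep \<Rightarrow> ('g, 'w::ab_group_add) rep \<Rightarrow>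
      ('v \<Rightarrow> 'w) \<Rightarrow> bool" where
  "rep_iso G R S \<phi> \<longleftrightarrow> bij_betw \<phi> (rep_space R) (rep_space S) \<and>
     (\<forall>v\<in>rep_space R. \<forall>w\<in>rep_space R. \<phi> (v + w) = \<phi> v + \<phi> w) \<and>
     (\<forall>a. \<forall>v\<in>rep_space R. \<phi> (rep_scale R a v) = rep_scale S a (\<phi> v)) \<and>
     (\<forall>g\<in>carrier G. \<forall>v\<in>rep_space R. \<phi> (rep_act R g v) = rep_act S g (\<phi> v))"

lemma
  assumes "rep_iso G R S \<phi>"
  shows rep_iso_bij_betw: "bij_betw \<phi> (rep_space R) (rep_space S)"
    and rep_iso_in_space: "\<And>v. v \<in> rep_space R \<Longrightarrow> \<phi> v \<in> rep_space S"
    and rep_iso_add: "\<And>v w. v \<in> rep_space R \<Longrightarrow> w \<in> rep_space R \<Longrightarrow> \<phi> (v + w) = \<phi> v + \<phi> w"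
    and rep_iso_scale: "\<And>a v. v \<in> rep_space R \<Longrightarrow> \<phi> (rep_scale R a v) = rep_scale S a (\<phi> v)"
    and rep_iso_act: "\<And>g v. g \<in> carrier G \<Longrightarrow> v \<in> rep_space R \<Longrightarrow> \<phi> (rep_act R g v) = rep_act S g (\<phi> v)"
  using assms bij_betw_apply by (auto simp: rep_iso_def)

lemma rep_isomorphic_iff_rep_iso:
  "rep_isomorphic G R S \<longleftrightarrow> representation G R \<and> representation G S \<and> (\<exists>\<phi>. rep_iso G R S \<phi>)"
  by (simp add: rep_isomorphic_def rep_iso_def)

lemma rep_iso_inv_into:
  assumes rep_R: "representation G R" and iso_RS: "rep_iso G R S \<phi>"
  shows "rep_iso G S R (inv_into (rep_space R) \<phi>)"
proof -
  let ?\<psi> = "inv_into (rep_space R) \<phi>"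
  interpret R: vector_space "rep_scale R" using rep_R by (rule representation_vector_space)
  note subspace_R = representation_subspace[OF rep_R]
  have inv_into_R: "?\<psi> v \<in> rep_space R" "\<phi> (?\<psi> v) = v" if "v \<in> rep_space S" for v
    using rep_iso_bij_betw[OF iso_RS] that by (auto simp: bij_betw_def inv_into_into f_inv_into_f)
  have eqI: "?\<psi> w = v" if "v \<in> rep_space R" "\<phi> v = w" for v w
    using that rep_iso_bij_betw[OF iso_RS] by (auto simp: bij_betw_def inv_into_f_f)
  have "?\<psi> (v + w) = ?\<psi> v + ?\<psi> w" if "v \<in> rep_space S" "w \<in> rep_space S" for v w
    using inv_into_R that subspace_R by (intro eqI)
      (auto simp: rep_iso_add[OF iso_RS] R.subspace_add)
  moreover have "?\<psi> (rep_scale S a v) = rep_scale R a (?\<psi> v)" if "v \<in> rep_space S" for a v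
    using inv_into_R that subspace_R by (intro eqI)
      (auto simp: rep_iso_scale[OF iso_RS] R.subspace_scale)
  moreover have "?\<psi> (rep_act S g v) = rep_act R g (?\<psi> v)" if "g \<in> carrier G" "v \<in> rep_space S"
    for g v
    using inv_into_R that by (intro eqI)
      (auto simp: rep_iso_act[OF iso_RS] representation_act_closed[OF rep_R])
  ultimately show ?thesis
    using bij_betw_inv_into[OF rep_iso_bij_betw[OF iso_RS]] by (simp add: rep_iso_def)
qed

lemma rep_iso_comp:
  assumes iso_RS: "rep_iso G R S \<phi>" and iso_ST: "rep_iso G S T \<psi>"
  shows "rep_iso G R T (\<psi> \<circ> \<phi>)"
  using bij_betw_trans[OF rep_iso_bij_betw[OF iso_RS] rep_iso_bij_betw[OF iso_ST]]
  by (simp add: rep_iso_def rep_iso_in_space[OF iso_RS]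
      rep_iso_add[OF iso_RS] rep_iso_scale[OF iso_RS] rep_iso_act[OF iso_RS]
      rep_iso_add[OF iso_ST] rep_iso_scale[OF iso_ST] rep_iso_act[OF iso_ST])

lemma rep_isomorphic_sym: "rep_isomorphic G R S \<Longrightarrow> rep_isomorphic G S R"
  unfolding rep_isomorphic_iff_rep_iso using rep_iso_inv_into by blast

lemma rep_isomorphic_trans:
  "rep_isomorphic G R S \<Longrightarrow> rep_isomorphic G S T \<Longrightarrow> rep_isomorphic G R T"
  unfolding rep_isomorphic_iff_rep_iso using rep_iso_comp by blast

lemma representation_linear_image:
  assumes rep_R: "representation G R"
    and lin: "Vector_Spaces.linear (rep_scale R) (rep_scale S) \<phi>"
    and img: "\<phi> ` rep_space R = rep_space S"
    and act: "\<And>g v. g \<in> carrier G \<Longrightarrow> v \<in> rep_space R \<Longrightarrow> rep_act S g (\<phi> v) = \<phi> (rep_act R g v)"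
  shows "representation G S"
proof -
  interpret \<phi>: Vector_Spaces.linear "rep_scale R" "rep_scale S" \<phi> by (rule lin)
  interpret G: group G using rep_R by (rule representation_group)
  note R_simps = act representation_act_closed[OF rep_R] representation_act_add[OF rep_R]
    representation_act_scale[OF rep_R] representation_act_one[OF rep_R]
    representation_act_mult[OF rep_R]
    \<phi>.vs1.subspace_add[OF representation_subspace[OF rep_R]]
    \<phi>.vs1.subspace_scale[OF representation_subspace[OF rep_R]]
  have "module.subspace (rep_scale S) (rep_space S)"
    using \<phi>.subspace_image[OF representation_subspace[OF rep_R]] by (simp only: img)
  then show ?thesis
    unfolding representation_def
    by (auto simp: G.is_group \<phi>.vs2.vector_space_axioms R_simps
        simp flip: img \<phi>.add \<phi>.scale)
qed

lemma rep_isomorphic_of_linear: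
  assumes rep_R: "representation G R"
    and lin: "Vector_Spaces.linear (rep_scale R) (rep_scale S) \<phi>"
    and bij: "bij_betw \<phi> (rep_space R) (rep_space S)"
    and act: "\<And>g v. g \<in> carrier G \<Longrightarrow> v \<in> rep_space R \<Longrightarrow> rep_act S g (\<phi> v) = \<phi> (rep_act R g v)"
  shows "rep_isomorphic G R S"
proof -
  interpret \<phi>: Vector_Spaces.linear "rep_scale R" "rep_scale S" \<phi> by (rule lin)
  have "rep_iso G R S \<phi>" using bij act by (simp add: rep_iso_def \<phi>.add \<phi>.scale)
  moreover have "representation G S"
    using rep_R lin _ act by (rule representation_linear_image)
      (use bij in \<open>simp add: bij_betw_def\<close>)
  ultimately show ?thesis using rep_R unfolding rep_isomorphic_iff_rep_iso by blast
qed

definition invariant_subspace ::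
    "('g, 'm) monoid_scheme \<Rightarrow> ('g, 'v::ab_group_add) rep \<Rightarrow> 'v set \<Rightarrow> bool" where
  "invariant_subspace G R W \<longleftrightarrow> module.subspace (rep_scale R) W \<and> W \<subseteq> rep_space R \<and>
     (\<forall>g\<in>carrier G. \<forall>w\<in>W. rep_act R g w \<in> W)"

lemma irreducible_rep_iff_invariant_subspace:
  "irreducible_rep G R \<longleftrightarrow> representation G R \<and> rep_space R \<noteq> {0} \<and>
     (\<forall>W. invariant_subspace G R W \<longrightarrow> W = {0} \<or> W = rep_space R)"
  by (simp add: irreducible_rep_def invariant_subspace_def)

lemma rep_iso_zero:
  assumes "representation G R" "rep_iso G R S \<phi>"
  shows "\<phi> 0 = 0"
proof -
  interpret vector_space "rep_scale R" using assms(1) by (rule representation_vector_space)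
  have "0 \<in> rep_space R" using representation_subspace[OF assms(1)] by (rule subspace_0)
  then show ?thesis using rep_iso_add[OF assms(2), of 0 0] by simp
qed

lemma invariant_subspace_image:
  assumes rep_R: "representation G R" and rep_S: "representation G S" and iso_RS: "rep_iso G R S \<phi>"
    and invariant_W: "invariant_subspace G R W"
  shows "invariant_subspace G S (\<phi> ` W)"
proof -
  interpret R: vector_space "rep_scale R" using rep_R by (rule representation_vector_space)
  interpret S: vector_space "rep_scale S" using rep_S by (rule representation_vector_space)
  have subspace_W: "R.subspace W" and W_subset: "w \<in> W \<Longrightarrow> w \<in> rep_space R"
    and act: "g \<in> carrier G \<Longrightarrow> w \<in> W \<Longrightarrow> rep_act R g w \<in> W" for g w
    using invariant_W by (auto simp: invariant_subspace_def)
  have "S.subspace (\<phi> ` W)"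
  proof (rule S.subspaceI)
    show "0 \<in> \<phi> ` W" using R.subspace_0[OF subspace_W] rep_iso_zero[OF rep_R iso_RS] by force
  qed (auto simp: W_subset R.subspace_add[OF subspace_W] R.subspace_scale[OF subspace_W]
      simp flip: rep_iso_add[OF iso_RS] rep_iso_scale[OF iso_RS])
  then show ?thesis
    by (auto simp: invariant_subspace_def W_subset act rep_iso_in_space[OF iso_RS]
        simp flip: rep_iso_act[OF iso_RS])
qed

lemma irreducible_rep_isomorphic:
  assumes "rep_isomorphic G R S" "irreducible_rep G S"
  shows "irreducible_rep G R"
proof -
  obtain \<phi> where rep_R: "representation G R" and rep_S: "representation G S"
    and iso_RS: "rep_iso G R S \<phi>"
    using assms(1) unfolding rep_isomorphic_iff_rep_iso by blast
  interpret R: vector_space "rep_scale R" using rep_R by (rule representation_vector_space)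
  have img: "\<phi> ` rep_space R = rep_space S" and inj: "inj_on \<phi> (rep_space R)"
    using rep_iso_bij_betw[OF iso_RS] by (auto simp: bij_betw_def)
  have zero: "\<phi> ` {0} = {0}" "{0} \<subseteq> rep_space R"
    using rep_iso_zero[OF rep_R iso_RS] R.subspace_0[OF representation_subspace[OF rep_R]] by auto
  have "W = {0} \<or> W = rep_space R" if invariant_W: "invariant_subspace G R W" for W
  proof -
    have "W \<subseteq> rep_space R" using invariant_W by (simp add: invariant_subspace_def)
    moreover have "\<phi> ` W = \<phi> ` {0} \<or> \<phi> ` W = \<phi> ` rep_space R"
      using assms(2) invariant_subspace_image[OF rep_R rep_S iso_RS invariant_W]
      unfolding irreducible_rep_iff_invariant_subspace img zero by blast
    ultimately show ?thesis using inj_on_image_eq_iff[OF inj] zero(2) by blast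
  qed
  moreover have "rep_space R \<noteq> {0}"
    using assms(2) img zero by (metis irreducible_rep_iff_invariant_subspace)
  ultimately show ?thesis using rep_R by (simp add: irreducible_rep_iff_invariant_subspace)
qed

definition linear_character :: "('g, 'm) monoid_scheme \<Rightarrow> ('g \<Rightarrow> complex) \<Rightarrow> bool" where
  "linear_character G \<chi> \<longleftrightarrow> \<chi> \<one>\<^bsub>G\<^esub> = 1 \<and>
     (\<forall>g\<in>carrier G. \<forall>h\<in>carrier G. \<chi> (g \<otimes>\<^bsub>G\<^esub> h) = \<chi> g * \<chi> h)"

lemma representation_tensor_char:
  assumes rep_R: "representation G R" and character: "linear_character G \<chi>"
  shows "representation G (tensor_char R \<chi>)"
proof -
  interpret R: vector_space "rep_scale R" using rep_R by (rule representation_vector_space)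
  show ?thesis
    using rep_R character by (auto simp: representation_def tensor_char_def linear_character_def
        R.scale_right_distrib R.subspace_scale mult.commute)
qed

lemma rep_isomorphic_tensor_char_right:
  assumes rep_R: "representation G R" and character: "linear_character G \<chi>"
    and inv: "\<And>g. g \<in> carrier G \<Longrightarrow> \<chi> g * \<psi> g = 1"
    and iso: "rep_isomorphic G (tensor_char R \<psi>) S"
  shows "rep_isomorphic G R (tensor_char S \<chi>)"
proof -
  interpret R: vector_space "rep_scale R" using rep_R by (rule representation_vector_space)
  obtain \<phi> where rep_S: "representation G S" and iso_RS: "rep_iso G (tensor_char R \<psi>) S \<phi>"
    using iso unfolding rep_isomorphic_iff_rep_iso by blast
  have "\<phi> (rep_act R g v) = rep_scale S (\<chi> g) (rep_act S g (\<phi> v))"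
    if g_in: "g \<in> carrier G" and v_space: "v \<in> rep_space R" for g v
  proof -
    have twisted_space: "rep_scale R (\<psi> g) (rep_act R g v) \<in> rep_space R"
      using representation_act_closed[OF rep_R g_in v_space]
        R.subspace_scale[OF representation_subspace[OF rep_R]] by simp
    have "\<phi> (rep_act R g v) = \<phi> (rep_scale R (\<chi> g) (rep_scale R (\<psi> g) (rep_act R g v)))"
      using inv[OF g_in] by simp
    also have "\<dots> = rep_scale S (\<chi> g) (rep_act S g (\<phi> v))"
      using rep_iso_scale[OF iso_RS, of _ "\<chi> g"] rep_iso_act[OF iso_RS g_in, of v] v_space
        twisted_space
      by (simp add: tensor_char_def del: R.scale_scale)
    finally show ?thesis .
  qed
  then have "rep_iso G R (tensor_char S \<chi>) \<phi>"
    using iso_RS by (simp add: rep_iso_def tensor_char_def)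
  then show ?thesis
    using rep_R representation_tensor_char[OF rep_S character] unfolding rep_isomorphic_iff_rep_iso
    by blast
qed

definition left_transversal :: "('g, 'm) monoid_scheme \<Rightarrow> 'g set \<Rightarrow> 'g set \<Rightarrow> bool" where
  "left_transversal G H W \<longleftrightarrow> W \<subseteq> carrier G \<and>
     (\<forall>g\<in>carrier G. \<exists>h\<in>H. g \<otimes>\<^bsub>G\<^esub> h \<in> W) \<and>
     (\<forall>v\<in>W. \<forall>w\<in>W. inv\<^bsub>G\<^esub> v \<otimes>\<^bsub>G\<^esub> w \<in> H \<longrightarrow> v = w)"

lemma induced_char_eqI:
  assumes group_G: "group G" and subgroup_H: "subgroup H G"
    and transversal: "left_transversal G H W"
    and f_space: "f \<in> rep_space (induced_rep G H (char_rep \<chi>))"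
    and h_space: "h \<in> rep_space (induced_rep G H (char_rep \<chi>))"
    and eq: "\<And>w. w \<in> W \<Longrightarrow> f w = h w"
  shows "f = h"
proof
  interpret group G by (rule group_G)
  fix g
  show "f g = h g"
  proof (cases "g \<in> carrier G")
    case True
    then obtain k where k_coset: "k \<in> H" "g \<otimes>\<^bsub>G\<^esub> k \<in> W" using transversal
      by (auto simp: left_transversal_def)
    then have k_carrier: "k \<in> carrier G" "inv\<^bsub>G\<^esub> k \<in> H" using subgroup_H
      by (auto simp: subgroup.mem_carrier subgroup.m_inv_closed)
    have "F g = \<chi> k * F (g \<otimes>\<^bsub>G\<^esub> k)" if "F \<in> rep_space (induced_rep G H (char_rep \<chi>))" for F
    proof -
      have "F ((g \<otimes>\<^bsub>G\<^esub> k) \<otimes>\<^bsub>G\<^esub> inv\<^bsub>G\<^esub> k) = \<chi> (inv\<^bsub>G\<^esub> (inv\<^bsub>G\<^esub> k)) * F (g \<otimes>\<^bsub>G\<^esub> k)"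
        using that True k_carrier by (simp add: induced_rep_def char_rep_def del: inv_inv)
      then show ?thesis using True k_carrier by (simp add: m_assoc)
    qed
    then show ?thesis using f_space h_space eq[OF k_coset(2)] by metis
  next
    case False
    then show ?thesis using f_space h_space by (simp add: induced_rep_def)
  qed
qed

locale semi_invariant_functional =
  fixes G :: "('g, 'm) monoid_scheme" (structure) and R :: "('g, 'v::ab_group_add) rep"
    and H :: "'g set" and \<chi> :: "'g \<Rightarrow> complex" and \<Lambda> :: "'v \<Rightarrow> complex"
  assumes rep_R: "representation G R"
    and linear_act: "\<And>g. g \<in> carrier G
        \<Longrightarrow> Vector_Spaces.linear (rep_scale R) (rep_scale R) (rep_act R g)"
    and subgroup_H: "subgroup H G"
    and linear_functional: "Vector_Spaces.linear (rep_scale R) (*) \<Lambda>"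
    and semi_invariant: "\<And>h v. h \<in> H \<Longrightarrow> v \<in> rep_space R \<Longrightarrow> \<Lambda> (rep_act R h v) = \<chi> h * \<Lambda> v"
begin

definition frobenius_map :: "'v \<Rightarrow> 'g \<Rightarrow> complex" where
  "frobenius_map v g = (if g \<in> carrier G then \<Lambda> (rep_act R (inv g) v) else 0)"

sublocale G: group G
  using rep_R by (rule representation_group)

sublocale functional: Vector_Spaces.linear "rep_scale R" "(*)" \<Lambda>
  by (rule linear_functional)

lemma linear_frobenius_map: "Vector_Spaces.linear (rep_scale R) fun_scale frobenius_map"
proof -
  note act = linear_act[unfolded Vector_Spaces.linear_iff]
  show ?thesis
    unfolding Vector_Spaces.linear_iff
    using act by (simp add: functional.vs1.vector_space_axioms fun_space.vector_space_axioms
        frobenius_map_def fun_eq_iff functional.add functional.scale)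
qed

sublocale frobenius_map: Vector_Spaces.linear "rep_scale R" fun_scale frobenius_map
  by (rule linear_frobenius_map)

lemma frobenius_map_in_induced:
  assumes "v \<in> rep_space R"
  shows "frobenius_map v \<in> rep_space (induced_rep G H (char_rep \<chi>))"
proof -
  have "frobenius_map v (g \<otimes> h) = \<chi> (inv h) * frobenius_map v g" if g_in: "g \<in> carrier G"
    and h_in: "h \<in> H" for g h
  proof -
    have h_carrier: "h \<in> carrier G" "inv h \<in> H" using subgroup_H h_in
      by (auto simp: subgroup.mem_carrier subgroup.m_inv_closed)
    then have "rep_act R (inv (g \<otimes> h)) v = rep_act R (inv h) (rep_act R (inv g) v)"
      using assms g_in by (simp add: G.inv_mult_group representation_act_mult[OF rep_R])
    then show ?thesis
      using assms g_in h_carrier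
      by (simp add: frobenius_map_def semi_invariant representation_act_closed[OF rep_R])
  qed
  then show ?thesis by (simp add: induced_rep_def char_rep_def frobenius_map_def)
qed

lemma frobenius_map_act:
  assumes "s \<in> carrier G" "v \<in> rep_space R"
  shows "rep_act (induced_rep G H (char_rep \<chi>)) s (frobenius_map v) = frobenius_map (rep_act R s v)"
  using assms
  by (auto simp: induced_rep_def frobenius_map_def fun_eq_iff G.inv_mult_group
    representation_act_mult[OF rep_R])

context
  fixes W f
  assumes transversal: "left_transversal G H W" and finite_W: "finite W"
    and f_supported: "f \<in> rep_space R" "\<Lambda> f \<noteq> 0" "\<And>g. g \<in> carrier G \<Longrightarrow> g \<notin> H \<Longrightarrow> \<Lambda> (rep_act R g f) = 0"
begin

lemma frobenius_map_translate:
  assumes "v \<in> W" "w \<in> W"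
  shows "frobenius_map (rep_act R w f) v = (if w = v then \<Lambda> f else 0)"
proof -
  have vw_carrier: "v \<in> carrier G" "w \<in> carrier G" using transversal assms
    by (auto simp: left_transversal_def)
  then have "frobenius_map (rep_act R w f) v = \<Lambda> (rep_act R (inv v \<otimes> w) f)"
    using f_supported(1) by (simp add: frobenius_map_def representation_act_mult[OF rep_R])
  moreover have "inv v \<otimes> w \<notin> H" if "w \<noteq> v"
    using transversal assms that by (auto simp: left_transversal_def)
  ultimately show ?thesis using vw_carrier f_supported
    by (auto simp: representation_act_one[OF rep_R])
qed

lemma frobenius_map_sum_translates:
  assumes "v \<in> W"
  shows "frobenius_map (\<Sum>w\<in>W. rep_scale R (a w) (rep_act R w f)) v = a v * \<Lambda> f"
proof -
  have "frobenius_map (\<Sum>w\<in>I. rep_scale R (a w) (rep_act R w f)) v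
      = (\<Sum>w\<in>I. a w * frobenius_map (rep_act R w f) v)" for I
    by (induction I rule: infinite_finite_induct)
      (simp_all add: frobenius_map.zero frobenius_map.add frobenius_map.scale)
  also have "(\<Sum>w\<in>W. a w * frobenius_map (rep_act R w f) v) = (\<Sum>w\<in>W. if w = v then a w * \<Lambda> f else 0)"
    using assms by (intro sum.cong) (auto simp: frobenius_map_translate)
  finally show ?thesis using assms finite_W by (simp add: sum.delta')
qed

lemma translate_in_space: "w \<in> W \<Longrightarrow> rep_act R w f \<in> rep_space R"
  using transversal f_supported(1)
  by (auto simp: left_transversal_def intro: representation_act_closed[OF rep_R])

lemma
  shows inj_on_frobenius_translates: "inj_on (\<lambda>w. frobenius_map (rep_act R w f)) W"
    and independent_frobenius_translates:
      "fun_space.independent ((\<lambda>w. frobenius_map (rep_act R w f)) ` W)"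
proof -
  have zero: "a v = 0" if "(\<Sum>w\<in>W. fun_scale (a w) (frobenius_map (rep_act R w f))) = 0" "v \<in> W"
    for a v
    using frobenius_map_sum_translates[OF that(2), of a] that(1) f_supported(2)
    by (simp add: frobenius_map.sum frobenius_map.scale)
  show "inj_on (\<lambda>w. frobenius_map (rep_act R w f)) W"
    and "fun_space.independent ((\<lambda>w. frobenius_map (rep_act R w f)) ` W)"
    by (rule fun_space.independent_family[OF finite_W], erule (1) zero)+
qed

lemma span_frobenius_translates:
  "fun_space.span ((\<lambda>w. frobenius_map (rep_act R w f)) ` W)
      = rep_space (induced_rep G H (char_rep \<chi>))"
    (is "fun_space.span ?C = ?I")
proof
  have "frobenius_map ` rep_space R \<subseteq> ?I" using frobenius_map_in_induced by blast
  moreover have "?C \<subseteq> frobenius_map ` rep_space R" using translate_in_space by blast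
  then have "fun_space.span ?C \<subseteq> frobenius_map ` rep_space R"
    by (rule fun_space.span_minimal)
      (rule frobenius_map.subspace_image[OF representation_subspace[OF rep_R]])
  ultimately show "fun_space.span ?C \<subseteq> ?I" by blast
  show "?I \<subseteq> fun_space.span ?C"
  proof
    fix F assume F_space: "F \<in> ?I"
    let ?v = "\<Sum>w\<in>W. rep_scale R (F w / \<Lambda> f) (rep_act R w f)"
    have "?v \<in> rep_space R"
      using representation_subspace[OF rep_R] translate_in_space
      by (intro functional.vs1.subspace_sum functional.vs1.subspace_scale)
    then have "frobenius_map ?v \<in> ?I" by (rule frobenius_map_in_induced)
    moreover have "frobenius_map ?v w = F w" if "w \<in> W" for w
      using frobenius_map_sum_translates[OF that, of "\<lambda>w. F w / \<Lambda> f"] f_supported(2) by simp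
    ultimately have "frobenius_map ?v = F"
      using induced_char_eqI[OF G.is_group subgroup_H transversal _ F_space] by blast
    moreover have "frobenius_map ?v \<in> fun_space.span ?C"
      unfolding frobenius_map.sum frobenius_map.scale
      by (intro fun_space.span_sum fun_space.span_scale fun_space.span_base) blast
    ultimately show "F \<in> fun_space.span ?C" by simp
  qed
qed

theorem rep_isomorphic_induced:
  assumes "rep_space R = functional.vs1.span B" "finite B" "card B \<le> card W"
  shows "rep_isomorphic G R (induced_rep G H (char_rep \<chi>))"
proof (rule rep_isomorphic_of_linear[where \<phi> = frobenius_map])
  let ?C = "(\<lambda>w. frobenius_map (rep_act R w f)) ` W"
  have "card B \<le> card ?C" using assms(3) inj_on_frobenius_translates by (simp add: card_image)
  moreover have "?C \<subseteq> frobenius_map ` functional.vs1.span B"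
    using translate_in_space assms(1) by blast
  ultimately show "bij_betw frobenius_map (rep_space R) (rep_space (induced_rep G H (char_rep \<chi>)))"
    unfolding span_frobenius_translates[symmetric] assms(1)
    using assms(2) independent_frobenius_translates
    by (intro frobenius_map.bij_betw_span_if_card_le_independent)
  show "Vector_Spaces.linear (rep_scale R) (rep_scale (induced_rep G H (char_rep \<chi>))) frobenius_map"
    using linear_frobenius_map by (simp add: induced_rep_def char_rep_def)
qed (use rep_R frobenius_map_act in auto)

end

end

section \<open>Substitution homomorphisms\<close>

definition monomial_value :: "('v \<Rightarrow> 'a::comm_monoid_mult) \<Rightarrow> ('v \<Rightarrow>\<^sub>0 nat) \<Rightarrow> 'a" where
  "monomial_value x m = (\<Prod>i\<in>Poly_Mapping.keys m. x i ^ Poly_Mapping.lookup m i)"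

definition poly_subst ::
    "('a::zero \<Rightarrow> 'b::comm_semiring_1) \<Rightarrow> ('v \<Rightarrow> 'b) \<Rightarrow> (('v \<Rightarrow>\<^sub>0 nat) \<Rightarrow>\<^sub>0 'a) \<Rightarrow> 'b" where
  "poly_subst \<kappa> x p = (\<Sum>m\<in>Poly_Mapping.keys p. \<kappa> (Poly_Mapping.lookup p m) * monomial_value x m)"

lemma monomial_value_superset:
  assumes "finite K" "Poly_Mapping.keys m \<subseteq> K"
  shows "monomial_value x m = (\<Prod>i\<in>K. x i ^ Poly_Mapping.lookup m i)"
  unfolding monomial_value_def using assms
  by (intro prod.mono_neutral_left) (auto simp: in_keys_iff)

lemma monomial_value_zero [simp]: "monomial_value x 0 = 1"
  by (simp add: monomial_value_def)

lemma monomial_value_single [simp]: "monomial_value x (Poly_Mapping.single i k) = x i ^ k"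
  by (cases "k = 0") (simp_all add: monomial_value_def)

lemma monomial_value_add: "monomial_value x (a + b) = monomial_value x a * monomial_value x b"
proof -
  let ?K = "Poly_Mapping.keys a \<union> Poly_Mapping.keys b"
  have "monomial_value x (a + b) = (\<Prod>i\<in>?K. x i ^ Poly_Mapping.lookup (a + b) i)"
    using keys_add[of a b] by (intro monomial_value_superset) auto
  also have "\<dots> = (\<Prod>i\<in>?K. x i ^ Poly_Mapping.lookup a i) * (\<Prod>i\<in>?K. x i ^ Poly_Mapping.lookup b i)"
    by (simp add: lookup_add power_add prod.distrib)
  also have "\<dots> = monomial_value x a * monomial_value x b"
    by (subst (1 2) monomial_value_superset[of ?K]) auto
  finally show ?thesis .
qed

lemma sum_single_lookup:
  "(\<Sum>m\<in>Poly_Mapping.keys p. Poly_Mapping.single m (Poly_Mapping.lookup p m)) = p"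
  by (rule poly_mapping_eqI)
    (auto simp: lookup_sum lookup_single when_def sum.delta' in_keys_iff)

locale poly_substitution =
  fixes \<kappa> :: "'a::comm_ring_1 \<Rightarrow> 'b::comm_ring_1" and x :: "'v \<Rightarrow> 'b"
  assumes coeff_zero: "\<kappa> 0 = 0" and coeff_one: "\<kappa> 1 = 1"
    and coeff_add: "\<kappa> (a + b) = \<kappa> a + \<kappa> b" and coeff_mult: "\<kappa> (a * b) = \<kappa> a * \<kappa> b"
begin

lemma subst_superset:
  assumes "finite K" "Poly_Mapping.keys p \<subseteq> K"
  shows "poly_subst \<kappa> x p = (\<Sum>m\<in>K. \<kappa> (Poly_Mapping.lookup p m) * monomial_value x m)"
  unfolding poly_subst_def using assms
  by (intro sum.mono_neutral_left) (auto simp: in_keys_iff coeff_zero)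

lemma subst_single: "poly_subst \<kappa> x (Poly_Mapping.single m a) = \<kappa> a * monomial_value x m"
  by (cases "a = 0") (simp_all add: poly_subst_def coeff_zero)

lemma subst_zero: "poly_subst \<kappa> x 0 = 0"
  by (simp add: poly_subst_def)

lemma subst_one: "poly_subst \<kappa> x 1 = 1"
  using subst_single[of 0 1] by (simp add: coeff_one)

lemma subst_add: "poly_subst \<kappa> x (p + q) = poly_subst \<kappa> x p + poly_subst \<kappa> x q"
proof -
  let ?K = "Poly_Mapping.keys p \<union> Poly_Mapping.keys q"
  have "poly_subst \<kappa> x (p + q) = (\<Sum>m\<in>?K. \<kappa> (Poly_Mapping.lookup (p + q) m) * monomial_value x m)"
    using keys_add[of p q] by (intro subst_superset) auto
  also have "\<dots> = (\<Sum>m\<in>?K. \<kappa> (Poly_Mapping.lookup p m) * monomial_value x m)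
      + (\<Sum>m\<in>?K. \<kappa> (Poly_Mapping.lookup q m) * monomial_value x m)"
    by (simp add: lookup_add coeff_add distrib_right sum.distrib)
  also have "\<dots> = poly_subst \<kappa> x p + poly_subst \<kappa> x q"
    by (subst (1 2) subst_superset[of ?K]) auto
  finally show ?thesis .
qed

lemma subst_minus: "poly_subst \<kappa> x (- p) = - poly_subst \<kappa> x p"
  using subst_add[of p "- p"] by (simp add: subst_zero add_eq_0_iff)

lemma subst_diff: "poly_subst \<kappa> x (p - q) = poly_subst \<kappa> x p - poly_subst \<kappa> x q"
  using subst_add[of p "- q"] by (simp add: subst_minus)

lemma subst_sum: "poly_subst \<kappa> x (\<Sum>i\<in>A. f i) = (\<Sum>i\<in>A. poly_subst \<kappa> x (f i))"
  by (induction A rule: infinite_finite_induct) (simp_all add: subst_zero subst_add)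

lemma subst_mult: "poly_subst \<kappa> x (p * q) = poly_subst \<kappa> x p * poly_subst \<kappa> x q"
proof -
  have "poly_subst \<kappa> x (p * q) = poly_subst \<kappa> x
     ((\<Sum>a\<in>Poly_Mapping.keys p. Poly_Mapping.single a (Poly_Mapping.lookup p a))
      * (\<Sum>b\<in>Poly_Mapping.keys q. Poly_Mapping.single b (Poly_Mapping.lookup q b)))"
    by (simp only: sum_single_lookup)
  also have "\<dots> = (\<Sum>a\<in>Poly_Mapping.keys p. \<Sum>b\<in>Poly_Mapping.keys q.
      (\<kappa> (Poly_Mapping.lookup p a) * monomial_value x a) *
      (\<kappa> (Poly_Mapping.lookup q b) * monomial_value x b))"
    by (simp add: sum_product mult_single subst_sum subst_single coeff_mult monomial_value_add
      ac_simps)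
  also have "\<dots> = poly_subst \<kappa> x p * poly_subst \<kappa> x q"
    by (simp add: poly_subst_def sum_product)
  finally show ?thesis .
qed

lemma subst_prod: "poly_subst \<kappa> x (\<Prod>i\<in>A. f i) = (\<Prod>i\<in>A. poly_subst \<kappa> x (f i))"
  by (induction A rule: infinite_finite_induct) (simp_all add: subst_one subst_mult)

lemma subst_power: "poly_subst \<kappa> x (p ^ k) = poly_subst \<kappa> x p ^ k"
  by (induction k) (simp_all add: subst_one subst_mult)

lemmas subst_simps = subst_zero subst_one subst_add subst_minus subst_diff subst_sum
  subst_mult subst_prod subst_power

end

abbreviation poly_eval :: "(nat \<Rightarrow> complex) \<Rightarrow> cpoly \<Rightarrow> complex" where
  "poly_eval \<equiv> poly_subst (\<lambda>a. a)"

interpretation poly_eval: poly_substitution "\<lambda>a::complex. a" x for x :: "nat \<Rightarrow> complex"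
  by unfold_locales simp_all

lemma poly_eval_var [simp]: "poly_eval x (poly_var i) = x i"
  by (simp add: poly_var_def poly_eval.subst_single)

lemma poly_eval_scale [simp]: "poly_eval x (poly_scale a p) = a * poly_eval x p"
  by (simp add: poly_scale_def poly_const_def poly_eval.subst_mult poly_eval.subst_single)

interpretation permute_vars: poly_substitution poly_const "\<lambda>i. poly_var (\<sigma> i)"
  rewrites "poly_subst poly_const (\<lambda>i. poly_var (\<sigma> i)) = permute_vars \<sigma>" for \<sigma> :: "nat \<Rightarrow> nat"
proof -
  show "poly_substitution poly_const"
    by unfold_locales (simp_all add: poly_const_def single_add mult_single)
  show "poly_subst poly_const (\<lambda>i. poly_var (\<sigma> i)) = permute_vars \<sigma>"
    by (simp add: fun_eq_iff permute_vars_def poly_subst_def monomial_value_def)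
qed

lemma permute_vars_const [simp]: "permute_vars \<sigma> (poly_const a) = poly_const a"
  unfolding poly_const_def by (subst permute_vars.subst_single) (simp add: poly_const_def)

lemma permute_vars_var [simp]: "permute_vars \<sigma> (poly_var i) = poly_var (\<sigma> i)"
  unfolding poly_var_def by (subst permute_vars.subst_single)
    (simp add: poly_const_def poly_var_def)

lemma permute_vars_scale [simp]: "permute_vars \<sigma> (poly_scale a p) = poly_scale a (permute_vars \<sigma> p)"
  by (simp add: poly_scale_def permute_vars.subst_mult)

lemma linear_permute_vars: "Vector_Spaces.linear poly_scale poly_scale (permute_vars \<sigma>)"
  by unfold_locales (simp_all add: permute_vars.subst_add)

lemma monomial_value_poly_var: "monomial_value poly_var m = Poly_Mapping.single m 1"
proof (induction m rule: update_induct)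
  case const
  then show ?case by simp
next
  case (update m i k)
  have "Poly_Mapping.update i k m = Poly_Mapping.single i k + m"
    using update by (intro poly_mapping_eqI)
      (auto simp: lookup_update lookup_add lookup_single when_def in_keys_iff)
  moreover have "poly_var i ^ k = Poly_Mapping.single (Poly_Mapping.single i k) 1" for k
    by (induction k) (simp_all add: poly_var_def mult_single flip: single_add)
  ultimately show ?case using update by (simp add: monomial_value_add mult_single)
qed

lemma permute_vars_ident [simp]: "permute_vars (\<lambda>x. x) p = p"
proof -
  have "permute_vars (\<lambda>x. x) p
      = (\<Sum>m\<in>Poly_Mapping.keys p. poly_const (Poly_Mapping.lookup p m) * monomial_value poly_var m)"
    by (simp add: permute_vars_def monomial_value_def)
  also have "\<dots> = (\<Sum>m\<in>Poly_Mapping.keys p. Poly_Mapping.single m (Poly_Mapping.lookup p m))"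
    by (simp add: monomial_value_poly_var poly_const_def mult_single)
  finally show ?thesis by (simp only: sum_single_lookup)
qed

lemma permute_vars_id [simp]: "permute_vars id p = p"
  by (simp add: id_def)

lemma permute_vars_comp: "permute_vars (\<sigma> \<circ> \<tau>) p = permute_vars \<sigma> (permute_vars \<tau> p)"
  by (simp add: permute_vars_def[of "\<sigma> \<circ> \<tau>"] permute_vars_def[of \<tau>] permute_vars.subst_simps)

section \<open>Homogeneous components of the slim module\<close>

abbreviation monomial_degree :: "(nat \<Rightarrow>\<^sub>0 nat) \<Rightarrow> nat" where
  "monomial_degree m \<equiv> \<Sum>i\<in>Poly_Mapping.keys m. Poly_Mapping.lookup m i"

definition homogeneous_part :: "nat \<Rightarrow> cpoly \<Rightarrow> cpoly" where
  "homogeneous_part k p = Poly_Mapping.mapp (\<lambda>m a. a when monomial_degree m = k) p"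

lemma lookup_homogeneous_part:
  "Poly_Mapping.lookup (homogeneous_part k p) m
      = (Poly_Mapping.lookup p m when monomial_degree m = k)"
  by (auto simp: homogeneous_part_def lookup_mapp when_def in_keys_iff)

lemma lookup_poly_scale [simp]:
  "Poly_Mapping.lookup (poly_scale a p) m = a * Poly_Mapping.lookup p m"
proof -
  have "poly_scale a p = Poly_Mapping.map ((*) a) p"
    by (simp add: poly_scale_def poly_const_def mult_map_scale_conv_mult)
  then show ?thesis by (simp add: Poly_Mapping.map.rep_eq when_def)
qed

lemma linear_homogeneous_part: "Vector_Spaces.linear poly_scale poly_scale (homogeneous_part k)"
  by unfold_locales
    (auto intro!: poly_mapping_eqI simp: lookup_homogeneous_part lookup_add when_def)

lemma homogeneous_part_of_homogeneous:
  assumes "homogeneous j p"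
  shows "homogeneous_part k p = (if j = k then p else 0)"
  using assms by (intro poly_mapping_eqI)
    (auto simp: lookup_homogeneous_part homogeneous_def when_def in_keys_iff)

lemma subspace_homogeneous: "cpoly.subspace {p. homogeneous k p}"
  unfolding cpoly.subspace_def homogeneous_def
  by (auto simp: in_keys_iff lookup_add dest!: set_mp[OF keys_add])

lemma finite_complete_edges [simp]: "finite (complete_edges N)"
  by (rule finite_subset[of _ "Pow {1..N}"]) (auto simp: complete_edges_def)

lemma card_complete_edges: "card (complete_edges N) = N choose 2"
  using n_subsets[of "{1..N}" 2] by (simp add: complete_edges_def)

lemma slim_finite: "slim n G \<Longrightarrow> finite G"
  by (auto simp: slim_def intro: finite_subset)

definition slim_polys :: "nat \<Rightarrow> nat \<Rightarrow> cpoly set" where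
  "slim_polys n k = graph_poly ` {G. slim n G \<and> card G = k}"

lemma V_deg_eq_span: "V_deg n k = cpoly.span (slim_polys n k)"
proof
  interpret Vector_Spaces.linear poly_scale poly_scale "homogeneous_part k"
    by (rule linear_homogeneous_part)
  let ?S = "{graph_poly G |G. slim n G}"
  have part: "homogeneous_part k ` ?S \<subseteq> cpoly.span (slim_polys n k)"
  proof clarify
    fix G assume slim_G: "slim n G"
    show "homogeneous_part k (graph_poly G) \<in> cpoly.span (slim_polys n k)"
      using slim_G
        homogeneous_part_of_homogeneous[OF homogeneous_graph_poly[OF slim_finite[OF slim_G]], of k]
      by (auto simp: slim_polys_def intro: cpoly.span_base cpoly.span_zero)
  qed
  show "V_deg n k \<subseteq> cpoly.span (slim_polys n k)"
  proof
    fix p assume p_in: "p \<in> V_deg n k"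
    then have "p \<in> cpoly.span ?S" "homogeneous_part k p = p"
      using homogeneous_part_of_homogeneous[of k p k] by (auto simp: V_deg_def slim_module_def)
    then have "p \<in> homogeneous_part k ` cpoly.span ?S" by (intro image_eqI[of p]) simp_all
    then have "p \<in> cpoly.span (homogeneous_part k ` ?S)" by (simp only: span_image)
    then show "p \<in> cpoly.span (slim_polys n k)"
      using cpoly.span_minimal[OF part cpoly.subspace_span] by blast
  qed
  have "slim_polys n k \<subseteq> {p. homogeneous k p}"
    by (auto simp: slim_polys_def intro: homogeneous_graph_poly slim_finite)
  then have "cpoly.span (slim_polys n k) \<subseteq> {p. homogeneous k p}"
    by (rule cpoly.span_minimal[OF _ subspace_homogeneous])
  moreover have "cpoly.span (slim_polys n k) \<subseteq> cpoly.span ?S"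
    by (rule cpoly.span_mono) (auto simp: slim_polys_def)
  ultimately show "cpoly.span (slim_polys n k) \<subseteq> V_deg n k"
    by (auto simp: V_deg_def slim_module_def)
qed

lemma subspace_V_deg: "cpoly.subspace (V_deg n k)"
  by (simp add: V_deg_eq_span cpoly.subspace_span)

lemma graph_poly_in_V_deg: "slim n G \<Longrightarrow> graph_poly G \<in> V_deg n (card G)"
  by (auto simp: V_deg_eq_span slim_polys_def intro: cpoly.span_base)

definition edge_sign :: "nat \<Rightarrow> nat \<Rightarrow> cpoly" where
  "edge_sign a b = (if a < b then 1 else - 1)"

lemma edge_sign_cases: "edge_sign a b \<in> {1, - 1}"
  by (simp add: edge_sign_def)

lemma edge_sign_square [simp]: "edge_sign a b * (edge_sign a b * p) = p"
  by (simp add: edge_sign_def)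

lemma sign_mult_mem_subspace:
  "cpoly.subspace W \<Longrightarrow> p \<in> W \<Longrightarrow> s \<in> {1, - 1} \<Longrightarrow> s * p \<in> W"
  by (auto intro: cpoly.subspace_neg)

lemma edge_poly_pair: "a \<noteq> b \<Longrightarrow> edge_poly {a, b} = edge_sign a b * (poly_var a - poly_var b)"
  by (auto simp: edge_poly_def edge_sign_def min_def max_def)

lemma complete_edgesE:
  assumes "e \<in> complete_edges N"
  obtains a b where "e = {a, b}" "a < b" "a \<in> {1..N}" "b \<in> {1..N}"
proof -
  obtain a b where "e = {a, b}" "a \<noteq> b" using assms by (auto simp: complete_edges_def card_2_iff)
  then show ?thesis using assms that[of a b] that[of b a]
    by (cases "a < b") (auto simp: complete_edges_def insert_commute)
qed

lemma pair_in_complete_edges: "{a, b} \<in> complete_edges N \<longleftrightarrow> a \<noteq> b \<and> a \<in> {1..N} \<and> b \<in> {1..N}"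
  by (auto simp: complete_edges_def card_insert_if)

lemma permute_vars_edge_poly:
  assumes "inj \<sigma>" "e \<in> complete_edges N"
  obtains s where "s \<in> {1, - 1}" "permute_vars \<sigma> (edge_poly e) = s * edge_poly (\<sigma> ` e)"
proof -
  obtain i j where endpoints: "e = {i, j}" "i < j" using assms(2) by (rule complete_edgesE)
  then have distinct: "\<sigma> i \<noteq> \<sigma> j" using assms(1) by (auto dest: injD)
  have "permute_vars \<sigma> (edge_poly e) = poly_var (\<sigma> i) - poly_var (\<sigma> j)"
    using endpoints by (simp add: edge_poly_pair edge_sign_def permute_vars.subst_diff)
  also have "\<dots> = edge_sign (\<sigma> i) (\<sigma> j) * edge_poly (\<sigma> ` e)"
    using endpoints distinct by (simp add: edge_poly_pair)
  finally show ?thesis by (rule that[OF edge_sign_cases])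
qed

lemma inj_image_image: "inj f \<Longrightarrow> inj ((`) f)"
  by (rule injI) (simp add: inj_image_eq_iff)

lemma permute_vars_graph_poly:
  assumes "inj \<sigma>" "G \<subseteq> complete_edges N"
  obtains s where "s \<in> {1, - 1}" "permute_vars \<sigma> (graph_poly G) = s * graph_poly ((`) \<sigma> ` G)"
proof -
  have "finite G" using assms(2) by (rule finite_subset) simp
  then have "\<exists>s\<in>{1, - 1}. permute_vars \<sigma> (graph_poly G) = s * graph_poly ((`) \<sigma> ` G)"
    using assms(2)
  proof (induction G rule: finite_induct)
    case empty
    show ?case by (simp add: graph_poly_def permute_vars.subst_one)
  next
    case (insert e G)
    from insert.IH insert.prems obtain s
      where sign_s: "s \<in> {1, - 1}" "permute_vars \<sigma> (graph_poly G) = s * graph_poly ((`) \<sigma> ` G)"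
      by blast
    obtain t where sign_t: "t \<in> {1, - 1}" "permute_vars \<sigma> (edge_poly e) = t * edge_poly (\<sigma> ` e)"
      using permute_vars_edge_poly[OF assms(1)] insert.prems by blast
    have "\<sigma> ` e \<notin> (`) \<sigma> ` G"
      using insert.hyps inj_image_image[OF assms(1)] by (simp add: inj_image_mem_iff)
    then have "permute_vars \<sigma> (graph_poly (insert e G)) = (s * t) * graph_poly ((`) \<sigma> ` insert e G)"
      using insert.hyps sign_s sign_t by (simp add: graph_poly_def permute_vars.subst_mult ac_simps)
    moreover have "s * t \<in> {1, - 1}" using sign_s sign_t by auto
    ultimately show ?case by blast
  qed
  then show ?thesis using that by blast
qed

lemma image_complete_edges:
  assumes "\<sigma> permutes {1..N}"
  shows "(`) \<sigma> ` complete_edges N = complete_edges N"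
proof (rule card_subset_eq)
  have "inj \<sigma>" using assms by (rule permutes_inj)
  then show "(`) \<sigma> ` complete_edges N \<subseteq> complete_edges N"
    using permutes_in_image[OF assms]
    by (auto simp: complete_edges_def card_image inj_on_subset subset_iff)
  show "card ((`) \<sigma> ` complete_edges N) = card (complete_edges N)"
    by (rule card_image) (rule inj_on_subset[OF inj_image_image[OF \<open>inj \<sigma>\<close>] subset_UNIV])
qed simp

lemma connected_graph_image:
  assumes "connected_graph A E" "f ` A = B"
  shows "connected_graph B ((`) f ` E)"
  unfolding connected_graph_def
proof (intro ballI)
  have "(f u, f v) \<in> {(a, b). {a, b} \<in> (`) f ` E}\<^sup>*" if "(u, v) \<in> {(a, b). {a, b} \<in> E}\<^sup>*" for u v
    using that
  proof induction
    case (step y z)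
    then have "(f y, f z) \<in> {(a, b). {a, b} \<in> (`) f ` E}"
      by (auto intro!: image_eqI[of _ _ "{y, z}"])
    then show ?case using step.IH by (rule rtrancl_into_rtrancl[rotated])
  qed simp
  then show "(u, v) \<in> {(a, b). {a, b} \<in> (`) f ` E}\<^sup>*" if "u \<in> B" "v \<in> B" for u v
    using that assms unfolding connected_graph_def by blast
qed

lemma slim_image:
  assumes "slim n G" "\<sigma> permutes {1..n + 1}"
  shows "slim n ((`) \<sigma> ` G)"
proof -
  have inj: "inj ((`) \<sigma>)" using inj_image_image[OF permutes_inj[OF assms(2)]] .
  have "complete_edges (n + 1) - (`) \<sigma> ` G = (`) \<sigma> ` (complete_edges (n + 1) - G)"
    using image_complete_edges[OF assms(2)] by (simp add: image_set_diff[OF inj])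
  moreover have "(`) \<sigma> ` G \<subseteq> complete_edges (n + 1)"
    using assms image_complete_edges[OF assms(2)] unfolding slim_def by blast
  ultimately show ?thesis
    using assms connected_graph_image[OF _ permutes_image[OF assms(2)]] by (simp add: slim_def)
qed

lemma permute_vars_V_deg:
  assumes "\<sigma> permutes {1..n + 1}" "p \<in> V_deg n k"
  shows "permute_vars \<sigma> p \<in> V_deg n k"
proof -
  interpret Vector_Spaces.linear poly_scale poly_scale "permute_vars \<sigma>"
    by (rule linear_permute_vars)
  have inj: "inj \<sigma>" using assms(1) by (rule permutes_inj)
  have "permute_vars \<sigma> (graph_poly G) \<in> V_deg n (card G)" if slim_G: "slim n G" for G
  proof -
    have "G \<subseteq> complete_edges (n + 1)" using slim_G by (simp add: slim_def)
    then obtain s where sign_s: "s \<in> {1, - 1}"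
      "permute_vars \<sigma> (graph_poly G) = s * graph_poly ((`) \<sigma> ` G)"
      using permute_vars_graph_poly[OF inj] by blast
    have "card ((`) \<sigma> ` G) = card G"
      by (rule card_image) (rule inj_on_subset[OF inj_image_image[OF inj] subset_UNIV])
    then have "graph_poly ((`) \<sigma> ` G) \<in> V_deg n (card G)"
      using graph_poly_in_V_deg[OF slim_image[OF slim_G assms(1)]] by simp
    then show ?thesis unfolding sign_s(2) using sign_s(1)
      by (rule sign_mult_mem_subspace[OF subspace_V_deg])
  qed
  then have "permute_vars \<sigma> ` slim_polys n k \<subseteq> V_deg n k" by (auto simp: slim_polys_def)
  then have "cpoly.span (permute_vars \<sigma> ` slim_polys n k) \<subseteq> V_deg n k"
    by (rule cpoly.span_minimal[OF _ subspace_V_deg])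
  then show ?thesis using assms(2) by (auto simp: V_deg_eq_span span_image)
qed

lemma representation_V_rep: "representation (sym_group (n + 1)) (V_rep n k)"
  using permute_vars_V_deg
  by (auto simp: representation_def V_rep_def sym_group_is_group sym_group_carrier sym_group_mult
      sym_group_one vector_space_poly_scale subspace_V_deg permute_vars.subst_add permute_vars_comp)

section \<open>Low degrees\<close>

lemma exists_common_non_neighbour:
  assumes "finite G" "u \<in> A" "v \<in> A" "u \<noteq> v" "card (G - {{u, v}}) < card (A - {u, v})"
  obtains w where "w \<in> A" "w \<noteq> u" "w \<noteq> v" "{u, w} \<notin> G" "{v, w} \<notin> G"
proof (rule ccontr)
  assume "\<not> thesis"
  with that have covered: "{u, w} \<in> G \<or> {v, w} \<in> G" if "w \<in> A - {u, v}" for w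
    using that by blast
  define f where "f w = (if {u, w} \<in> G then {u, w} else {v, w})" for w
  have "inj_on f (A - {u, v})"
    by (auto simp: inj_on_def f_def doubleton_eq_iff split: if_splits)
  moreover have "f w \<in> G - {{u, v}}" if "w \<in> A - {u, v}" for w
    using covered[OF that] that by (auto simp: f_def doubleton_eq_iff)
  ultimately have "card (A - {u, v}) \<le> card (G - {{u, v}})"
    using assms(1) by (intro card_inj_on_le) auto
  then show False using assms(5) by simp
qed

lemma slim_of_card_less:
  assumes "G \<subseteq> complete_edges (n + 1)" "card G < n"
  shows "slim n G"
  unfolding slim_def connected_graph_def
proof (intro conjI ballI)
  have finite_G: "finite G" using assms(1) by (rule finite_subset) simp
  let ?R = "{(a, b). {a, b} \<in> complete_edges (n + 1) - G}"
  fix u v assume uv_vertices: "u \<in> {1..n + 1}" "v \<in> {1..n + 1}"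
  consider (equal) "u = v" | (non_edge) "u \<noteq> v" "{u, v} \<notin> G" | (edge) "u \<noteq> v" "{u, v} \<in> G"
    by blast
  then show "(u, v) \<in> ?R\<^sup>*"
  proof cases
    case non_edge
    then have "(u, v) \<in> ?R" using uv_vertices by (simp add: pair_in_complete_edges)
    then show ?thesis by blast
  next
    case edge
    then have "card G > 0" using finite_G by (auto simp: card_gt_0_iff)
    moreover have "card ({1..n + 1} - {u, v}) = n - 1" using edge uv_vertices
      by (subst card_Diff_subset) auto
    ultimately have "card (G - {{u, v}}) < card ({1..n + 1} - {u, v})"
      using edge finite_G assms(2) by simp
    then obtain w where "w \<in> {1..n + 1}" "w \<noteq> u" "w \<noteq> v" "{u, w} \<notin> G" "{v, w} \<notin> G"
      using exists_common_non_neighbour[OF finite_G uv_vertices] edge(1) by blast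
    then have "(u, w) \<in> ?R" "(w, v) \<in> ?R"
      using uv_vertices by (auto simp: pair_in_complete_edges insert_commute)
    then show ?thesis by (meson r_into_rtrancl rtrancl_trans)
  qed simp
qed (rule assms(1))

lemma slim_polys_0:
  assumes "n \<ge> 1"
  shows "slim_polys n 0 = {1}"
proof -
  have "{G. slim n G \<and> card G = 0} = {{}}"
    using slim_of_card_less[of "{}" n] slim_finite[of n] assms by auto
  then show ?thesis by (simp add: slim_polys_def graph_poly_def)
qed

lemma slim_polys_1:
  assumes "n \<ge> 2"
  shows "slim_polys n 1 = edge_poly ` complete_edges (n + 1)"
proof -
  have "slim n {e} \<longleftrightarrow> e \<in> complete_edges (n + 1)" for e
    using slim_of_card_less[of "{e}" n] assms by (auto simp: slim_def)
  then have "{G. slim n G \<and> card G = 1} = (\<lambda>e. {e}) ` complete_edges (n + 1)"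
    by (auto simp: card_1_singleton_iff)
  then show ?thesis by (simp add: slim_polys_def image_image graph_poly_def)
qed

lemma V_deg_0: "n \<ge> 1 \<Longrightarrow> V_deg n 0 = cpoly.span {1}"
  by (simp add: V_deg_eq_span slim_polys_0)

lemma edge_poly_in_V_deg_1: "n \<ge> 2 \<Longrightarrow> e \<in> complete_edges (n + 1) \<Longrightarrow> edge_poly e \<in> V_deg n 1"
  unfolding V_deg_eq_span by (subst slim_polys_1) (auto intro: cpoly.span_base)

lemma span_mult_mem_subspace:
  assumes subspace_W: "cpoly.subspace W" and mem: "\<And>s t. s \<in> S \<Longrightarrow> t \<in> T \<Longrightarrow> s * t \<in> W"
    and "p \<in> cpoly.span S" "q \<in> cpoly.span T"
  shows "p * q \<in> W"
proof -
  have right: "cpoly.subspace {q. s * q \<in> W}" for s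
    using subspace_W by (auto simp: cpoly.subspace_def poly_scale_def distrib_left
      mult.left_commute[of s])
  have left: "cpoly.subspace {p. p * q \<in> W}"
    using right[of q] by (simp add: mult.commute)
  have "s * q \<in> W" if "s \<in> S" for s
    using cpoly.span_minimal[OF _ right[of s], of T] mem that assms(4) by blast
  then show ?thesis using cpoly.span_minimal[OF _ left, of S] assms(3) by blast
qed

lemma edge_poly_mult_new_edge:
  assumes "slim n G" "Suc (card G) < n" "e \<in> complete_edges (n + 1)" "e \<notin> G"
  shows "edge_poly e * graph_poly G \<in> V_deg n (Suc (card G))"
proof -
  have finite_G: "finite G" using assms(1) by (rule slim_finite)
  then have card: "card (insert e G) = Suc (card G)" using assms(4) by simp
  moreover have "slim n (insert e G)"
    using assms card by (intro slim_of_card_less) (auto simp: slim_def)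
  moreover have "graph_poly (insert e G) = edge_poly e * graph_poly G"
    using finite_G assms(4) by (simp add: graph_poly_def)
  ultimately show ?thesis using graph_poly_in_V_deg by metis
qed

lemma edge_poly_detour:
  assumes "i \<noteq> j" "i \<noteq> v" "j \<noteq> v"
  shows "edge_poly {i, j} =
    edge_sign i j * (edge_sign i v * edge_poly {i, v} - edge_sign j v * edge_poly {j, v})"
  using assms by (simp add: edge_poly_pair)

lemma edge_poly_mult_graph_poly:
  assumes slim_G: "slim n G" and card: "Suc (card G) < n" and e_edge: "e \<in> complete_edges (n + 1)"
  shows "edge_poly e * graph_poly G \<in> V_deg n (Suc (card G))"
proof (cases "e \<in> G")
  case False
  with assms show ?thesis by (rule edge_poly_mult_new_edge)
next
  case True
  obtain i j where endpoints: "e = {i, j}" "i < j" "i \<in> {1..n + 1}" "j \<in> {1..n + 1}"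
    using e_edge by (rule complete_edgesE)
  have finite_G: "finite G" using slim_G by (rule slim_finite)
  have "card ({1..n + 1} - {i, j}) = n - 1" using endpoints by (subst card_Diff_subset) auto
  then have "card (G - {{i, j}}) < card ({1..n + 1} - {i, j})" using True endpoints finite_G card
    by simp
  then obtain v where v_vertex: "v \<in> {1..n + 1}" "v \<noteq> i" "v \<noteq> j" "{i, v} \<notin> G" "{j, v} \<notin> G"
    using exists_common_non_neighbour[OF finite_G endpoints(3,4)] endpoints(2) by blast
  have mem: "edge_sign a v * (edge_poly {a, v} * graph_poly G) \<in> V_deg n (Suc (card G))"
    if "a \<in> {i, j}" for a
    using that endpoints v_vertex slim_G card edge_sign_cases
    by (intro sign_mult_mem_subspace[OF subspace_V_deg] edge_poly_mult_new_edge)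
      (auto simp: pair_in_complete_edges)
  have "edge_poly e * graph_poly G = edge_sign i j *
      (edge_sign i v * (edge_poly {i, v} * graph_poly G)
        - edge_sign j v * (edge_poly {j, v} * graph_poly G))"
    unfolding endpoints(1) by (subst edge_poly_detour[of i j v])
      (use endpoints v_vertex in \<open>simp_all add: algebra_simps\<close>)
  then show ?thesis
    using mem[of i] mem[of j] edge_sign_cases
    by (simp only: sign_mult_mem_subspace[OF subspace_V_deg] cpoly.subspace_diff[OF subspace_V_deg]
      insert_iff simp_thms)
qed

lemma V_deg_mult:
  assumes "Suc k < n" "p \<in> V_deg n 1" "q \<in> V_deg n k"
  shows "p * q \<in> V_deg n (Suc k)"
proof (rule span_mult_mem_subspace[OF subspace_V_deg _ assms(2,3)[unfolded V_deg_eq_span]])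
  show "s * t \<in> V_deg n (Suc k)" if "s \<in> slim_polys n 1" "t \<in> slim_polys n k" for s t
    using that assms(1) slim_polys_1[of n] edge_poly_mult_graph_poly
    by (auto simp: slim_polys_def)
qed

lemma V_deg_eq_span_products:
  assumes "k < n"
  shows "V_deg n k = cpoly.span {(\<Prod>i<k. f i) |f. \<forall>i<k. f i \<in> V_deg n 1}"
proof
  let ?P = "{(\<Prod>i<k. f i) |f. \<forall>i<k. f i \<in> V_deg n 1}"
  have "graph_poly G \<in> ?P" if slim_G: "slim n G" "card G = k" for G
  proof -
    obtain h where enum: "bij_betw h {..<k} G"
      using ex_bij_betw_nat_finite[OF slim_finite[OF slim_G(1)]] slim_G(2)
      by (auto simp: atLeast0LessThan)
    have "edge_poly (h i) \<in> V_deg n 1" if "i < k" for i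
      using enum slim_G that assms
      by (intro edge_poly_in_V_deg_1) (auto simp: slim_def bij_betw_def)
    moreover have "graph_poly G = (\<Prod>i<k. edge_poly (h i))"
      unfolding graph_poly_def by (rule prod.reindex_bij_betw[OF enum, symmetric])
    ultimately show ?thesis by blast
  qed
  then show "V_deg n k \<subseteq> cpoly.span ?P"
    unfolding V_deg_eq_span slim_polys_def by (intro cpoly.span_mono) blast
  have "(\<Prod>i<j. f i) \<in> V_deg n j" if "\<forall>i<j. f i \<in> V_deg n 1" "j < n" for f j
    using that
  proof (induction j)
    case 0
    then show ?case by (simp add: V_deg_0 cpoly.span_base)
  next
    case (Suc j)
    then show ?case using V_deg_mult[of j n "f j" "\<Prod>i<j. f i"] by (simp add: mult.commute)
  qed
  then have "?P \<subseteq> V_deg n k" using assms by blast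
  then show "cpoly.span ?P \<subseteq> V_deg n k" by (rule cpoly.span_minimal[OF _ subspace_V_deg])
qed

lemma representation_char_rep_trivial:
  assumes "group G"
  shows "representation G (char_rep (\<lambda>_. 1))"
proof -
  interpret C: vector_space "(*) :: complex \<Rightarrow> complex \<Rightarrow> complex" by (rule vector_space_complex)
  show ?thesis
    using assms by (simp add: representation_def char_rep_def C.vector_space_axioms C.subspace_UNIV)
qed

lemma rep_isomorphic_V_rep_0:
  assumes "n \<ge> 1"
  shows "rep_isomorphic (sym_group (n + 1)) (V_rep n 0) (char_rep (\<lambda>_. 1))"
proof (rule rep_isomorphic_sym, rule rep_isomorphic_of_linear[where \<phi> = "\<lambda>a. poly_scale a 1"])
  show "representation (sym_group (n + 1)) (char_rep (\<lambda>_. 1))"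
    by (rule representation_char_rep_trivial) (rule sym_group_is_group)
  show "Vector_Spaces.linear (rep_scale (char_rep (\<lambda>_. 1))) (rep_scale (V_rep n 0))
      (\<lambda>a. poly_scale a 1)"
    unfolding Vector_Spaces.linear_iff
    by (simp add: char_rep_def V_rep_def vector_space_complex vector_space_poly_scale
      cpoly.scale_left_distrib)
  show "bij_betw (\<lambda>a. poly_scale a 1) (rep_space (char_rep (\<lambda>_. 1))) (rep_space (V_rep n 0))"
    using assms
    by (simp add: bij_betw_def inj_on_def char_rep_def V_rep_def V_deg_0 cpoly.span_singleton
        cpoly.scale_cancel_right)
qed (simp_all add: char_rep_def V_rep_def permute_vars.subst_one)

section \<open>The reflection representation\<close>

definition unit_vec :: "'a \<Rightarrow> 'a \<Rightarrow> complex" where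
  "unit_vec i = (\<lambda>j. if j = i then 1 else 0)"

abbreviation sum_zero_space :: "nat \<Rightarrow> (nat \<Rightarrow> complex) set" where
  "sum_zero_space N \<equiv> rep_space (reflection_rep N)"

lemma mem_sum_zero_space:
  "v \<in> sum_zero_space N \<longleftrightarrow> (\<forall>i. i \<notin> {1..N} \<longrightarrow> v i = 0) \<and> (\<Sum>i=1..N. v i) = 0"
  by (simp add: reflection_rep_def)

lemma subspace_sum_zero_space: "fun_space.subspace (sum_zero_space N)"
  by (auto simp: fun_space.subspace_def mem_sum_zero_space sum.distrib simp flip: sum_distrib_left)

lemma sum_zero_space_comp_permutes:
  assumes \<sigma>_permutes: "\<sigma> permutes {1..N}" and v_space: "v \<in> sum_zero_space N"
  shows "(\<lambda>i. v (\<sigma> i)) \<in> sum_zero_space N"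
  using v_space sum.permute[OF \<sigma>_permutes, of v] permutes_not_in[OF \<sigma>_permutes]
  by (simp add: mem_sum_zero_space comp_def)

lemma representation_reflection_rep: "representation (sym_group N) (reflection_rep N)"
proof -
  have "inv' (\<sigma> \<circ> \<tau>) = inv' \<tau> \<circ> inv' \<sigma>" if "\<sigma> permutes {1..N}" "\<tau> permutes {1..N}" for \<sigma> \<tau>
    using that by (intro o_inv_distrib permutes_bij)
  then show ?thesis
    using subspace_sum_zero_space[of N] sum_zero_space_comp_permutes[OF permutes_inv]
      fun_space.vector_space_axioms
    by (auto simp: representation_def sym_group_is_group sym_group_carrier sym_group_mult
        sym_group_one) (auto simp: reflection_rep_def fun_eq_iff)
qed

lemma unit_vec_diff_in_sum_zero_space:
  "a \<in> {1..N} \<Longrightarrow> b \<in> {1..N} \<Longrightarrow> unit_vec a - unit_vec b \<in> sum_zero_space N"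
  by (auto simp: mem_sum_zero_space unit_vec_def sum_subtractf)

lemma sum_zero_space_expand:
  assumes "v \<in> sum_zero_space N"
  shows "v = (\<Sum>a=1..N. fun_scale (v a) (unit_vec a - unit_vec 1))"
proof
  fix j
  have "(\<Sum>a=1..M. fun_scale (v a) (unit_vec a - unit_vec 1)) j
      = (\<Sum>a=1..M. v a * unit_vec a j) - (\<Sum>a=1..M. v a) * unit_vec 1 j" for M
    by (induction M) (simp_all add: algebra_simps)
  also have "(\<Sum>a=1..N. v a * unit_vec a j) = (\<Sum>a=1..N. if a = j then v a else 0)"
    by (rule sum.cong) (auto simp: unit_vec_def)
  finally show "v j = (\<Sum>a=1..N. fun_scale (v a) (unit_vec a - unit_vec 1)) j"
    using assms by (auto simp: mem_sum_zero_space sum.delta')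
qed

lemma sum_zero_space_subset:
  assumes "fun_space.subspace W" "\<And>a. a \<in> {2..N} \<Longrightarrow> unit_vec a - unit_vec 1 \<in> W"
  shows "sum_zero_space N \<subseteq> W"
proof
  fix v assume v_space: "v \<in> sum_zero_space N"
  have "unit_vec a - unit_vec 1 \<in> W" if "a \<in> {1..N}" for a
    using assms(2)[of a] that fun_space.subspace_0[OF assms(1)] by (cases "a = 1") auto
  then have "(\<Sum>a=1..N. fun_scale (v a) (unit_vec a - unit_vec 1)) \<in> W"
    by (intro fun_space.subspace_sum assms(1) fun_space.subspace_scale)
  then show "v \<in> W" using sum_zero_space_expand[OF v_space] by simp
qed

lemma exists_permutes_two_points:
  assumes "a \<in> S" "b \<in> S" "a \<noteq> b" "c \<in> S" "d \<in> S" "c \<noteq> d"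
  obtains \<pi> where "\<pi> permutes S" "\<pi> c = a" "\<pi> d = b"
proof
  define b' where "b' = transpose c a b"
  have "b' \<in> S" "b' \<noteq> c" using assms by (auto simp: b'_def transpose_def)
  then show "(transpose c a \<circ> transpose d b') permutes S"
    using assms by (intro permutes_compose permutes_swap_id)
  show "(transpose c a \<circ> transpose d b') c = a" "(transpose c a \<circ> transpose d b') d = b"
    using assms \<open>b' \<noteq> c\<close> by (auto simp: b'_def transpose_def)
qed

lemma sum_zero_space_nonconstant:
  assumes "w \<in> sum_zero_space N" "w \<noteq> 0"
  obtains i j where "i \<in> {1..N}" "j \<in> {1..N}" "w i \<noteq> w j"
proof -
  obtain i where w_i_nonzero: "w i \<noteq> 0" using assms(2) by (auto simp: fun_eq_iff)
  then have i_in: "i \<in> {1..N}" using assms(1) by (auto simp: mem_sum_zero_space)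
  have "\<exists>j\<in>{1..N}. w i \<noteq> w j"
  proof (rule ccontr)
    assume "\<not> ?thesis"
    then have "(\<Sum>j=1..N. w j) = (\<Sum>j=1..N. w i)" by (intro sum.cong) auto
    then show False using assms(1) w_i_nonzero i_in by (simp add: mem_sum_zero_space)
  qed
  then show ?thesis using i_in that by blast
qed

lemma unit_vec_comp_inv_permutes:
  assumes "\<pi> permutes S"
  shows "(\<lambda>k. (unit_vec i - unit_vec j) (inv' \<pi> k)) = unit_vec (\<pi> i) - unit_vec (\<pi> j)"
  using permutes_inv_eq[OF assms] by (auto simp: fun_eq_iff unit_vec_def)

lemma transposition_diff_eq_unit_vec:
  fixes w :: "'a \<Rightarrow> complex"
  assumes "w i \<noteq> w j"
  shows "fun_scale (inverse (w i - w j)) (w - (\<lambda>k. w (transpose i j k))) = unit_vec i - unit_vec j"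
  using assms by (auto simp: fun_eq_iff unit_vec_def transpose_def field_simps)

lemma irreducible_reflection_rep:
  assumes "N \<ge> 2"
  shows "irreducible_rep (sym_group N) (reflection_rep N)"
  unfolding irreducible_rep_iff_invariant_subspace
proof (intro conjI allI impI)
  show "representation (sym_group N) (reflection_rep N)" by (rule representation_reflection_rep)
  have "unit_vec 1 - unit_vec 2 \<in> sum_zero_space N" "unit_vec (1::nat) - unit_vec 2 \<noteq> 0"
    using unit_vec_diff_in_sum_zero_space[of 1 N 2] assms
    by (auto simp: unit_vec_def fun_eq_iff split: if_splits)
  then show "sum_zero_space N \<noteq> {0}" by blast
  fix W assume "invariant_subspace (sym_group N) (reflection_rep N) W"
  then have subspace_W: "fun_space.subspace W" "W \<subseteq> sum_zero_space N"
    and inv: "\<sigma> permutes {1..N} \<Longrightarrow> w \<in> W \<Longrightarrow> (\<lambda>i. w (inv' \<sigma> i)) \<in> W" for \<sigma> w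
    by (auto simp: invariant_subspace_def reflection_rep_def sym_group_carrier)
  show "W = {0} \<or> W = sum_zero_space N"
  proof (cases "W = {0}")
    case False
    then obtain w where w_in: "w \<in> W" "w \<noteq> 0" using fun_space.subspace_0[OF subspace_W(1)] by blast
    then obtain i j where distinct_values: "i \<in> {1..N}" "j \<in> {1..N}" "w i \<noteq> w j"
      using sum_zero_space_nonconstant subspace_W(2) by blast
    have "fun_scale (inverse (w i - w j)) (w - (\<lambda>k. w (transpose i j k))) \<in> W"
      using inv[OF permutes_swap_id[OF distinct_values(1,2)] w_in(1)] w_in(1)
      by (intro fun_space.subspace_scale fun_space.subspace_diff subspace_W(1)) simp_all
    then have diff: "unit_vec i - unit_vec j \<in> W"
      unfolding transposition_diff_eq_unit_vec[of w, OF distinct_values(3)] .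
    have "unit_vec a - unit_vec 1 \<in> W" if "a \<in> {2..N}" for a
    proof -
      have "a \<in> {1..N}" "1 \<in> {1..N}" "a \<noteq> 1" "i \<noteq> j" using that distinct_values(3) by auto
      then obtain \<pi> where \<pi>_permutes: "\<pi> permutes {1..N}" "\<pi> i = a" "\<pi> j = 1"
        using exists_permutes_two_points distinct_values(1,2) by metis
      show ?thesis using inv[OF \<pi>_permutes(1) diff]
        unfolding unit_vec_comp_inv_permutes[OF \<pi>_permutes(1)] \<pi>_permutes(2,3) .
    qed
    then show ?thesis using sum_zero_space_subset[OF subspace_W(1)] subspace_W(2) by blast
  qed simp
qed

definition linear_form :: "nat \<Rightarrow> (nat \<Rightarrow> complex) \<Rightarrow> cpoly" where
  "linear_form N v = (\<Sum>i=1..N. poly_scale (v i) (poly_var i))"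

lemma linear_linear_form: "Vector_Spaces.linear fun_scale poly_scale (linear_form N)"
  by unfold_locales
    (simp_all add: linear_form_def cpoly.scale_left_distrib sum.distrib cpoly.scale_sum_right)

interpretation linear_form: Vector_Spaces.linear fun_scale poly_scale "linear_form N" for N
  by (rule linear_linear_form)

lemma linear_form_unit_vec:
  assumes "a \<in> {1..N}"
  shows "linear_form N (unit_vec a) = poly_var a"
proof -
  have "linear_form N (unit_vec a) = (\<Sum>i=1..N. if i = a then poly_var i else 0)"
    unfolding linear_form_def by (rule sum.cong) (auto simp: unit_vec_def)
  then show ?thesis using assms by (simp add: sum.delta')
qed

lemma poly_var_eq_iff [simp]: "poly_var a = poly_var b \<longleftrightarrow> a = b"
proof
  assume "poly_var a = poly_var b"
  then have "poly_eval (unit_vec a) (poly_var a) = poly_eval (unit_vec a) (poly_var b)" by simp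
  then show "a = b" by (simp add: unit_vec_def split: if_splits)
qed simp

lemma poly_eval_linear_form: "poly_eval x (linear_form N v) = (\<Sum>i=1..N. v i * x i)"
  by (simp add: linear_form_def poly_eval.subst_sum)

lemma inj_on_linear_form: "inj_on (linear_form N) (sum_zero_space N)"
proof (rule inj_onI, rule ext)
  fix v w i assume v_space: "v \<in> sum_zero_space N" and w_space: "w \<in> sum_zero_space N"
    and eq: "linear_form N v = linear_form N w"
  have eval: "poly_eval (unit_vec i) (linear_form N u) = (if i \<in> {1..N} then u i else 0)" for u
    unfolding poly_eval_linear_form by (simp add: unit_vec_def if_distrib sum.delta' cong: if_cong)
  show "v i = w i"
    using eval[of v] eval[of w] eq v_space w_space
    by (cases "i \<in> {1..N}") (simp_all add: mem_sum_zero_space)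
qed

lemma linear_form_image:
  assumes "n \<ge> 2"
  shows "linear_form (n + 1) ` sum_zero_space (n + 1) = V_deg n 1"
proof
  let ?N = "n + 1"
  have "sum_zero_space ?N \<subseteq> linear_form ?N -` V_deg n 1"
  proof (rule sum_zero_space_subset)
    fix a assume a_in: "a \<in> {2..?N}"
    then have "edge_poly {1, a} \<in> V_deg n 1"
      using assms by (intro edge_poly_in_V_deg_1) (auto simp: pair_in_complete_edges)
    then have "- edge_poly {1, a} \<in> V_deg n 1" by (rule cpoly.subspace_neg[OF subspace_V_deg])
    moreover have "linear_form ?N (unit_vec a - unit_vec 1) = - edge_poly {1, a}"
      using a_in by (simp add: linear_form.diff linear_form_unit_vec edge_poly_pair edge_sign_def)
    ultimately show "unit_vec a - unit_vec 1 \<in> linear_form ?N -` V_deg n 1" by simp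
  qed (rule linear_form.subspace_vimage[OF subspace_V_deg])
  then show "linear_form ?N ` sum_zero_space ?N \<subseteq> V_deg n 1" by blast
  have "slim_polys n 1 \<subseteq> linear_form ?N ` sum_zero_space ?N"
  proof
    fix p assume "p \<in> slim_polys n 1"
    then obtain a b where endpoints: "p = edge_poly {a, b}" "a < b" "a \<in> {1..?N}" "b \<in> {1..?N}"
      using slim_polys_1[OF assms] by (auto elim: complete_edgesE)
    then have "p = linear_form ?N (unit_vec a - unit_vec b)"
      by (simp add: edge_poly_pair edge_sign_def linear_form.diff linear_form_unit_vec)
    then show "p \<in> linear_form ?N ` sum_zero_space ?N"
      using unit_vec_diff_in_sum_zero_space[OF endpoints(3,4)] by blast
  qed
  then show "V_deg n 1 \<subseteq> linear_form ?N ` sum_zero_space ?N"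
    unfolding V_deg_eq_span
    by (rule cpoly.span_minimal) (rule linear_form.subspace_image[OF subspace_sum_zero_space])
qed

lemma permute_vars_linear_form:
  assumes "\<sigma> permutes {1..N}"
  shows "permute_vars \<sigma> (linear_form N v) = linear_form N (\<lambda>i. v (inv' \<sigma> i))"
  unfolding linear_form_def permute_vars.subst_sum
  using sum.permute[OF assms, of "\<lambda>i. poly_scale (v (inv' \<sigma> i)) (poly_var i)"]
  by (simp add: comp_def permutes_inverses(2)[OF assms])

lemma rep_isomorphic_reflection_V_rep:
  assumes "n \<ge> 2"
  shows "rep_isomorphic (sym_group (n + 1)) (reflection_rep (n + 1)) (V_rep n 1)"
proof (rule rep_isomorphic_of_linear[where \<phi> = "linear_form (n + 1)"])
  show "representation (sym_group (n + 1)) (reflection_rep (n + 1))"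
    by (rule representation_reflection_rep)
  show "Vector_Spaces.linear (rep_scale (reflection_rep (n + 1))) (rep_scale (V_rep n 1))
      (linear_form (n + 1))"
    using linear_linear_form by (simp add: reflection_rep_def V_rep_def)
  show "bij_betw (linear_form (n + 1)) (sum_zero_space (n + 1)) (rep_space (V_rep n 1))"
    using inj_on_linear_form linear_form_image[OF assms] by (simp add: bij_betw_def V_rep_def)
qed (simp add: V_rep_def reflection_rep_def sym_group_carrier permute_vars_linear_form)

section \<open>The Specht module of shape (n, 1)\<close>

definition hook_tabloid :: "nat \<Rightarrow> nat \<Rightarrow> nat \<Rightarrow> nat set" where
  "hook_tabloid n b r = (if r = 0 then {1..n + 1} - {b} else if r = 1 then {b} else {})"

lemma hook_tabloid_inj: "hook_tabloid n a = hook_tabloid n b \<longleftrightarrow> a = b"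
  by (auto simp: hook_tabloid_def fun_eq_iff split: if_splits)

lemma tabloid_act_hook_tabloid:
  assumes "\<sigma> permutes {1..n + 1}"
  shows "tabloid_act \<sigma> (hook_tabloid n b) = hook_tabloid n (\<sigma> b)"
proof
  fix r
  have "\<sigma> ` ({1..n + 1} - {b}) = {1..n + 1} - {\<sigma> b}"
    using permutes_image[OF assms] by (simp add: image_set_diff[OF permutes_inj[OF assms]])
  then show "tabloid_act \<sigma> (hook_tabloid n b) r = hook_tabloid n (\<sigma> b) r"
    by (simp add: tabloid_act_def hook_tabloid_def)
qed

lemma tabloid_act_inv_eq_iff:
  assumes "\<sigma> permutes S"
  shows "tabloid_act (inv' \<sigma>) t = u \<longleftrightarrow> t = tabloid_act \<sigma> u"
proof -
  have "tabloid_act \<sigma> (tabloid_act (inv' \<sigma>) t) = t" "tabloid_act (inv' \<sigma>) (tabloid_act \<sigma> u) = u"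
    by (simp_all add: tabloid_act_def fun_eq_iff image_comp permutes_inv_o[OF assms])
  then show ?thesis by metis
qed

lemma cells_hook: "cells [n, Suc 0] = insert (Suc 0, 0) ((\<lambda>c. (0, c)) ` {..<n})"
  by (auto simp: cells_def less_Suc_eq)

lemma
  assumes n_pos: "n \<ge> 1" and tableau: "T \<in> tableaux [n, 1]"
  shows tableau_hook_mem: "T (0, 0) \<in> {1..n + 1}" "T (1, 0) \<in> {1..n + 1}"
    and tableau_hook_column_neq: "T (0, 0) \<noteq> T (1, 0)"
    and tableau_hook_first_row: "(\<lambda>c. T (0, c)) ` {..<n} = {1..n + 1} - {T (1, 0)}"
    and tableau_hook_inj: "\<And>c d. c < n \<Longrightarrow> d < n \<Longrightarrow> T (0, c) = T (0, d) \<Longrightarrow> c = d"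
proof -
  have bij: "bij_betw T (insert (1, 0) ((\<lambda>c. (0, c)) ` {..<n})) {1..n + 1}"
    using tableau by (simp add: tableaux_def cells_hook)
  then have inj: "inj_on T (insert (1, 0) ((\<lambda>c. (0, c)) ` {..<n}))"
    and img: "insert (T (1, 0)) ((\<lambda>c. T (0, c)) ` {..<n}) = {1..n + 1}"
    by (simp_all add: bij_betw_def image_image)
  have distinct: "T (0, c) \<noteq> T (1, 0)" if "c < n" for c
    using inj_onD[OF inj, of "(0, c)" "(1, 0)"] that by auto
  show "T (0, 0) \<in> {1..n + 1}" "T (1, 0) \<in> {1..n + 1}" using img n_pos by auto
  show "T (0, 0) \<noteq> T (1, 0)" using distinct[of 0] n_pos by auto
  show "(\<lambda>c. T (0, c)) ` {..<n} = {1..n + 1} - {T (1, 0)}" using img distinct by auto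
  show "c = d" if "c < n" "d < n" "T (0, c) = T (0, d)" for c d
    using inj_onD[OF inj, of "(0, c)" "(0, d)"] that by auto
qed

lemma tabloid_hook:
  assumes "n \<ge> 1" "T \<in> tableaux [n, 1]"
  shows "tabloid [n, 1] T = hook_tabloid n (T (1, 0))"
proof
  fix r
  have "tabloid [n, 1] T 0 = (\<lambda>c. T (0, c)) ` {..<n}" by (auto simp: tabloid_def cells_hook)
  then have "tabloid [n, 1] T 0 = {1..n + 1} - {T (1, 0)}"
    using tableau_hook_first_row[OF assms] by simp
  moreover have "tabloid [n, 1] T 1 = {T (1, 0)}" by (auto simp: tabloid_def cells_hook)
  moreover have "tabloid [n, 1] T r = {}" if "r > 1" using that
    by (auto simp: tabloid_def cells_hook)
  ultimately show "tabloid [n, 1] T r = hook_tabloid n (T (1, 0)) r"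
    by (cases "r > 1") (auto simp: hook_tabloid_def not_less le_Suc_eq)
qed

lemma tableau_column_hook:
  assumes "n \<ge> 1"
  shows "tableau_column [n, 1] T c
      = (if c = 0 then {T (0, 0), T (1, 0)} else if c < n then {T (0, c)} else {})"
  using assms by (auto simp: tableau_column_def cells_hook)

lemma column_stabilizer_hook:
  assumes n_pos: "n \<ge> 1" and tableau: "T \<in> tableaux [n, 1]"
  shows "column_stabilizer [n, 1] T = {\<pi>. \<pi> permutes {T (0, 0), T (1, 0)}}"
proof (intro subset_antisym subsetI; clarify)
  let ?col = "{T (0, 0), T (1, 0)}"
  fix \<pi> assume "\<pi> \<in> column_stabilizer [n, 1] T"
  then have \<pi>_permutes: "\<pi> permutes {1..n + 1}"
    and stab: "\<pi> ` tableau_column [n, 1] T c = tableau_column [n, 1] T c" for c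
    by (auto simp: column_stabilizer_def)
  show "\<pi> permutes ?col"
  proof (rule permutes_superset[OF \<pi>_permutes])
    fix x assume x_in: "x \<in> {1..n + 1} - ?col"
    then have "x \<in> (\<lambda>c. T (0, c)) ` {..<n}" by (simp add: tableau_hook_first_row[OF n_pos tableau])
    then obtain c where entry: "x = T (0, c)" "c < n" by blast
    moreover have "c \<noteq> 0" using x_in entry(1) by (cases "c = 0") auto
    ultimately show "\<pi> x = x" using stab[of c]
      by (simp add: tableau_column_hook[OF n_pos, unfolded One_nat_def])
  qed
next
  let ?col = "{T (0, 0), T (1, 0)}"
  fix \<pi> assume \<pi>_permutes: "\<pi> permutes ?col"
  have "\<pi> ` tableau_column [n, 1] T c = tableau_column [n, 1] T c" for c
  proof (cases "c = 0")
    case True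
    then show ?thesis using permutes_image[OF \<pi>_permutes]
      by (simp only: tableau_column_hook[OF n_pos] if_True simp_thms)
  next
    case False
    then have "T (0, c) \<notin> ?col" if "c < n"
      using tableau_hook_first_row[OF n_pos tableau] tableau_hook_inj[OF n_pos tableau, of c 0]
        n_pos that by auto
    then show ?thesis using False permutes_not_in[OF \<pi>_permutes]
      by (simp only: tableau_column_hook[OF n_pos]) simp
  qed
  moreover have "\<pi> permutes {1..n + 1}"
    using \<pi>_permutes tableau_hook_mem[OF n_pos tableau]
    by (intro permutes_subset[OF \<pi>_permutes]) auto
  ultimately show "\<pi> \<in> column_stabilizer [n, 1] T" by (simp add: column_stabilizer_def)
qed

definition tabloid_form :: "nat \<Rightarrow> (nat \<Rightarrow> complex) \<Rightarrow> (nat \<Rightarrow> nat set) \<Rightarrow> complex" where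
  "tabloid_form n v t = (\<Sum>i=1..n + 1. if t = hook_tabloid n i then v i else 0)"

lemma tabloid_form_hook_tabloid:
  "tabloid_form n v (hook_tabloid n i) = (if i \<in> {1..n + 1} then v i else 0)"
  by (simp add: tabloid_form_def hook_tabloid_inj sum.delta del: One_nat_def)

lemma linear_tabloid_form: "Vector_Spaces.linear fun_scale fun_scale (tabloid_form n)"
  by (unfold_locales; rule ext)
    (auto simp: tabloid_form_def sum_distrib_left simp flip: sum.distrib simp del: sum.cl_ivl_Suc
      intro!: sum.cong)

interpretation tabloid_form: Vector_Spaces.linear fun_scale fun_scale "tabloid_form n" for n
  by (rule linear_tabloid_form)

lemma tabloid_form_unit_vec:
  assumes "a \<in> {1..n + 1}"
  shows "tabloid_form n (unit_vec a) t = (if hook_tabloid n a = t then 1 else 0)"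
proof -
  have "tabloid_form n (unit_vec a) t
      = (\<Sum>i=1..n + 1. if i = a then if hook_tabloid n a = t then 1 else 0 else 0)"
    unfolding tabloid_form_def by (rule sum.cong) (auto simp: unit_vec_def)
  then show ?thesis using assms by (simp add: sum.delta')
qed

lemma polytabloid_hook:
  assumes n_pos: "n \<ge> 1" and tableau: "T \<in> tableaux [n, 1]"
  shows "polytabloid [n, 1] T = tabloid_form n (unit_vec (T (1, 0)) - unit_vec (T (0, 0)))"
proof
  fix t
  define a b where "a = T (0, 0)" and "b = T (1, 0)"
  note entries = tableau_hook_mem[OF n_pos tableau, folded a_def b_def]
    tableau_hook_column_neq[OF n_pos tableau, folded a_def b_def]
  have stab: "column_stabilizer [n, 1] T = {id, transpose a b}"
    unfolding column_stabilizer_hook[OF n_pos tableau] a_def[symmetric] b_def[symmetric]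
    by (auto simp: permutes_doubleton_iff)
  have transpose_permutes: "transpose a b permutes {1..n + 1}"
    using entries by (intro permutes_swap_id)
  have "id \<noteq> transpose a b" using entries(3) by (metis id_apply transpose_apply_first)
  then have "polytabloid [n, 1] T t
      = (if hook_tabloid n b = t then 1 else 0) - (if hook_tabloid n a = t then 1 else 0)"
    unfolding polytabloid_def stab tabloid_hook[OF n_pos tableau] b_def[symmetric]
    using entries(3) tabloid_act_hook_tabloid[OF permutes_id, of n b]
    by (simp add: tabloid_act_hook_tabloid[OF transpose_permutes] sign_char_def sign_swap_id
      del: One_nat_def)
  then show "polytabloid [n, 1] T t = tabloid_form n (unit_vec (T (1, 0)) - unit_vec (T (0, 0))) t"
    using entries by (simp add: tabloid_form.diff tabloid_form_unit_vec flip: a_def b_def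
      del: One_nat_def)
qed

lemma exists_tableau_hook:
  assumes "a \<in> {1..n + 1}" "b \<in> {1..n + 1}" "a \<noteq> b" "n \<ge> 1"
  obtains T where "T \<in> tableaux [n, 1]" "T (0, 0) = a" "T (1, 0) = b"
proof -
  obtain \<pi> where \<pi>_permutes: "\<pi> permutes {1..n + 1}" "\<pi> 1 = a" "\<pi> (n + 1) = b"
    using exists_permutes_two_points[of a "{1..n + 1}" b 1 "n + 1"] assms by auto
  define row_tableau where "row_tableau = (\<lambda>(r::nat, c). if r = 0 then c + 1 else n + 1)"
  have "bij_betw row_tableau (cells [n, 1]) {1..n + 1}"
  proof (rule bij_betw_byWitness[where f' = "\<lambda>i. if i = n + 1 then (1, 0) else (0, i - 1)"])
    show "row_tableau ` cells [n, 1] \<subseteq> {1..n + 1}" by (auto simp: cells_hook row_tableau_def)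
    show "(\<lambda>i. if i = n + 1 then (1, 0) else (0, i - 1)) ` {1..n + 1} \<subseteq> cells [n, 1]"
      by (auto simp: cells_hook)
  qed (auto simp: cells_hook row_tableau_def)
  then have "bij_betw (\<pi> \<circ> row_tableau) (cells [n, 1]) {1..n + 1}"
    using permutes_imp_bij[OF \<pi>_permutes(1)] by (rule bij_betw_trans)
  then have "\<pi> \<circ> row_tableau \<in> tableaux [n, 1]" by (simp add: tableaux_def)
  then show ?thesis using that[of "\<pi> \<circ> row_tableau"] \<pi>_permutes by (simp add: row_tableau_def)
qed

lemma inj_on_tabloid_form: "inj_on (tabloid_form n) (sum_zero_space (n + 1))"
proof (rule inj_onI, rule ext)
  fix v w i
  assume "v \<in> sum_zero_space (n + 1)" "w \<in> sum_zero_space (n + 1)"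
    "tabloid_form n v = tabloid_form n w"
  then show "v i = w i"
    using tabloid_form_hook_tabloid[of n v i] tabloid_form_hook_tabloid[of n w i]
    by (cases "i \<in> {1..n + 1}") (auto simp: mem_sum_zero_space)
qed

lemma tabloid_form_image:
  assumes n_pos: "n \<ge> 1"
  shows "tabloid_form n ` sum_zero_space (n + 1)
      = fun_space.span (polytabloid [n, 1] ` tableaux [n, 1])"
    (is "?L = fun_space.span ?P")
proof
  have "sum_zero_space (n + 1) \<subseteq> tabloid_form n -` fun_space.span ?P"
  proof (rule sum_zero_space_subset)
    fix a assume "a \<in> {2..n + 1}"
    then have "1 \<in> {1..n + 1}" "a \<in> {1..n + 1}" "1 \<noteq> a" by auto
    then obtain T where "T \<in> tableaux [n, 1]" "T (0, 0) = 1" "T (1, 0) = a"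
      using n_pos by (rule exists_tableau_hook)
    then have "tabloid_form n (unit_vec a - unit_vec 1) \<in> ?P"
      using polytabloid_hook[OF n_pos, of T] by (metis imageI)
    then show "unit_vec a - unit_vec 1 \<in> tabloid_form n -` fun_space.span ?P"
      by (simp add: fun_space.span_base)
  qed (rule tabloid_form.subspace_vimage[OF fun_space.subspace_span])
  then show "?L \<subseteq> fun_space.span ?P" by blast
  have "polytabloid [n, 1] T \<in> ?L" if tableau: "T \<in> tableaux [n, 1]" for T
    unfolding polytabloid_hook[OF n_pos tableau]
    by (intro imageI unit_vec_diff_in_sum_zero_space tableau_hook_mem[OF n_pos tableau])
  then show "fun_space.span ?P \<subseteq> ?L"
    by (intro fun_space.span_minimal tabloid_form.subspace_image[OF subspace_sum_zero_space]) blast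
qed

lemma tabloid_form_tabloid_act_inv:
  assumes \<sigma>_permutes: "\<sigma> permutes {1..n + 1}"
  shows "tabloid_form n v (tabloid_act (inv' \<sigma>) t) = tabloid_form n (\<lambda>i. v (inv' \<sigma> i)) t"
proof -
  have "tabloid_form n v (tabloid_act (inv' \<sigma>) t)
      = (\<Sum>i=1..n + 1. if t = hook_tabloid n (\<sigma> i) then v (inv' \<sigma> (\<sigma> i)) else 0)"
    unfolding tabloid_form_def tabloid_act_inv_eq_iff[OF \<sigma>_permutes]
      tabloid_act_hook_tabloid[OF \<sigma>_permutes]
    by (intro sum.cong) (simp_all add: permutes_inverses(2)[OF \<sigma>_permutes])
  also have "\<dots> = tabloid_form n (\<lambda>i. v (inv' \<sigma> i)) t"
    unfolding tabloid_form_def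
    using sum.permute[OF \<sigma>_permutes, of "\<lambda>i. if t = hook_tabloid n i then v (inv' \<sigma> i) else 0"]
    by (simp add: comp_def del: sum.cl_ivl_Suc)
  finally show ?thesis .
qed

lemma rep_isomorphic_reflection_specht:
  assumes "n \<ge> 1"
  shows "rep_isomorphic (sym_group (n + 1)) (reflection_rep (n + 1)) (specht_rep [n, 1])"
proof (rule rep_isomorphic_of_linear[where \<phi> = "tabloid_form n"])
  show "representation (sym_group (n + 1)) (reflection_rep (n + 1))"
    by (rule representation_reflection_rep)
  show "Vector_Spaces.linear (rep_scale (reflection_rep (n + 1))) (rep_scale (specht_rep [n, 1]))
      (tabloid_form n)"
    using linear_tabloid_form by (simp add: reflection_rep_def specht_rep_def)
  show "bij_betw (tabloid_form n) (sum_zero_space (n + 1)) (rep_space (specht_rep [n, 1]))"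
    using inj_on_tabloid_form tabloid_form_image[OF assms]
    by (simp add: bij_betw_def specht_rep_def)
qed (simp add: specht_rep_def reflection_rep_def sym_group_carrier fun_eq_iff
  tabloid_form_tabloid_act_inv)

section \<open>The Vandermonde product\<close>

abbreviation vandermonde :: "nat \<Rightarrow> cpoly" where
  "vandermonde N \<equiv> graph_poly (complete_edges N)"

lemma permute_vars_vandermonde_adjacent:
  assumes "i \<in> {1..N}" "Suc i \<in> {1..N}"
  shows "permute_vars (transpose i (Suc i)) (vandermonde N) = - vandermonde N"
proof -
  let ?\<tau> = "transpose i (Suc i)" and ?e = "{i, Suc i}"
  let ?G = "complete_edges N - {?e}"
  have \<tau>_permutes: "?\<tau> permutes {1..N}" using assms by (intro permutes_swap_id)
  have inj: "inj ((`) ?\<tau>)" using inj_image_image[OF permutes_inj[OF \<tau>_permutes]] .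
  have e_edge: "?e \<in> complete_edges N" using assms by (auto simp: pair_in_complete_edges)
  have img: "(`) ?\<tau> ` ?G = ?G"
    unfolding image_set_diff[OF inj] image_complete_edges[OF \<tau>_permutes]
    by (simp add: insert_commute)
  have keep_order: "permute_vars ?\<tau> (edge_poly f) = edge_poly (?\<tau> ` f)" if f_edge: "f \<in> ?G" for f
  proof -
    have "f \<in> complete_edges N" using f_edge by blast
    then obtain a b where endpoints: "f = {a, b}" "a < b" by (rule complete_edgesE)
    then have "?\<tau> a < ?\<tau> b" using f_edge by (auto simp: transpose_def)
    then show ?thesis using endpoints
      by (simp add: edge_poly_pair edge_sign_def permute_vars.subst_diff)
  qed
  have "permute_vars ?\<tau> (graph_poly ?G) = (\<Prod>f\<in>?G. edge_poly (?\<tau> ` f))"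
    by (simp add: graph_poly_def permute_vars.subst_prod keep_order)
  also have "\<dots> = (\<Prod>f\<in>(`) ?\<tau> ` ?G. edge_poly f)"
    by (subst prod.reindex[OF inj_on_subset[OF inj subset_UNIV]]) simp
  finally have "permute_vars ?\<tau> (graph_poly ?G) = graph_poly ?G"
    unfolding img graph_poly_def .
  moreover have "permute_vars ?\<tau> (edge_poly ?e) = - edge_poly ?e"
    by (simp add: edge_poly_pair edge_sign_def permute_vars.subst_diff)
  moreover have "vandermonde N = edge_poly ?e * graph_poly ?G"
    using prod.remove[OF _ e_edge, of edge_poly] by (simp add: graph_poly_def)
  ultimately show ?thesis by (simp add: permute_vars.subst_mult)
qed

lemma permute_vars_vandermonde_adj_transps:
  assumes "\<forall>i\<in>set xs. i \<in> {1..N} \<and> Suc i \<in> {1..N}"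
  shows "permute_vars (apply_adj_transps xs) (vandermonde N) = (- 1) ^ length xs * vandermonde N"
  using assms
proof (induction xs)
  case (Cons i xs)
  then have "permute_vars (transpose i (Suc i)) ((- 1) ^ length xs * vandermonde N)
      = (- 1) ^ length (i # xs) * vandermonde N"
    using permute_vars_vandermonde_adjacent[of i N] by (simp add: permute_vars.subst_simps)
  then show ?case
    using Cons unfolding apply_adj_transps_Cons permute_vars_comp by simp
qed simp

lemma permute_vars_vandermonde_transpose:
  assumes "a \<in> {1..N}" "b \<in> {1..N}" "a < b"
  shows "permute_vars (transpose a b) (vandermonde N) = - vandermonde N"
proof -
  have "odd (length (adj_transp_seq a b))" using assms(3) by (simp add: length_adj_transp_seq)
  moreover have "\<forall>i\<in>set (adj_transp_seq a b). i \<in> {1..N} \<and> Suc i \<in> {1..N}"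
    using assms by (auto simp: set_adj_transp_seq)
  ultimately show ?thesis
    using permute_vars_vandermonde_adj_transps[of "adj_transp_seq a b" N] assms(3)
    by (simp add: adj_transp_seq_correct)
qed

lemma permute_vars_vandermonde:
  assumes "\<sigma> permutes {1..N}"
  shows "permute_vars \<sigma> (vandermonde N) = poly_scale (sign_char \<sigma>) (vandermonde N)"
  using assms finite_atLeastAtMost
proof (induction rule: permutes_induct)
  case id
  then show ?case by (simp add: sign_char_def)
next
  case (swap a b p)
  have "permutation p" using swap by (auto simp: permutation_permutes)
  then have sign: "sign_char (transpose a b \<circ> p) = - sign_char p"
    using swap by (simp add: sign_char_def sign_compose permutation_swap_id sign_swap_id)
  have "permute_vars (transpose a b) (vandermonde N) = - vandermonde N"
    using permute_vars_vandermonde_transpose[of a N b] permute_vars_vandermonde_transpose[of b N a]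
      swap
    by (cases "a < b") (auto simp: transpose_commute)
  then show ?case unfolding sign permute_vars_comp swap.IH by simp
qed

section \<open>Rooted trees\<close>

text \<open>A tree is given by the parents of the vertices other than the root; \<open>sz v\<close> is the number of
  descendants of \<open>v\<close>, including \<open>v\<close>. The recursion for \<open>sz\<close> already excludes cycles.\<close>

definition children :: "'a set \<Rightarrow> 'a \<Rightarrow> ('a \<Rightarrow> 'a) \<Rightarrow> 'a \<Rightarrow> 'a set" where
  "children A r par v = {u \<in> A - {r}. par u = v}"

locale rooted_tree =
  fixes A :: "'a set" and r :: 'a and par :: "'a \<Rightarrow> 'a" and sz :: "'a \<Rightarrow> nat"
  assumes finite_vertices: "finite A" and root_in: "r \<in> A"
    and parent_in: "v \<in> A - {r} \<Longrightarrow> par v \<in> A"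
    and size_eq: "v \<in> A \<Longrightarrow> sz v = 1 + (\<Sum>u\<in>children A r par v. sz u)"
begin

lemma finite_children: "finite (children A r par v)"
  using finite_vertices by (simp add: children_def)

lemma size_pos: "v \<in> A \<Longrightarrow> 0 < sz v"
  by (simp add: size_eq)

lemma size_less_parent:
  assumes "v \<in> A - {r}"
  shows "sz v < sz (par v)"
proof -
  have "sz v \<le> (\<Sum>u\<in>children A r par (par v). sz u)"
    using assms finite_children by (intro member_le_sum) (auto simp: children_def)
  then show ?thesis using size_eq[OF parent_in[OF assms]] by simp
qed

lemma parent_neq: "v \<in> A - {r} \<Longrightarrow> par v \<noteq> v"
  using size_less_parent by fastforce

lemma size_root: "sz r = card A"
proof -
  have "(\<Sum>v\<in>A. sz v) = card A + (\<Sum>v\<in>A. \<Sum>u\<in>children A r par v. sz u)"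
    by (simp add: size_eq sum_Suc)
  also have "(\<Sum>v\<in>A. \<Sum>u\<in>children A r par v. sz u) = (\<Sum>u\<in>A - {r}. sz u)"
    unfolding children_def using finite_vertices parent_in by (intro sum.group) auto
  also have "(\<Sum>v\<in>A. sz v) = sz r + (\<Sum>u\<in>A - {r}. sz u)"
    using finite_vertices root_in by (rule sum.remove)
  finally show ?thesis by simp
qed

lemma size_less_card:
  assumes "v \<in> A - {r}"
  shows "sz v < card A"
proof -
  define M where "M = Max (sz ` A)"
  have le_Max: "sz u \<le> M" if "u \<in> A" for u
    unfolding M_def using that finite_vertices by (intro Max_ge) auto
  have "M \<in> sz ` A" unfolding M_def using finite_vertices root_in by (intro Max_in) auto
  then obtain u where u_in: "u \<in> A" "sz u = M" by auto
  have "u = r"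
  proof (rule ccontr)
    assume "u \<noteq> r"
    then have "u \<in> A - {r}" using u_in by blast
    then show False using size_less_parent[of u] le_Max[OF parent_in[of u]] u_in by simp
  qed
  then have "M = card A" using u_in size_root by simp
  then show ?thesis using size_less_parent[OF assms] le_Max[OF parent_in[OF assms]] by simp
qed

lemma size_in: "v \<in> A \<Longrightarrow> sz v \<in> {1..card A}"
  using size_pos[of v] size_less_card[of v] size_root by (cases "v = r") (auto simp: Suc_le_eq)

lemma rehang:
  assumes b_vertex: "b \<in> A - {r}" and c_vertex: "c \<in> A - {r}" and siblings: "b \<noteq> c" "par b = par c"
  shows "rooted_tree A r (par(c := b)) (sz(b := sz b + sz c))"
proof
  let ?par = "par(c := b)" and ?sz = "sz(b := sz b + sz c)"
  show "finite A" "r \<in> A" by (rule finite_vertices root_in)+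
  show "?par v \<in> A" if "v \<in> A - {r}" for v
    using parent_in[OF that] b_vertex by auto
  fix x assume "x \<in> A"
  then have size_x: "sz x = 1 + (\<Sum>u\<in>children A r par x. sz u)" by (rule size_eq)
  have distinct: "par b \<noteq> b" "par c \<noteq> c" using parent_neq b_vertex c_vertex by auto
  consider (new_parent) "x = b" | (old_parent) "x = par b" | (other) "x \<noteq> b" "x \<noteq> par b" by blast
  then show "?sz x = 1 + (\<Sum>u\<in>children A r ?par x. ?sz u)"
  proof cases
    case new_parent
    then have "children A r ?par x = insert c (children A r par x)" "c \<notin> children A r par x"
      "b \<notin> children A r par x"
      using c_vertex siblings distinct by (auto simp: children_def)
    moreover from this(3) have "(\<Sum>u\<in>children A r par x. ?sz u) = (\<Sum>u\<in>children A r par x. sz u)"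
      by (intro sum.cong) auto
    ultimately have "(\<Sum>u\<in>children A r ?par x. ?sz u) = sz c + (\<Sum>u\<in>children A r par x. sz u)"
      using siblings(1) finite_children by simp
    moreover have "?sz x = sz x + sz c" using new_parent by simp
    ultimately show ?thesis using size_x by linarith
  next
    case old_parent
    define D where "D = children A r par x - {b, c}"
    have D_fresh: "finite D" "b \<notin> D" "c \<notin> D" using finite_children by (auto simp: D_def)
    have "children A r par x = insert b (insert c D)" "children A r ?par x = insert b D"
      using old_parent b_vertex c_vertex siblings distinct by (auto simp: D_def children_def)
    moreover have "(\<Sum>u\<in>D. ?sz u) = (\<Sum>u\<in>D. sz u)" using D_fresh by (intro sum.cong) auto
    ultimately show ?thesis using old_parent size_x distinct siblings(1) D_fresh by simp
  next
    case other
    then have "children A r ?par x = children A r par x" "b \<notin> children A r par x"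
      using siblings by (auto simp: children_def)
    moreover from this(2) have "(\<Sum>u\<in>children A r par x. ?sz u) = (\<Sum>u\<in>children A r par x. sz u)"
      by (intro sum.cong) auto
    ultimately show ?thesis using other size_x by simp
  qed
qed

end

lemma rooted_tree_induct [consumes 1, case_names path rehang]:
  assumes "rooted_tree A r par sz"
    and path: "\<And>par sz. rooted_tree A r par sz \<Longrightarrow> inj_on par (A - {r}) \<Longrightarrow> P par sz"
    and rehang: "\<And>par sz b c. rooted_tree A r par sz \<Longrightarrow> b \<in> A - {r} \<Longrightarrow> c \<in> A - {r} \<Longrightarrow> b \<noteq> c \<Longrightarrow>
      par b = par c \<Longrightarrow> P (par(c := b)) (sz(b := sz b + sz c)) \<Longrightarrow>
      P (par(b := c)) (sz(c := sz c + sz b)) \<Longrightarrow> P par sz"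
  shows "P par sz"
  using assms(1)
proof (induction "card A * card A - (\<Sum>v\<in>A. sz v)" arbitrary: par sz rule: less_induct)
  case less
  interpret rooted_tree A r par sz by (rule less.prems)
  show ?case
  proof (cases "inj_on par (A - {r})")
    case False
    then obtain b c where siblings: "b \<in> A - {r}" "c \<in> A - {r}" "b \<noteq> c" "par b = par c"
      by (auto simp: inj_on_def)
    have "P (par(c := b)) (sz(b := sz b + sz c))"
      if siblings: "b \<in> A - {r}" "c \<in> A - {r}" "b \<noteq> c" "par b = par c" for b c
    proof (rule less.hyps)
      let ?sz = "sz(b := sz b + sz c)"
      interpret rehung: rooted_tree A r "par(c := b)" ?sz using siblings by (rule rehang)
      show "rooted_tree A r (par(c := b)) ?sz" by (rule rehung.rooted_tree_axioms)
      have "(\<Sum>v\<in>A. sz v) < (\<Sum>v\<in>A. ?sz v)"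
        using siblings size_pos finite_vertices by (intro sum_strict_mono_ex1) auto
      moreover have "(\<Sum>v\<in>A. ?sz v) \<le> card A * card A"
        using sum_bounded_above[of A ?sz "card A"] rehung.size_in by simp
      ultimately show "card A * card A - (\<Sum>v\<in>A. ?sz v) < card A * card A - (\<Sum>v\<in>A. sz v)"
        by linarith
    qed
    from this[of b c] this[of c b] show ?thesis
      using siblings by (intro assms(3)[OF less.prems, of b c]) auto
  qed (rule path[OF less.prems])
qed

lemma exists_rooted_tree_size:
  fixes d :: "'a \<Rightarrow> nat"
  assumes "finite A" "r \<in> A" and par: "\<And>v. v \<in> A - {r} \<Longrightarrow> par v \<in> A \<and> d (par v) < d v"
  shows "\<exists>sz. rooted_tree A r par sz"
proof -
  define deeper where "deeper = {(u, v). u \<in> children A r par v}"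
  define sz :: "'a \<Rightarrow> nat" where "sz = wfrec deeper (\<lambda>sz v. 1 + (\<Sum>u\<in>children A r par v. sz u))"
  have "deeper \<subseteq> measure (\<lambda>v. Max (d ` A) - d v)"
  proof (clarsimp simp: deeper_def)
    fix u v assume "u \<in> children A r par v"
    then have "d v < d u" "u \<in> A" using par[of u] by (auto simp: children_def)
    moreover have "d u \<le> Max (d ` A)" using assms(1) \<open>u \<in> A\<close> by (intro Max_ge) auto
    ultimately show "Max (d ` A) - d u < Max (d ` A) - d v" by linarith
  qed
  then have "wf deeper" by (rule wf_subset[OF wf_measure])
  then have size: "sz v = 1 + (\<Sum>u\<in>children A r par v. sz u)" for v
    unfolding sz_def by (subst wfrec) (auto simp: cut_apply deeper_def intro!: sum.cong)
  have "rooted_tree A r par sz"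
    by unfold_locales (use assms(1,2) par in blast, use assms(2) in blast, use par in blast,
      rule size)
  then show ?thesis by blast
qed

definition tree_edges :: "'a set \<Rightarrow> 'a \<Rightarrow> ('a \<Rightarrow> 'a) \<Rightarrow> 'a set set" where
  "tree_edges A r par = (\<lambda>v. {v, par v}) ` (A - {r})"

lemma tree_edges_cong: "(\<And>v. v \<in> A - {r} \<Longrightarrow> p v = q v) \<Longrightarrow> tree_edges A r p = tree_edges A r q"
  by (simp add: tree_edges_def cong: image_cong_simp)

lemma (in rooted_tree) inj_on_tree_edges: "inj_on (\<lambda>v. {v, par v}) (A - {r})"
proof (rule inj_onI)
  fix u v assume "u \<in> A - {r}" "v \<in> A - {r}" "{u, par u} = {v, par v}"
  then show "u = v"
    using size_less_parent[of u] size_less_parent[of v] by (auto simp: doubleton_eq_iff)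
qed

lemma (in rooted_tree) card_tree_edges: "card (tree_edges A r par) = card A - 1"
  unfolding tree_edges_def using root_in by (subst card_image[OF inj_on_tree_edges]) simp

lemma tree_edges_subset:
  assumes "rooted_tree {1..N} r par sz"
  shows "tree_edges {1..N} r par \<subseteq> complete_edges N"
proof -
  interpret rooted_tree "{1..N}" r par sz by (rule assms)
  show ?thesis
    using parent_in parent_neq by (fastforce simp: tree_edges_def pair_in_complete_edges)
qed

lemma connected_tree_edges:
  assumes "rooted_tree A r par sz"
  shows "connected_graph A (tree_edges A r par)"
proof -
  interpret rooted_tree A r par sz by (rule assms)
  let ?R = "{(a, b). {a, b} \<in> tree_edges A r par}"
  have to_root: "(v, r) \<in> ?R\<^sup>*" if "v \<in> A" for v
    using that
  proof (induction "card A - sz v" arbitrary: v rule: less_induct)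
    case less
    show ?case
    proof (cases "v = r")
      case False
      then have v_vertex: "v \<in> A - {r}" using less.prems by auto
      then have "(v, par v) \<in> ?R" by (auto simp: tree_edges_def)
      moreover have "(par v, r) \<in> ?R\<^sup>*"
        using size_less_parent[OF v_vertex] size_less_card[OF v_vertex]
        by (intro less.hyps parent_in[OF v_vertex]) auto
      ultimately show ?thesis by (rule converse_rtrancl_into_rtrancl)
    qed simp
  qed
  have "sym ?R" by (auto simp: sym_def insert_commute)
  then have "sym (?R\<^sup>*)" by (rule sym_rtrancl)
  then show ?thesis using to_root unfolding connected_graph_def by (meson rtrancl_trans symD)
qed

lemma connected_graph_spanning_tree:
  assumes "connected_graph A E" "finite A" "r \<in> A" "\<Union>E \<subseteq> A"
  obtains par sz where "rooted_tree A r par sz" "tree_edges A r par \<subseteq> E"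
proof -
  let ?R = "{(a, b). {a, b} \<in> E}"
  define d where "d v = (LEAST k. (r, v) \<in> ?R ^^ k)" for v
  have "\<exists>u. u \<in> A \<and> d u < d v \<and> {v, u} \<in> E" if v_vertex: "v \<in> A - {r}" for v
  proof -
    have "(r, v) \<in> ?R\<^sup>*" using assms(1,3) v_vertex unfolding connected_graph_def by blast
    then have "\<exists>k. (r, v) \<in> ?R ^^ k" by (simp add: rtrancl_power)
    then have d_v: "(r, v) \<in> ?R ^^ d v" unfolding d_def by (rule LeastI_ex)
    show ?thesis
    proof (cases "d v")
      case 0
      then show ?thesis using d_v v_vertex by simp
    next
      case (Suc k)
      then obtain u where neighbour: "(r, u) \<in> ?R ^^ k" "{u, v} \<in> E" using d_v by auto
      then have "d u \<le> k" unfolding d_def by (intro Least_le)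
      moreover have "u \<in> A" using neighbour(2) assms(4) by blast
      ultimately show ?thesis using neighbour Suc by (auto simp: insert_commute intro!: exI[of _ u])
    qed
  qed
  then obtain par where par: "\<And>v. v \<in> A - {r} \<Longrightarrow> par v \<in> A \<and> d (par v) < d v \<and> {v, par v} \<in> E"
    by metis
  then obtain sz where "rooted_tree A r par sz"
    using exists_rooted_tree_size[OF assms(2,3), of par d] by blast
  moreover have "tree_edges A r par \<subseteq> E" using par by (auto simp: tree_edges_def)
  ultimately show ?thesis by (rule that)
qed

definition tree_prod ::
    "('a \<Rightarrow> 'a \<Rightarrow> nat \<Rightarrow> 'b::comm_monoid_mult) \<Rightarrow> 'a set \<Rightarrow> 'a \<Rightarrow> ('a \<Rightarrow> 'a) \<Rightarrow> ('a \<Rightarrow> nat) \<Rightarrow> 'b" where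
  "tree_prod f A r par sz = (\<Prod>v\<in>A - {r}. f (par v) v (sz v))"

lemma tree_prod_cong:
  assumes "\<And>v. v \<in> A - {r} \<Longrightarrow> f (par v) v (sz v) = f' (par' v) v (sz' v)"
  shows "tree_prod f A r par sz = tree_prod f' A r par' sz'"
  unfolding tree_prod_def using assms by (rule prod.cong[OF refl])

lemma tree_prod_remove2:
  assumes "finite A" "b \<in> A - {r}" "c \<in> A - {r}" "b \<noteq> c"
  shows "tree_prod f A r par sz =
    f (par b) b (sz b) * f (par c) c (sz c) * tree_prod f (A - {b, c}) r par sz"
proof -
  have "A - {r} = insert b (insert c (A - {b, c} - {r}))" using assms by blast
  then show ?thesis using assms unfolding tree_prod_def by (simp add: mult.assoc)
qed

lemma rooted_tree_permute:
  assumes "rooted_tree A r par sz" and w_permutes: "w permutes A"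
  shows "rooted_tree A (w r) (w \<circ> par \<circ> inv' w) (sz \<circ> inv' w)"
proof
  interpret rooted_tree A r par sz by (rule assms)
  have inv_in: "inv' w v \<in> A - {r}" if "v \<in> A - {w r}" for v
    using that permutes_in_image[OF permutes_inv[OF w_permutes]] permutes_inv_eq[OF w_permutes]
    by auto
  show "finite A" "w r \<in> A"
    using finite_vertices root_in permutes_in_image[OF w_permutes] by auto
  show "(w \<circ> par \<circ> inv' w) v \<in> A" if "v \<in> A - {w r}" for v
    using parent_in[OF inv_in[OF that]] permutes_in_image[OF w_permutes] by simp
  fix v assume v_in: "v \<in> A"
  let ?C = "children A r par (inv' w v)"
  have "children A (w r) (w \<circ> par \<circ> inv' w) v = w ` ?C"
  proof (intro subset_antisym subsetI)
    fix u assume "u \<in> children A (w r) (w \<circ> par \<circ> inv' w) v"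
    then have "inv' w u \<in> ?C"
      using inv_in[of u] permutes_inverses[OF w_permutes] by (auto simp: children_def)
    then show "u \<in> w ` ?C" using permutes_inverses(1)[OF w_permutes, of u] by (metis imageI)
  qed (use permutes_in_image[OF w_permutes] permutes_inverses[OF w_permutes]
    inj_eq[OF permutes_inj[OF w_permutes]] in \<open>auto simp: children_def\<close>)
  then have "(\<Sum>u\<in>children A (w r) (w \<circ> par \<circ> inv' w) v. (sz \<circ> inv' w) u) = (\<Sum>u\<in>?C. sz u)"
    by (simp add: sum.reindex[OF inj_on_subset[OF permutes_inj[OF w_permutes] subset_UNIV]]
      permutes_inverses[OF w_permutes])
  moreover have "inv' w v \<in> A" using v_in permutes_in_image[OF permutes_inv[OF w_permutes]] by simp
  ultimately show "(sz \<circ> inv' w) v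
      = 1 + (\<Sum>u\<in>children A (w r) (w \<circ> par \<circ> inv' w) v. (sz \<circ> inv' w) u)"
    using size_eq[of "inv' w v"] by simp
qed

lemma tree_prod_permute:
  assumes w_permutes: "w permutes A"
  shows "tree_prod f A (w r) (w \<circ> par \<circ> inv' w) (sz \<circ> inv' w)
    = tree_prod (\<lambda>a b. f (w a) (w b)) A r par sz"
proof -
  have "A - {w r} = w ` (A - {r})"
    using permutes_image[OF w_permutes] image_set_diff[OF permutes_inj[OF w_permutes], of A "{r}"]
    by simp
  then show ?thesis
    unfolding tree_prod_def
    by (simp add: prod.reindex[OF inj_on_subset[OF permutes_inj[OF w_permutes] subset_UNIV]]
      permutes_inverses[OF w_permutes])
qed

definition line_parent :: "nat \<Rightarrow> nat \<Rightarrow> nat" where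
  "line_parent m i = (if i < m then i + 1 else i - 1)"

definition line_size :: "nat \<Rightarrow> nat \<Rightarrow> nat \<Rightarrow> nat" where
  "line_size N m i = (if i < m then i else if i = m then N else N + 1 - i)"

lemma rooted_tree_line:
  assumes m_in: "m \<in> {1..N}"
  shows "rooted_tree {1..N} m (line_parent m) (line_size N m)"
proof
  show "line_parent m i \<in> {1..N}" if "i \<in> {1..N} - {m}" for i
    using that m_in by (auto simp: line_parent_def)
  fix i assume i_in: "i \<in> {1..N}"
  let ?C = "children {1..N} m (line_parent m) i"
  consider (below) "i < m" | (root) "i = m" | (above) "i > m" by linarith
  then show "line_size N m i = 1 + (\<Sum>j\<in>?C. line_size N m j)"
  proof cases
    case below
    then have "?C = (if i = 1 then {} else {i - 1})"
      using i_in m_in by (auto simp: children_def line_parent_def)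
    then show ?thesis using below i_in by (auto simp: line_size_def)
  next
    case root
    then have "?C = (if m = 1 then {} else {m - 1}) \<union> (if m = N then {} else {m + 1})"
      using m_in by (auto simp: children_def line_parent_def)
    then show ?thesis using root m_in by (auto simp: line_size_def)
  next
    case above
    then have "?C = (if i = N then {} else {i + 1})"
      using i_in m_in by (auto simp: children_def line_parent_def)
    then show ?thesis using above i_in by (auto simp: line_size_def)
  qed
qed (use m_in in auto)

lemma tree_prod_line:
  assumes m_in: "m \<in> {1..N}"
  shows "tree_prod f {1..N} m (line_parent m) (line_size N m) =
    (\<Prod>i\<in>{1..<m}. f (i + 1) i i) * (\<Prod>i\<in>{m..<N}. f i (i + 1) (N - i))"
proof -
  let ?g = "\<lambda>i. f (line_parent m i) i (line_size N m i)"
  have "{1..N} - {m} = {1..<m} \<union> {Suc m..<Suc N}" using m_in by auto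
  then have "tree_prod f {1..N} m (line_parent m) (line_size N m)
      = (\<Prod>i\<in>{1..<m}. ?g i) * (\<Prod>i\<in>{Suc m..<Suc N}. ?g i)"
    unfolding tree_prod_def by (simp add: prod.union_disjoint)
  also have "(\<Prod>i\<in>{Suc m..<Suc N}. ?g i) = (\<Prod>i\<in>{m..<N}. ?g (Suc i))"
    by (rule prod.shift_bounds_Suc_ivl)
  also have "\<dots> = (\<Prod>i\<in>{m..<N}. f i (i + 1) (N - i))"
    by (intro prod.cong) (auto simp: line_parent_def line_size_def)
  also have "(\<Prod>i\<in>{1..<m}. ?g i) = (\<Prod>i\<in>{1..<m}. f (i + 1) i i)"
    by (intro prod.cong) (auto simp: line_parent_def line_size_def)
  finally show ?thesis .
qed

lemma (in rooted_tree) size_parent: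
  assumes "inj_on par (A - {r})" and v_vertex: "v \<in> A - {r}"
  shows "sz (par v) = Suc (sz v)"
proof -
  have "children A r par (par v) = {v}" using assms by (auto simp: children_def dest: inj_onD)
  then show ?thesis using size_eq[OF parent_in[OF v_vertex]] by simp
qed

lemma (in rooted_tree) bij_betw_size:
  assumes inj: "inj_on par (A - {r})"
  shows "bij_betw sz A {1..card A}"
proof -
  have attained: "card A - j \<in> sz ` A" if "j < card A" for j
    using that
  proof (induction j)
    case 0
    then show ?case using size_root root_in by force
  next
    case (Suc j)
    then obtain v where v_in: "v \<in> A" "sz v = card A - j" by auto
    then have "children A r par v \<noteq> {}" using size_eq[of v] Suc.prems by auto
    then obtain u where u_in: "u \<in> A - {r}" "par u = v" by (auto simp: children_def)
    then have "sz u = card A - Suc j" using size_parent[OF inj u_in(1)] v_in(2) by simp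
    then show ?case using u_in(1) by force
  qed
  have "k \<in> sz ` A" if "k \<in> {1..card A}" for k
    using attained[of "card A - k"] that by simp
  moreover have "sz ` A \<subseteq> {1..card A}" using size_in by blast
  ultimately have "sz ` A = {1..card A}" by blast
  then show ?thesis
    using finite_vertices by (simp add: bij_betw_def eq_card_imp_inj_on)
qed

section \<open>Tree polynomials\<close>

lemma slim_subset_tree_complement:
  assumes "slim n G"
  obtains par sz where "rooted_tree {1..n + 1} 1 par sz"
    "G \<subseteq> complete_edges (n + 1) - tree_edges {1..n + 1} 1 par"
proof -
  have conn: "connected_graph {1..n + 1} (complete_edges (n + 1) - G)"
    and G_subset: "G \<subseteq> complete_edges (n + 1)"
    using assms by (simp_all only: slim_def)
  have "1 \<in> {1..n + 1}" "\<Union>(complete_edges (n + 1) - G) \<subseteq> {1..n + 1}"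
    by (auto simp: complete_edges_def)
  from connected_graph_spanning_tree[OF conn finite_atLeastAtMost this] obtain par sz
    where "rooted_tree {1..n + 1} 1 par sz"
      "tree_edges {1..n + 1} 1 par \<subseteq> complete_edges (n + 1) - G" .
  then show ?thesis using G_subset by (intro that) auto
qed

lemma card_tree_complement:
  assumes "rooted_tree {1..n + 1} r par sz"
  shows "card (complete_edges (n + 1) - tree_edges {1..n + 1} r par) = n choose 2"
proof -
  have "card (tree_edges {1..n + 1} r par) = n" using rooted_tree.card_tree_edges[OF assms] by simp
  moreover have "card (complete_edges (n + 1)) = (n choose 2) + n"
    by (simp add: card_complete_edges numeral_2_eq_2)
  ultimately show ?thesis
    using tree_edges_subset[OF assms] finite_subset[OF _ finite_complete_edges]
    by (simp add: card_Diff_subset)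
qed

lemma V_deg_above_top:
  assumes "k > n choose 2"
  shows "V_deg n k = {0}"
proof -
  have "card G \<le> n choose 2" if slim: "slim n G" for G
  proof -
    obtain par sz where tree: "rooted_tree {1..n + 1} 1 par sz"
      and G_subset: "G \<subseteq> complete_edges (n + 1) - tree_edges {1..n + 1} 1 par"
      using slim by (rule slim_subset_tree_complement)
    show ?thesis using card_mono[OF _ G_subset] by (simp only: card_tree_complement[OF tree]) simp
  qed
  then have "slim_polys n k = {}" using assms by (fastforce simp: slim_polys_def)
  then show ?thesis by (simp only: V_deg_eq_span cpoly.span_empty)
qed

definition tree_poly :: "nat \<Rightarrow> nat \<Rightarrow> (nat \<Rightarrow> nat) \<Rightarrow> cpoly" where
  "tree_poly N r par = (\<Prod>v\<in>{1..N} - {r}. edge_sign (par v) v) *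
     graph_poly (complete_edges N - tree_edges {1..N} r par)"

lemma prod_edge_sign_cases: "(\<Prod>v\<in>A. edge_sign (f v) (g v)) \<in> {1, - 1}"
  by (induction A rule: infinite_finite_induct) (auto simp: edge_sign_def)

lemma tree_poly_eq_graph_poly:
  obtains s where "s \<in> {1, - 1}"
    "tree_poly N r par = s * graph_poly (complete_edges N - tree_edges {1..N} r par)"
    "graph_poly (complete_edges N - tree_edges {1..N} r par) = s * tree_poly N r par"
proof
  let ?s = "\<Prod>v\<in>{1..N} - {r}. edge_sign (par v) v"
  show "?s \<in> {1, - 1}" by (rule prod_edge_sign_cases)
  then have "?s * ?s = 1" by auto
  then show "graph_poly (complete_edges N - tree_edges {1..N} r par) = ?s * tree_poly N r par"
    by (simp add: tree_poly_def flip: mult.assoc)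
qed (simp add: tree_poly_def)

lemma V_deg_top_eq_span_trees:
  "V_deg n (n choose 2)
      = cpoly.span {tree_poly (n + 1) 1 par |par sz. rooted_tree {1..n + 1} 1 par sz}"
    (is "_ = cpoly.span ?T")
proof
  let ?G = "\<lambda>par. complete_edges (n + 1) - tree_edges {1..n + 1} 1 par"
  have "graph_poly G \<in> cpoly.span ?T" if slim: "slim n G" and top: "card G = n choose 2" for G
  proof -
    obtain par sz where tree: "rooted_tree {1..n + 1} 1 par sz" and G_subset: "G \<subseteq> ?G par"
      using slim by (rule slim_subset_tree_complement)
    have "G = ?G par"
      using card_subset_eq[OF _ G_subset] top by (simp only: card_tree_complement[OF tree]) simp
    then obtain s where sign_s: "s \<in> {1, - 1}" "graph_poly G = s * tree_poly (n + 1) 1 par"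
      using tree_poly_eq_graph_poly[of "n + 1" 1 par] by metis
    have "tree_poly (n + 1) 1 par \<in> cpoly.span ?T" using tree by (intro cpoly.span_base) blast
    then show ?thesis unfolding sign_s(2) using sign_s(1)
      by (rule sign_mult_mem_subspace[OF cpoly.subspace_span])
  qed
  then show "V_deg n (n choose 2) \<subseteq> cpoly.span ?T"
    unfolding V_deg_eq_span slim_polys_def by (intro cpoly.span_minimal cpoly.subspace_span) blast
  have "tree_poly (n + 1) 1 par \<in> V_deg n (n choose 2)" if tree: "rooted_tree {1..n + 1} 1 par sz"
    for par sz
  proof -
    have "complete_edges (n + 1) - ?G par = tree_edges {1..n + 1} 1 par"
      using tree_edges_subset[OF tree] by blast
    then have "slim n (?G par)" using connected_tree_edges[OF tree] by (simp add: slim_def)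
    then have "graph_poly (?G par) \<in> V_deg n (n choose 2)"
      using graph_poly_in_V_deg[of n "?G par"] by (simp only: card_tree_complement[OF tree])
    then show ?thesis
      using tree_poly_eq_graph_poly[of "n + 1" 1 par] sign_mult_mem_subspace[OF subspace_V_deg]
      by metis
  qed
  then show "cpoly.span ?T \<subseteq> V_deg n (n choose 2)"
    by (intro cpoly.span_minimal subspace_V_deg) blast
qed

definition edge_diff :: "nat \<Rightarrow> nat \<Rightarrow> nat \<Rightarrow> cpoly" where
  "edge_diff a b _ = poly_var a - poly_var b"

lemma tree_poly_mult_edge_diffs:
  assumes "rooted_tree {1..N} r par sz"
  shows "tree_poly N r par * tree_prod edge_diff {1..N} r par sz = vandermonde N"
proof -
  interpret rooted_tree "{1..N}" r par sz by (rule assms)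
  let ?A = "{1..N} - {r}" and ?T = "tree_edges {1..N} r par"
  have "(\<Prod>v\<in>?A. edge_sign (par v) v) * tree_prod edge_diff {1..N} r par sz
      = (\<Prod>v\<in>?A. edge_poly {v, par v})"
    unfolding tree_prod_def prod.distrib[symmetric]
  proof (rule prod.cong)
    fix v assume "v \<in> ?A"
    then have "par v \<noteq> v" by (rule parent_neq)
    then show "edge_sign (par v) v * edge_diff (par v) v (sz v) = edge_poly {v, par v}"
      using edge_poly_pair[of "par v" v] by (simp add: edge_diff_def insert_commute)
  qed simp
  also have "\<dots> = graph_poly ?T"
    unfolding graph_poly_def tree_edges_def using inj_on_tree_edges by (simp add: prod.reindex)
  finally have signed: "(\<Prod>v\<in>?A. edge_sign (par v) v) * tree_prod edge_diff {1..N} r par sz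
      = graph_poly ?T" .
  have "tree_poly N r par * tree_prod edge_diff {1..N} r par sz
      = graph_poly (complete_edges N - ?T) *
        ((\<Prod>v\<in>?A. edge_sign (par v) v) * tree_prod edge_diff {1..N} r par sz)"
    unfolding tree_poly_def by (simp only: ac_simps)
  also have "\<dots> = graph_poly (complete_edges N - ?T) * graph_poly ?T" by (simp only: signed)
  also have "\<dots> = vandermonde N"
    unfolding graph_poly_def
    by (rule prod.subset_diff[OF tree_edges_subset[OF assms] finite_complete_edges, symmetric])
  finally show ?thesis .
qed

text \<open>\<open>1/((v - b)(v - c)) = 1/((v - b)(b - c)) + 1/((v - c)(c - b))\<close>, with cleared denominators.\<close>

lemma partial_fractions_cancel:
  fixes v :: "'a::idom"
  assumes "T * ((v - b) * (v - c) * Q) = V" "T1 * ((v - b) * (b - c) * Q) = V"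
    "T2 * ((c - b) * (v - c) * Q) = V"
    and "v \<noteq> b" "v \<noteq> c" "b \<noteq> c" "Q \<noteq> 0"
  shows "T = T1 + T2"
proof -
  let ?W = "(v - b) * (v - c) * (b - c) * Q"
  have "T * ?W = V * (b - c)" unfolding assms(1)[symmetric] by (simp only: ac_simps)
  also have "\<dots> = V * (v - c) + V * (b - v)" by (simp add: algebra_simps)
  also have "V * (v - c) = T1 * ?W" unfolding assms(2)[symmetric] by (simp only: ac_simps)
  also have "V * (b - v) = T2 * ?W" unfolding assms(3)[symmetric] by (simp add: algebra_simps)
  finally have "T * ?W = (T1 + T2) * ?W" by (simp only: distrib_right)
  then show ?thesis using assms(4-7) by simp
qed

lemma tree_poly_rehang:
  assumes tree: "rooted_tree {1..N} r par sz"
    and b_vertex: "b \<in> {1..N} - {r}" and c_vertex: "c \<in> {1..N} - {r}"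
    and siblings: "b \<noteq> c" "par b = par c"
  shows "tree_poly N r par = tree_poly N r (par(c := b)) + tree_poly N r (par(b := c))"
proof (rule partial_fractions_cancel)
  interpret rooted_tree "{1..N}" r par sz by (rule tree)
  let ?x = poly_var and ?v = "par b"
  define Q where "Q = tree_prod edge_diff ({1..N} - {b, c}) r par sz"
  have split: "tree_poly N r p * ((?x (p b) - ?x b) * (?x (p c) - ?x c) * Q) = vandermonde N"
    if tree_p: "rooted_tree {1..N} r p s" and agree: "\<And>u. u \<notin> {b, c} \<Longrightarrow> p u = par u" for p s
  proof -
    have "tree_prod edge_diff ({1..N} - {b, c}) r p s = Q"
      unfolding Q_def by (rule tree_prod_cong) (simp add: agree edge_diff_def)
    then show ?thesis
      using tree_poly_mult_edge_diffs[OF tree_p]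
        tree_prod_remove2[OF finite_vertices b_vertex c_vertex siblings(1), of edge_diff p s]
      by (simp add: edge_diff_def)
  qed
  show "tree_poly N r par * ((?x ?v - ?x b) * (?x ?v - ?x c) * Q) = vandermonde N"
    using split[OF tree] siblings by simp
  show "tree_poly N r (par(c := b)) * ((?x ?v - ?x b) * (?x b - ?x c) * Q) = vandermonde N"
    using split[OF rehang[OF b_vertex c_vertex siblings]] siblings by simp
  show "tree_poly N r (par(b := c)) * ((?x c - ?x b) * (?x ?v - ?x c) * Q) = vandermonde N"
    using split[OF rehang[OF c_vertex b_vertex siblings(1)[symmetric] siblings(2)[symmetric]]]
      siblings by simp
  show "?x ?v \<noteq> ?x b" "?x ?v \<noteq> ?x c" "?x b \<noteq> ?x c" using parent_neq b_vertex c_vertex siblings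
    by auto
  show "Q \<noteq> 0"
    using parent_neq by (auto simp: Q_def tree_prod_def edge_diff_def)
qed

section \<open>Path polynomials\<close>

text \<open>The path \<open>w 1, \<dots>, w N\<close> as a tree rooted at \<open>1\<close>, wherever \<open>1\<close> occurs in \<open>w\<close>.\<close>

definition path_parent :: "(nat \<Rightarrow> nat) \<Rightarrow> nat \<Rightarrow> nat" where
  "path_parent w = w \<circ> line_parent (inv' w 1) \<circ> inv' w"

definition path_size :: "nat \<Rightarrow> (nat \<Rightarrow> nat) \<Rightarrow> nat \<Rightarrow> nat" where
  "path_size N w = line_size N (inv' w 1) \<circ> inv' w"

lemma inv_permutes_in: "w permutes S \<Longrightarrow> x \<in> S \<Longrightarrow> inv' w x \<in> S"
  by (simp add: permutes_in_image[OF permutes_inv])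

lemma rooted_tree_path:
  assumes w_permutes: "w permutes {1..N}" and N_pos: "N \<ge> 1"
  shows "rooted_tree {1..N} 1 (path_parent w) (path_size N w)"
proof -
  have "inv' w 1 \<in> {1..N}" using N_pos by (intro inv_permutes_in[OF w_permutes]) simp
  then have "rooted_tree {1..N} (w (inv' w 1)) (path_parent w) (path_size N w)"
    unfolding path_parent_def path_size_def
    by (intro rooted_tree_permute[OF _ w_permutes] rooted_tree_line)
  then show ?thesis by (simp only: permutes_inverses(1)[OF w_permutes])
qed

lemma tree_prod_path:
  fixes f :: "nat \<Rightarrow> nat \<Rightarrow> nat \<Rightarrow> 'a::comm_ring_1"
  assumes w_permutes: "w permutes {1..N}" and N_pos: "N \<ge> 1"
    and reverse: "\<And>i. i \<in> {1..<N} \<Longrightarrow> f (w (i + 1)) (w i) i = - f (w i) (w (i + 1)) (N - i)"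
  shows "(- 1) ^ (inv' w 1 - 1) * tree_prod f {1..N} 1 (path_parent w) (path_size N w)
    = (\<Prod>i\<in>{1..<N}. f (w i) (w (i + 1)) (N - i))"
proof -
  define m where "m = inv' w 1"
  let ?g = "\<lambda>i. f (w i) (w (i + 1)) (N - i)"
  have m_in: "m \<in> {1..N}" using N_pos unfolding m_def by (intro inv_permutes_in[OF w_permutes]) simp
  have "tree_prod f {1..N} (w m) (path_parent w) (path_size N w)
      = (\<Prod>i\<in>{1..<m}. f (w (i + 1)) (w i) i) * (\<Prod>i\<in>{m..<N}. ?g i)"
    unfolding path_parent_def path_size_def m_def[symmetric] tree_prod_permute[OF w_permutes]
    by (rule tree_prod_line[OF m_in])
  also have "(\<Prod>i\<in>{1..<m}. f (w (i + 1)) (w i) i) = (\<Prod>i\<in>{1..<m}. - ?g i)"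
    using m_in by (intro prod.cong refl reverse) auto
  also have "\<dots> = (- 1) ^ (m - 1) * (\<Prod>i\<in>{1..<m}. ?g i)" by (simp add: prod_uminus)
  finally have "(- 1) ^ (m - 1) * tree_prod f {1..N} (w m) (path_parent w) (path_size N w)
      = (\<Prod>i\<in>{1..<m}. ?g i) * (\<Prod>i\<in>{m..<N}. ?g i)"
    by (simp flip: mult.assoc power_mult_distrib)
  also have "\<dots> = (\<Prod>i\<in>{1..<N}. ?g i)" using m_in by (intro prod.atLeastLessThan_concat) auto
  finally show ?thesis unfolding m_def permutes_inverses(1)[OF w_permutes] .
qed

definition path_poly :: "nat \<Rightarrow> (nat \<Rightarrow> nat) \<Rightarrow> cpoly" where
  "path_poly N w = (- 1) ^ (inv' w 1 - 1) * tree_poly N 1 (path_parent w)"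

definition path_denom :: "nat \<Rightarrow> (nat \<Rightarrow> nat) \<Rightarrow> cpoly" where
  "path_denom N w = (\<Prod>i\<in>{1..<N}. poly_var (w i) - poly_var (w (i + 1)))"

lemma path_poly_mult_denom:
  assumes w_permutes: "w permutes {1..N}" and N_pos: "N \<ge> 1"
  shows "path_poly N w * path_denom N w = vandermonde N"
proof -
  let ?P = "tree_prod edge_diff {1..N} 1 (path_parent w) (path_size N w)"
  have denom: "(- 1) ^ (inv' w 1 - 1) * ?P = path_denom N w"
    unfolding path_denom_def using tree_prod_path[OF w_permutes N_pos, of edge_diff]
    by (simp add: edge_diff_def)
  have "path_poly N w * path_denom N w = tree_poly N 1 (path_parent w) * ?P"
    unfolding path_poly_def denom[symmetric] by (cases "even (inv' w 1 - 1)") simp_all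
  then show ?thesis using tree_poly_mult_edge_diffs[OF rooted_tree_path[OF w_permutes N_pos]]
    by simp
qed

lemma path_denom_nonzero: "w permutes {1..N} \<Longrightarrow> path_denom N w \<noteq> 0"
  using inj_eq[OF permutes_inj[of w]] by (simp add: path_denom_def)

lemma permute_vars_path_poly:
  assumes \<sigma>_permutes: "\<sigma> permutes {1..N}" and w_permutes: "w permutes {1..N}" and N_pos: "N \<ge> 1"
  shows "permute_vars \<sigma> (path_poly N w) = poly_scale (sign_char \<sigma>) (path_poly N (\<sigma> \<circ> w))"
proof -
  have comp_permutes: "(\<sigma> \<circ> w) permutes {1..N}" using w_permutes \<sigma>_permutes
    by (rule permutes_compose)
  have "permute_vars \<sigma> (path_denom N w) = path_denom N (\<sigma> \<circ> w)"
    by (simp add: path_denom_def permute_vars.subst_simps)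
  then have "permute_vars \<sigma> (path_poly N w) * path_denom N (\<sigma> \<circ> w) = permute_vars \<sigma> (vandermonde N)"
    using path_poly_mult_denom[OF w_permutes N_pos] by (metis permute_vars.subst_mult)
  also have "\<dots> = poly_scale (sign_char \<sigma>) (path_poly N (\<sigma> \<circ> w)) * path_denom N (\<sigma> \<circ> w)"
    by (simp only: permute_vars_vandermonde[OF \<sigma>_permutes] poly_scale_def mult.assoc
      path_poly_mult_denom[OF comp_permutes N_pos])
  finally show ?thesis using path_denom_nonzero[OF comp_permutes] by simp
qed

lemma path_poly_in_V_deg:
  assumes "w permutes {1..n + 1}"
  shows "path_poly (n + 1) w \<in> V_deg n (n choose 2)"
proof -
  have "tree_poly (n + 1) 1 (path_parent w) \<in> V_deg n (n choose 2)"
    unfolding V_deg_top_eq_span_trees using rooted_tree_path[OF assms]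
    by (intro cpoly.span_base) auto
  then show ?thesis
    unfolding path_poly_def
    by (rule sign_mult_mem_subspace[OF subspace_V_deg]) (simp add: minus_one_power_iff)
qed

definition root_words :: "nat \<Rightarrow> (nat \<Rightarrow> nat) set" where
  "root_words N = {w. w permutes {1..N} \<and> w 1 = 1}"

lemma root_words_permutes: "w \<in> root_words N \<Longrightarrow> w permutes {1..N}"
  by (simp add: root_words_def)

lemma inv_root_words: "w \<in> root_words N \<Longrightarrow> inv' w 1 = 1"
  using permutes_inv_eq[of w "{1..N}" 1 1] by (simp add: root_words_def)

lemma finite_root_words [simp]: "finite (root_words N)"
  by (rule finite_subset[OF _ finite_permutations[of "{1..N}"]]) (auto simp: root_words_def)

lemma path_poly_root_word: "w \<in> root_words N \<Longrightarrow> path_poly N w = tree_poly N 1 (path_parent w)"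
  using inv_root_words[of w N] by (simp add: path_poly_def)

lemma exists_root_word_of_path_tree:
  assumes tree: "rooted_tree {1..N} 1 par sz" and inj: "inj_on par ({1..N} - {1})"
  obtains w where "w \<in> root_words N" "\<And>v. v \<in> {1..N} - {1} \<Longrightarrow> path_parent w v = par v"
    "\<And>v. v \<in> {1..N} - {1} \<Longrightarrow> path_size N w v = sz v"
proof -
  interpret rooted_tree "{1..N}" 1 par sz by (rule tree)
  define p where "p v = (if v \<in> {1..N} then N + 1 - sz v else v)" for v
  have "bij_betw (\<lambda>k. N + 1 - k) {1..N} {1..N}"
    by (rule bij_betw_byWitness[where f' = "\<lambda>k. N + 1 - k"]) auto
  then have "bij_betw ((\<lambda>k. N + 1 - k) \<circ> sz) {1..N} {1..N}"
    using bij_betw_trans[OF bij_betw_size[OF inj]] by simp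
  then have "bij_betw p {1..N} {1..N}"
    by (rule bij_betw_cong[THEN iffD1, rotated]) (simp add: p_def)
  then have p_permutes: "p permutes {1..N}" by (rule bij_imp_permutes) (auto simp: p_def)
  have inv: "inv' (inv' p) = p" using p_permutes by (rule permutes_inv_inv)
  have p_1: "p 1 = 1" using root_in size_root by (simp add: p_def)
  show ?thesis
  proof
    show "inv' p \<in> root_words N"
      using permutes_inv[OF p_permutes] permutes_inv_eq[OF p_permutes, of 1 1] p_1
      by (simp add: root_words_def)
    fix v assume v_vertex: "v \<in> {1..N} - {1}"
    then have p_v: "p v = N + 1 - sz v" "sz v \<in> {1..N}" using size_in[of v] by (auto simp: p_def)
    then show "path_size N (inv' p) v = sz v"
      using size_less_card[OF v_vertex]
      by (auto simp: path_size_def line_size_def inv p_1[simplified])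
    have "p (par v) = p v - 1"
      using parent_in[OF v_vertex] size_parent[OF inj v_vertex] p_v(1) by (simp add: p_def)
    then have "inv' p (p v - 1) = par v" by (simp add: permutes_inv_eq[OF p_permutes])
    then show "path_parent (inv' p) v = par v"
      using p_v by (auto simp: path_parent_def line_parent_def inv p_1[simplified])
  qed
qed

lemma tree_poly_cong:
  assumes eq: "\<And>v. v \<in> {1..N} - {r} \<Longrightarrow> p v = q v"
  shows "tree_poly N r p = tree_poly N r q"
proof -
  have "(\<Prod>v\<in>{1..N} - {r}. edge_sign (p v) v) = (\<Prod>v\<in>{1..N} - {r}. edge_sign (q v) v)"
    by (intro prod.cong) (simp_all only: eq)
  moreover have "tree_edges {1..N} r p = tree_edges {1..N} r q" using eq by (rule tree_edges_cong)
  ultimately show ?thesis by (simp only: tree_poly_def)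
qed

lemma tree_poly_in_span_paths:
  assumes "rooted_tree {1..N} 1 par sz"
  shows "tree_poly N 1 par \<in> cpoly.span (path_poly N ` root_words N)"
  using assms
proof (induction rule: rooted_tree_induct)
  case (path par sz)
  then obtain w where w_root_word: "w \<in> root_words N"
    "\<And>v. v \<in> {1..N} - {1} \<Longrightarrow> path_parent w v = par v"
    using exists_root_word_of_path_tree by metis
  then have "tree_poly N 1 par = path_poly N w"
    using tree_poly_cong[of N 1 "path_parent w" par] by (simp add: path_poly_root_word)
  then show ?case using w_root_word(1) by (simp add: cpoly.span_base)
next
  case (rehang par sz b c)
  then show ?case
    unfolding tree_poly_rehang[OF rehang(1-5)] by (intro cpoly.span_add)
qed

lemma V_deg_top_eq_span_paths:
  "V_deg n (n choose 2) = cpoly.span (path_poly (n + 1) ` root_words (n + 1))"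
proof
  show "V_deg n (n choose 2) \<subseteq> cpoly.span (path_poly (n + 1) ` root_words (n + 1))"
    unfolding V_deg_top_eq_span_trees
    using tree_poly_in_span_paths by (intro cpoly.span_minimal cpoly.subspace_span) blast
  show "cpoly.span (path_poly (n + 1) ` root_words (n + 1)) \<subseteq> V_deg n (n choose 2)"
    using path_poly_in_V_deg root_words_permutes by (intro cpoly.span_minimal subspace_V_deg) blast
qed

section \<open>Linear independence of the path polynomials\<close>

lemma increasing_permutes_id:
  fixes v :: "nat \<Rightarrow> nat"
  assumes "v permutes {1..N}" "\<And>i. i \<in> {1..<N} \<Longrightarrow> v i < v (i + 1)"
  shows "v = id"
proof (rule permutes_natset_ge[OF assms(1)], rule ballI)
  fix i assume "i \<in> {1..N}"
  then have "1 \<le> i" "i \<le> N" by auto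
  then show "i \<le> v i"
  proof (induction i rule: dec_induct)
    case base
    then show ?case using permutes_in_image[OF assms(1), of 1] by simp
  next
    case (step i)
    then show ?case using assms(2)[of i] by simp
  qed
qed

lemma tendsto_power_div_power:
  assumes "i < j"
  shows "((\<lambda>t::real. t ^ i / t ^ j) \<longlongrightarrow> 0) at_top"
proof -
  have "((\<lambda>t::real. inverse t ^ (j - i)) \<longlongrightarrow> 0 ^ (j - i)) at_top"
    by (intro tendsto_power tendsto_inverse_0_at_top filterlim_ident)
  moreover have "\<forall>\<^sub>F t::real in at_top. inverse t ^ (j - i) = t ^ i / t ^ j"
    by (rule eventually_mono[OF eventually_gt_at_top[of 0]])
      (use assms in \<open>simp add: power_diff power_inverse field_simps\<close>)
  ultimately have "((\<lambda>t::real. t ^ i / t ^ j) \<longlongrightarrow> 0 ^ (j - i)) at_top"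
    by (rule Lim_transform_eventually)
  then show ?thesis using assms by (simp add: zero_power)
qed

lemma tendsto_power_ratio:
  assumes "i \<noteq> j"
  shows "((\<lambda>t::real. t ^ j / (t ^ i - t ^ j)) \<longlongrightarrow> (if i < j then - 1 else 0)) at_top"
proof (cases "i < j")
  case True
  have "((\<lambda>t::real. 1 / (t ^ i / t ^ j - 1)) \<longlongrightarrow> 1 / (0 - 1)) at_top"
    by (intro tendsto_intros tendsto_power_div_power True) simp
  moreover have "\<forall>\<^sub>F t::real in at_top. 1 / (t ^ i / t ^ j - 1) = t ^ j / (t ^ i - t ^ j)"
    by (rule eventually_mono[OF eventually_gt_at_top[of 0]]) (simp add: divide_simps)
  ultimately have "((\<lambda>t::real. t ^ j / (t ^ i - t ^ j)) \<longlongrightarrow> 1 / (0 - 1)) at_top"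
    by (rule Lim_transform_eventually)
  then show ?thesis using True by simp
next
  case False
  have "((\<lambda>t::real. t ^ j / t ^ i / (1 - t ^ j / t ^ i)) \<longlongrightarrow> 0 / (1 - 0)) at_top"
    using assms False by (intro tendsto_intros tendsto_power_div_power) simp_all
  moreover have "\<forall>\<^sub>F t::real in at_top. t ^ j / t ^ i / (1 - t ^ j / t ^ i)
      = t ^ j / (t ^ i - t ^ j)"
    by (rule eventually_mono[OF eventually_gt_at_top[of 0]]) (simp add: divide_simps)
  ultimately have "((\<lambda>t::real. t ^ j / (t ^ i - t ^ j)) \<longlongrightarrow> 0 / (1 - 0)) at_top"
    by (rule Lim_transform_eventually)
  then show ?thesis using False by simp
qed

lemma poly_eval_vandermonde_nonzero:
  assumes "inj_on x {1..N}"
  shows "poly_eval x (vandermonde N) \<noteq> 0"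
proof -
  have "poly_eval x (edge_poly e) \<noteq> 0" if e_edge: "e \<in> complete_edges N" for e
  proof -
    obtain a b where endpoints: "e = {a, b}" "a < b" "a \<in> {1..N}" "b \<in> {1..N}"
      using e_edge by (rule complete_edgesE)
    then have "x a \<noteq> x b" using inj_onD[OF assms, of a b] by auto
    then show ?thesis using endpoints
      by (simp add: edge_poly_pair edge_sign_def poly_eval.subst_diff)
  qed
  then show ?thesis by (simp add: graph_poly_def poly_eval.subst_prod)
qed

definition path_ratio :: "nat \<Rightarrow> (nat \<Rightarrow> 'a::field) \<Rightarrow> (nat \<Rightarrow> nat) \<Rightarrow> 'a" where
  "path_ratio N x w = (\<Prod>i\<in>{1..<N}. x (w (i + 1)) / (x (w i) - x (w (i + 1))))"

lemma prod_root_word: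
  assumes w_root_word: "w \<in> root_words N"
  shows "(\<Prod>v\<in>{1..N} - {1}. f v) = (\<Prod>i\<in>{1..<N}. f (w (i + 1)))"
proof -
  have inj: "inj w" using root_words_permutes[OF w_root_word] by (rule permutes_inj)
  have "w ` ({1..N} - {1}) = {1..N} - {1}"
    using w_root_word permutes_image[of w "{1..N}"]
    by (simp add: image_set_diff[OF inj] root_words_def)
  then have "(\<Prod>v\<in>{1..N} - {1}. f v) = (\<Prod>v\<in>w ` ({1..N} - {1}). f v)" by (simp only:)
  also have "\<dots> = (\<Prod>i\<in>{1..N} - {1}. f (w i))"
    by (simp add: prod.reindex[OF inj_on_subset[OF inj subset_UNIV]])
  also have "\<dots> = (\<Prod>i\<in>{Suc 1..<Suc N}. f (w i))" by (rule prod.cong) auto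
  also have "(\<Prod>i\<in>{Suc 1..<Suc N}. f (w i)) = (\<Prod>i\<in>{1..<N}. f (w (i + 1)))"
    by (subst prod.shift_bounds_Suc_ivl) simp
  finally show ?thesis .
qed

lemma path_ratio_mult_vandermonde:
  assumes inj_x: "inj_on x {1..N}" and w_root_word: "w \<in> root_words N" and N_pos: "N \<ge> 1"
  shows "path_ratio N x w * poly_eval x (vandermonde N)
    = (\<Prod>v\<in>{1..N} - {1}. x v) * poly_eval x (path_poly N w)"
proof -
  have w_permutes: "w permutes {1..N}" using w_root_word by (rule root_words_permutes)
  have denom: "poly_eval x (path_denom N w) = (\<Prod>i\<in>{1..<N}. x (w i) - x (w (i + 1)))"
    by (simp add: path_denom_def poly_eval.subst_simps)
  have "poly_eval x (path_poly N w) * poly_eval x (path_denom N w) = poly_eval x (vandermonde N)"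
    unfolding poly_eval.subst_mult[symmetric] path_poly_mult_denom[OF w_permutes N_pos]
    by (rule refl)
  moreover from this have "poly_eval x (path_denom N w) \<noteq> 0"
    using poly_eval_vandermonde_nonzero[OF inj_x] by auto
  ultimately show ?thesis
    unfolding path_ratio_def prod_root_word[OF w_root_word] prod_dividef denom
    by (simp add: field_simps)
qed

lemma sum_path_ratio_eq_zero:
  assumes inj_x: "inj_on x {1..N}" and N_pos: "N \<ge> 1"
    and zero: "(\<Sum>w\<in>root_words N. poly_scale (a w) (path_poly N w)) = 0"
  shows "(\<Sum>w\<in>root_words N. a w * path_ratio N x w) = 0"
proof -
  let ?X = "\<Prod>v\<in>{1..N} - {1}. x v"
  have "(\<Sum>w\<in>root_words N. a w * path_ratio N x w) * poly_eval x (vandermonde N)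
      = (\<Sum>w\<in>root_words N. ?X * (a w * poly_eval x (path_poly N w)))"
    unfolding sum_distrib_right
    by (intro sum.cong refl) (simp only: mult.assoc path_ratio_mult_vandermonde[OF inj_x _ N_pos]
      mult.left_commute)
  also have "\<dots> = ?X * poly_eval x (\<Sum>w\<in>root_words N. poly_scale (a w) (path_poly N w))"
    by (simp add: poly_eval.subst_sum sum_distrib_left)
  finally show ?thesis
    using zero poly_eval_vandermonde_nonzero[OF inj_x] by (simp add: poly_eval.subst_zero)
qed

lemma inj_power_inv_permutes:
  assumes "u permutes S" "(t::real) > 1"
  shows "inj (\<lambda>v. complex_of_real (t ^ inv' u v))"
  using assms(2) permutes_inj[OF permutes_inv[OF assms(1)]]
  by (simp add: inj_def del: of_real_power)

lemma prod_ascents_eq_zero: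
  fixes u w :: "nat \<Rightarrow> nat"
  assumes u_permutes: "u permutes {1..N}" and w_permutes: "w permutes {1..N}" and "w \<noteq> u"
  shows "(\<Prod>i\<in>{1..<N}. if inv' u (w i) < inv' u (w (i + 1)) then a else 0)
      = (0::'a::comm_semiring_1)"
proof -
  have "\<exists>i\<in>{1..<N}. \<not> inv' u (w i) < inv' u (w (i + 1))"
  proof (rule ccontr)
    assume "\<not> ?thesis"
    moreover have "(inv' u \<circ> w) permutes {1..N}"
      using w_permutes permutes_inv[OF u_permutes] by (rule permutes_compose)
    ultimately have "inv' u \<circ> w = id" by (intro increasing_permutes_id) auto
    then have "u \<circ> (inv' u \<circ> w) = u" by simp
    then show False using \<open>w \<noteq> u\<close> permutes_inv_o(1)[OF u_permutes] by (simp add: o_assoc)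
  qed
  then show ?thesis by (intro prod_zero) auto
qed

lemma tendsto_path_ratio:
  assumes u_permutes: "u permutes {1..N}" and w_permutes: "w permutes {1..N}"
  shows "((\<lambda>t::real. path_ratio N (\<lambda>v. t ^ inv' u v) w) \<longlongrightarrow> (if w = u then (- 1) ^ (N - 1) else 0))
      at_top"
proof -
  let ?k = "\<lambda>i. inv' u (w i)"
  have "((\<lambda>t::real. path_ratio N (\<lambda>v. t ^ inv' u v) w) \<longlongrightarrow>
      (\<Prod>i\<in>{1..<N}. if ?k i < ?k (i + 1) then - 1 else 0)) at_top"
    unfolding path_ratio_def
    using inj_eq[OF permutes_inj[OF permutes_inv[OF u_permutes]]]
      inj_eq[OF permutes_inj[OF w_permutes]]
    by (intro tendsto_prod tendsto_power_ratio) simp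
  also have "(\<Prod>i\<in>{1..<N}. if ?k i < ?k (i + 1) then - 1 else 0 :: real)
      = (if w = u then (- 1) ^ (N - 1) else 0)"
    using prod_ascents_eq_zero[OF u_permutes w_permutes, of "- 1 :: real"]
      permutes_inverses(2)[OF u_permutes] by simp
  finally show ?thesis .
qed

lemma path_ratio_of_real: "path_ratio N (\<lambda>v. complex_of_real (x v)) w = of_real (path_ratio N x w)"
  by (simp add: path_ratio_def)

lemma path_poly_coefficients_zero:
  assumes N_pos: "N \<ge> 1" and zero: "(\<Sum>w\<in>root_words N. poly_scale (a w) (path_poly N w)) = 0"
    and u_root_word: "u \<in> root_words N"
  shows "a u = 0"
proof -
  have u_permutes: "u permutes {1..N}" using u_root_word by (rule root_words_permutes)
  let ?R = "\<lambda>t w. path_ratio N (\<lambda>v. t ^ inv' u v) w"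
  have "((\<lambda>t. \<Sum>w\<in>root_words N. a w * of_real (?R t w)) \<longlongrightarrow>
      (\<Sum>w\<in>root_words N. a w * of_real (if w = u then (- 1) ^ (N - 1) else 0))) at_top"
    using root_words_permutes
    by (intro tendsto_sum tendsto_mult tendsto_const tendsto_of_real tendsto_path_ratio u_permutes)
  also have "(\<Sum>w\<in>root_words N. a w * of_real (if w = u then (- 1) ^ (N - 1) else 0))
      = a u * (- 1) ^ (N - 1)"
    using u_root_word by (simp add: if_distrib sum.delta' cong: if_cong)
  finally have "((\<lambda>t. \<Sum>w\<in>root_words N. a w * of_real (?R t w)) \<longlongrightarrow> a u * (- 1) ^ (N - 1)) at_top" .
  moreover have "(\<Sum>w\<in>root_words N. a w * of_real (?R t w)) = 0" if "t > 1" for t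
    unfolding path_ratio_of_real[symmetric]
    using inj_on_subset[OF inj_power_inv_permutes[OF u_permutes that] subset_UNIV]
    by (rule sum_path_ratio_eq_zero[OF _ N_pos zero])
  then have "((\<lambda>t. \<Sum>w\<in>root_words N. a w * of_real (?R t w)) \<longlongrightarrow> 0) at_top"
    by (intro tendsto_eventually eventually_mono[OF eventually_gt_at_top[of 1]])
  ultimately have "a u * (- 1) ^ (N - 1) = 0"
    using tendsto_unique trivial_limit_at_top_linorder by blast
  then show ?thesis by simp
qed

lemma
  assumes "N \<ge> 1"
  shows inj_on_path_poly: "inj_on (path_poly N) (root_words N)"
    and independent_path_polys: "cpoly.independent (path_poly N ` root_words N)"
  by (rule cpoly.independent_family[OF finite_root_words],
      erule (1) path_poly_coefficients_zero[OF assms])+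

section \<open>The major index functional\<close>

definition unity_root :: "nat \<Rightarrow> complex" where
  "unity_root N = exp (2 * of_real pi * \<i> / of_nat N)"

lemma unity_root_power: "unity_root N ^ k = cis (2 * pi * real k / real N)"
  by (simp add: unity_root_def cis_conv_exp flip: exp_of_nat_mult) (simp add: field_simps)

lemma unity_root_nonzero [simp]: "unity_root N \<noteq> 0"
  by (simp add: unity_root_def)

lemma unity_root_power_N: "N \<ge> 1 \<Longrightarrow> unity_root N ^ N = 1"
  by (simp add: unity_root_power)

lemma unity_root_power_eq_iff:
  assumes "j < N" "k < N"
  shows "unity_root N ^ j = unity_root N ^ k \<longleftrightarrow> j = k"
proof -
  have "inj_on (\<lambda>k. unity_root N ^ k) {..<N}"
    using bij_betw_roots_unity[of N] assms by (simp add: bij_betw_def unity_root_power)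
  then show ?thesis using assms by (simp add: inj_on_eq_iff)
qed

lemma unity_root_power_neq_1: "0 < k \<Longrightarrow> k < N \<Longrightarrow> unity_root N ^ k \<noteq> 1"
  using unity_root_power_eq_iff[of k N 0] by simp

lemma sum_unity_root_powers:
  assumes "j < N" "N \<ge> 2"
  shows "(\<Sum>k<N. (unity_root N ^ j * inverse (unity_root N)) ^ k) = (if j = 1 then of_nat N else 0)"
proof (cases "j = 1")
  case False
  let ?\<omega> = "unity_root N" and ?r = "unity_root N ^ j * inverse (unity_root N)"
  have "?\<omega> ^ j \<noteq> ?\<omega> ^ 1" using False assms by (subst unity_root_power_eq_iff) auto
  then have "?r \<noteq> 1" by (simp add: field_simps)
  moreover have "?r ^ N = (?\<omega> ^ N) ^ j * inverse (?\<omega> ^ N)"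
    by (simp add: power_mult_distrib power_inverse mult.commute flip: power_mult)
  then have "?r ^ N = 1" using assms(2) by (simp add: unity_root_power_N)
  ultimately show ?thesis using False by (simp add: sum_gp_strict)
qed simp

definition edge_weight :: "nat \<Rightarrow> nat \<Rightarrow> nat \<Rightarrow> nat \<Rightarrow> complex" where
  "edge_weight N a b s = (if b < a then unity_root N ^ s else 1) / (1 - unity_root N ^ s)"

lemma edge_weight_partial_fractions:
  assumes "v \<noteq> b" "v \<noteq> c" "b \<noteq> c" "0 < s" "0 < t" "s + t < N"
  shows "edge_weight N v b s * edge_weight N v c t =
    edge_weight N v b (s + t) * edge_weight N b c t
    + edge_weight N v c (s + t) * edge_weight N c b s"
proof -
  define X Y where "X = unity_root N ^ s" and "Y = unity_root N ^ t"
  have "X \<noteq> 1" "Y \<noteq> 1" "X * Y \<noteq> 1"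
    using unity_root_power_neq_1[of _ N] assms unfolding X_def Y_def power_add[symmetric] by auto
  then have nonzero: "1 - X \<noteq> 0" "1 - Y \<noteq> 0" "1 - X * Y \<noteq> 0" by auto
  have [simp]: "unity_root N ^ (s + t) = X * Y" by (simp add: X_def Y_def power_add)
  consider "v < b" "b < c" | "v < c" "c < b" | "b < v" "v < c" | "c < v" "v < b" | "b < c" "c < v" |
    "c < b" "b < v"
    using assms(1-3) by linarith
  then show ?thesis
    by cases (use nonzero in \<open>simp_all add: edge_weight_def divide_simps flip: X_def Y_def\<close>;
      simp add: algebra_simps)+
qed

lemma edge_weight_reverse:
  assumes "a \<noteq> b" "0 < i" "i < N"
  shows "edge_weight N b a i = - edge_weight N a b (N - i)"
proof -
  define X Y where "X = unity_root N ^ i" and "Y = unity_root N ^ (N - i)"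
  have XY_inverse: "X * Y = 1" using assms unity_root_power_N[of N]
    by (simp add: X_def Y_def flip: power_add)
  have nonzero: "X \<noteq> 1" "Y \<noteq> 1" "X \<noteq> 0"
    using unity_root_power_neq_1[of _ N] assms unfolding X_def Y_def by auto
  then have "X / (1 - X) = - (1 / (1 - Y))" "1 / (1 - X) = - (Y / (1 - Y))"
    using XY_inverse by (simp_all add: divide_simps) (simp_all add: algebra_simps)
  then show ?thesis
    using assms(1) by (simp add: edge_weight_def flip: X_def Y_def)
qed

abbreviation tree_weight :: "nat \<Rightarrow> (nat \<Rightarrow> nat) \<Rightarrow> (nat \<Rightarrow> nat) \<Rightarrow> complex" where
  "tree_weight N \<equiv> tree_prod (edge_weight N) {1..N} 1"

lemma tree_weight_rehang:
  assumes tree: "rooted_tree {1..N} 1 par sz"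
    and b_vertex: "b \<in> {1..N} - {1}" and c_vertex: "c \<in> {1..N} - {1}"
    and siblings: "b \<noteq> c" "par b = par c"
  shows "tree_weight N par sz = tree_weight N (par(c := b)) (sz(b := sz b + sz c))
    + tree_weight N (par(b := c)) (sz(c := sz c + sz b))"
proof -
  interpret rooted_tree "{1..N}" 1 par sz by (rule tree)
  define Q where "Q = tree_prod (edge_weight N) ({1..N} - {b, c}) 1 par sz"
  have split: "tree_weight N p s = edge_weight N (p b) b (s b) * edge_weight N (p c) c (s c) * Q"
    if "\<And>u. u \<notin> {b, c} \<Longrightarrow> p u = par u \<and> s u = sz u" for p s
  proof -
    have "tree_prod (edge_weight N) ({1..N} - {b, c}) 1 p s = Q"
      unfolding Q_def by (rule tree_prod_cong) (simp add: that)
    with tree_prod_remove2[OF finite_vertices b_vertex c_vertex siblings(1), of "edge_weight N" p s]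
    show ?thesis by (simp only:)
  qed
  have "sz b + sz c < N"
    using rooted_tree.size_less_card[OF rehang[OF b_vertex c_vertex siblings] b_vertex] by simp
  then have "edge_weight N (par b) b (sz b) * edge_weight N (par b) c (sz c) =
      edge_weight N (par b) b (sz b + sz c) * edge_weight N b c (sz c)
      + edge_weight N (par b) c (sz b + sz c) * edge_weight N c b (sz b)"
    using parent_neq b_vertex c_vertex siblings size_pos
    by (intro edge_weight_partial_fractions) auto
  then show ?thesis
    using split[of par sz] split[of "par(c := b)" "sz(b := sz b + sz c)"]
      split[of "par(b := c)" "sz(c := sz c + sz b)"] siblings
    by (simp add: algebra_simps)
qed

lemma exists_tree_functional:
  assumes N_pos: "N \<ge> 1"
  obtains \<Lambda> where "Vector_Spaces.linear poly_scale (*) \<Lambda>"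
    "\<And>par sz. rooted_tree {1..N} 1 par sz \<Longrightarrow> \<Lambda> (tree_poly N 1 par) = tree_weight N par sz"
proof -
  interpret vector_space_pair poly_scale "(*) :: complex \<Rightarrow> complex \<Rightarrow> complex"
    by (rule vector_space_pair.intro[OF vector_space_poly_scale vector_space_complex])
  obtain \<Lambda> where lin: "Vector_Spaces.linear poly_scale (*) \<Lambda>"
    and functional_path: "\<And>w. w \<in> root_words N \<Longrightarrow> \<Lambda> (path_poly N w)
        = tree_weight N (path_parent w) (path_size N w)"
    using linear_extend_family[OF inj_on_path_poly[OF N_pos] independent_path_polys[OF N_pos],
      where h = "\<lambda>w. tree_weight N (path_parent w) (path_size N w)"] by blast
  interpret \<Lambda>: Vector_Spaces.linear poly_scale "(*)" \<Lambda> by (rule lin)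
  have "\<Lambda> (tree_poly N 1 par) = tree_weight N par sz" if "rooted_tree {1..N} 1 par sz" for par sz
    using that
  proof (induction rule: rooted_tree_induct)
    case (path par sz)
    then obtain w where w_root_word: "w \<in> root_words N"
      and par: "\<And>v. v \<in> {1..N} - {1} \<Longrightarrow> path_parent w v = par v"
      and size: "\<And>v. v \<in> {1..N} - {1} \<Longrightarrow> path_size N w v = sz v"
      using exists_root_word_of_path_tree by metis
    have "tree_poly N 1 par = path_poly N w"
      using tree_poly_cong[OF par] by (simp only: path_poly_root_word[OF w_root_word])
    moreover have "tree_weight N (path_parent w) (path_size N w) = tree_weight N par sz"
      by (rule tree_prod_cong) (simp only: par size)
    ultimately show ?case using functional_path[OF w_root_word] by simp
  next
    case (rehang par sz b c)
    show ?case
      unfolding tree_poly_rehang[OF rehang(1-5)] tree_weight_rehang[OF rehang(1-5)] \<Lambda>.add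
        rehang(6,7)
      by (rule refl)
  qed
  then show ?thesis using lin that by blast
qed

lemma exists_path_functional:
  assumes N_pos: "N \<ge> 1"
  obtains \<Lambda> where "Vector_Spaces.linear poly_scale (*) \<Lambda>"
    "\<And>w. w permutes {1..N} \<Longrightarrow> \<Lambda> (path_poly N w)
        = (\<Prod>i\<in>{1..<N}. edge_weight N (w i) (w (i + 1)) (N - i))"
proof -
  obtain \<Lambda> where lin: "Vector_Spaces.linear poly_scale (*) \<Lambda>"
    and functional_tree: "\<And>par sz. rooted_tree {1..N} 1 par sz \<Longrightarrow> \<Lambda> (tree_poly N 1 par)
        = tree_weight N par sz"
    using exists_tree_functional[OF N_pos] by blast
  interpret \<Lambda>: Vector_Spaces.linear poly_scale "(*)" \<Lambda> by (rule lin)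
  have sign: "\<Lambda> ((- 1) ^ k * p) = (- 1) ^ k * \<Lambda> p" for k p
    by (cases "even k") (simp_all add: \<Lambda>.neg)
  have "\<Lambda> (path_poly N w) = (\<Prod>i\<in>{1..<N}. edge_weight N (w i) (w (i + 1)) (N - i))"
    if w_permutes: "w permutes {1..N}" for w
    unfolding path_poly_def sign functional_tree[OF rooted_tree_path[OF w_permutes N_pos]]
    using inj_eq[OF permutes_inj[OF w_permutes]]
    by (intro tree_prod_path[OF w_permutes N_pos] edge_weight_reverse) auto
  then show ?thesis using lin that by blast
qed

section \<open>Rotations and the major index\<close>

lemma long_cycle_permutes: "long_cycle N permutes {1..N}"
proof -
  have "set [1..<Suc N] = {1..N}" by auto
  then show ?thesis using cycle_permutes[of "[1..<Suc N]"] unfolding long_cycle_def by metis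
qed

lemma long_cycle_apply:
  assumes "i \<in> {1..N}"
  shows "long_cycle N i = Suc (i mod N)"
proof -
  let ?c = "[1..<Suc N]"
  have "map (long_cycle N ^^ 1) ?c = rotate 1 ?c"
    unfolding long_cycle_def by (rule cyclic_rotation) simp
  then have "map (long_cycle N) ?c ! (i - 1) = rotate 1 ?c ! (i - 1)" by (simp del: upt_Suc)
  moreover have "rotate 1 ?c ! (i - 1) = Suc (i mod N)"
    using assms by (subst nth_rotate) (auto simp del: upt_Suc)
  moreover have "map (long_cycle N) ?c ! (i - 1) = long_cycle N i"
    using assms by (subst nth_map) (auto simp del: upt_Suc)
  ultimately show ?thesis by (simp only:)
qed

lemma long_cycle_eq_if: "i \<in> {1..N} \<Longrightarrow> long_cycle N i = (if i = N then 1 else Suc i)"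
  by (auto simp: long_cycle_apply)

lemma long_cycle_neq: "N \<ge> 2 \<Longrightarrow> i \<in> {1..N} \<Longrightarrow> long_cycle N i \<noteq> i"
  by (auto simp: long_cycle_eq_if)

lemma long_cycle_funpow_1:
  assumes "N \<ge> 1"
  shows "(long_cycle N ^^ k) 1 = Suc (k mod N)"
proof (induction k)
  case (Suc k)
  have "Suc (k mod N) \<in> {1..N}" using assms by (simp add: Suc_leI)
  then show ?case using Suc by (simp add: long_cycle_apply mod_Suc_eq)
qed simp

lemma long_cycle_funpow_permutes: "(long_cycle N ^^ k) permutes {1..N}"
  by (rule permutes_funpow[OF long_cycle_permutes])

definition cyclic_descents :: "nat \<Rightarrow> (nat \<Rightarrow> nat) \<Rightarrow> nat set" where
  "cyclic_descents N w = {i \<in> {1..N}. w (long_cycle N i) < w i}"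

lemma cyclic_descents_subset: "cyclic_descents N w \<subseteq> {1..N}"
  by (auto simp: cyclic_descents_def)

lemma finite_cyclic_descents [simp]: "finite (cyclic_descents N w)"
  by (simp add: cyclic_descents_def)

text \<open>This is \<open>\<omega>\<close> to the power \<open>- maj w\<close>, as a cyclic descent at \<open>N\<close> contributes \<open>\<omega>\<^sup>0 = 1\<close>.\<close>

definition maj_weight :: "nat \<Rightarrow> (nat \<Rightarrow> nat) \<Rightarrow> complex" where
  "maj_weight N w = (\<Prod>i\<in>cyclic_descents N w. unity_root N ^ (N - i))"

lemma maj_weight_nonzero: "maj_weight N w \<noteq> 0"
  by (simp add: maj_weight_def)

lemma prod_edge_weight_path:
  "(\<Prod>i\<in>{1..<N}. edge_weight N (w i) (w (i + 1)) (N - i))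
    = maj_weight N w / (\<Prod>i\<in>{1..<N}. 1 - unity_root N ^ (N - i))"
proof -
  have "maj_weight N w
      = (\<Prod>i\<in>{1..N}. if w (long_cycle N i) < w i then unity_root N ^ (N - i) else 1)"
    unfolding maj_weight_def cyclic_descents_def by (rule prod.inter_filter) simp
  also have "\<dots> = (\<Prod>i\<in>{1..<N}. if w (long_cycle N i) < w i then unity_root N ^ (N - i) else 1)"
    by (rule prod.mono_neutral_right) auto
  also have "\<dots> = (\<Prod>i\<in>{1..<N}. if w (i + 1) < w i then unity_root N ^ (N - i) else 1)"
    by (intro prod.cong) (auto simp: long_cycle_eq_if)
  finally show ?thesis by (simp add: edge_weight_def prod_dividef)
qed

lemma exists_major_index_functional:
  assumes N_pos: "N \<ge> 1"
  obtains \<Lambda> where "Vector_Spaces.linear poly_scale (*) \<Lambda>"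
    "\<And>w. w permutes {1..N} \<Longrightarrow> \<Lambda> (path_poly N w) = maj_weight N w"
proof -
  define D where "D = (\<Prod>i\<in>{1..<N}. 1 - unity_root N ^ (N - i))"
  have "D \<noteq> 0" using unity_root_power_neq_1[of "N - i" N for i] by (auto simp: D_def)
  obtain \<Lambda> where lin: "Vector_Spaces.linear poly_scale (*) \<Lambda>"
    and functional_path: "\<And>w. w permutes {1..N} \<Longrightarrow>
      \<Lambda> (path_poly N w) = (\<Prod>i\<in>{1..<N}. edge_weight N (w i) (w (i + 1)) (N - i))"
    using exists_path_functional[OF N_pos] by blast
  show ?thesis
  proof
    show "Vector_Spaces.linear poly_scale (*) (\<lambda>p. D * \<Lambda> p)"
      using lin unfolding Vector_Spaces.linear_iff by (simp add: distrib_left mult.left_commute)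
    show "D * \<Lambda> (path_poly N w) = maj_weight N w" if "w permutes {1..N}" for w
      unfolding functional_path[OF that] prod_edge_weight_path D_def[symmetric] using \<open>D \<noteq> 0\<close>
      by simp
  qed
qed

lemma unity_root_shift:
  assumes "i \<in> {1..N}"
  shows "unity_root N ^ (N - i) = unity_root N * unity_root N ^ (N - long_cycle N i)"
proof (cases "i = N")
  case True
  have "unity_root N * unity_root N ^ (N - 1) = unity_root N ^ N"
    using assms by (simp flip: power_Suc)
  then show ?thesis using True assms by (simp add: long_cycle_eq_if unity_root_power_N)
next
  case False
  then have "N - i = Suc (N - long_cycle N i)" using assms by (auto simp: long_cycle_eq_if)
  then show ?thesis by simp
qed

lemma cyclic_descents_rotate_letters:
  assumes w_permutes: "w permutes {1..N}" and N_ge_2: "N \<ge> 2"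
  defines "p \<equiv> inv' w N"
  defines "q \<equiv> inv' (long_cycle N) p"
  shows "insert p (cyclic_descents N (long_cycle N \<circ> w)) = insert q (cyclic_descents N w)"
    and "p \<notin> cyclic_descents N (long_cycle N \<circ> w)" "q \<notin> cyclic_descents N w"
proof -
  let ?c = "long_cycle N"
  have c_permutes: "?c permutes {1..N}" by (rule long_cycle_permutes)
  have p_in: "p \<in> {1..N}" using N_ge_2 unfolding p_def
    by (intro inv_permutes_in[OF w_permutes]) simp
  have q_in: "q \<in> {1..N}" unfolding q_def using p_in by (rule inv_permutes_in[OF c_permutes])
  have w_eq_N_iff: "w i = N \<longleftrightarrow> i = p" and c_eq_p_iff: "?c i = p \<longleftrightarrow> i = q" for i
    using permutes_inv_eq[OF w_permutes, of N i] permutes_inv_eq[OF c_permutes, of p i]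
    by (auto simp: p_def q_def)
  have w_in: "w i \<in> {1..N}" "w (?c i) \<in> {1..N}" if "i \<in> {1..N}" for i
    using that permutes_in_image[OF w_permutes] permutes_in_image[OF c_permutes] by auto
  have desc: "i \<in> cyclic_descents N w \<longleftrightarrow> i \<noteq> q \<and> (i = p \<or> w (?c i) < w i)" if "i \<in> {1..N}" for i
    using that w_eq_N_iff[of i] w_eq_N_iff[of "?c i"] c_eq_p_iff[of i] w_in[OF that]
      long_cycle_neq[OF N_ge_2 that]
    by (auto simp: cyclic_descents_def le_less)
  have desc_c: "i \<in> cyclic_descents N (?c \<circ> w) \<longleftrightarrow> i \<noteq> p \<and> (i = q \<or> w (?c i) < w i)" if "i \<in> {1..N}"
    for i
    using that w_eq_N_iff[of i] w_eq_N_iff[of "?c i"] c_eq_p_iff[of i] w_in[OF that]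
      long_cycle_neq[OF N_ge_2 that]
    by (auto simp: cyclic_descents_def long_cycle_eq_if[OF w_in(1)] long_cycle_eq_if[OF w_in(2)])
  show "p \<notin> cyclic_descents N (?c \<circ> w)" "q \<notin> cyclic_descents N w"
    using desc[OF q_in] desc_c[OF p_in] by auto
  have "p \<noteq> q" using c_eq_p_iff[of q] long_cycle_neq[OF N_ge_2 q_in] by auto
  then have "i \<in> insert p (cyclic_descents N (?c \<circ> w)) \<longleftrightarrow> i \<in> insert q (cyclic_descents N w)"
    if "i \<in> {1..N}" for i
    using desc[OF that] desc_c[OF that] by auto
  then show "insert p (cyclic_descents N (?c \<circ> w)) = insert q (cyclic_descents N w)"
    using p_in q_in cyclic_descents_subset by blast
qed

lemma maj_weight_rotate_letters:
  assumes w_permutes: "w permutes {1..N}" and N_ge_2: "N \<ge> 2"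
  shows "maj_weight N (long_cycle N \<circ> w) = unity_root N * maj_weight N w"
proof -
  define p where "p = inv' w N"
  define q where "q = inv' (long_cycle N) p"
  let ?\<rho> = "\<lambda>i. unity_root N ^ (N - i)"
  note desc = cyclic_descents_rotate_letters[OF assms, folded p_def, folded q_def]
  have "p \<in> {1..N}" using N_ge_2 unfolding p_def by (intro inv_permutes_in[OF w_permutes]) simp
  then have "q \<in> {1..N}" unfolding q_def by (rule inv_permutes_in[OF long_cycle_permutes])
  then have shift: "?\<rho> q = unity_root N * ?\<rho> p"
    using unity_root_shift[of q N] by (simp add: q_def permutes_inverses[OF long_cycle_permutes])
  have "?\<rho> p * maj_weight N (long_cycle N \<circ> w)
      = (\<Prod>i\<in>insert p (cyclic_descents N (long_cycle N \<circ> w)). ?\<rho> i)"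
    using desc(2) by (simp add: maj_weight_def)
  also have "\<dots> = ?\<rho> q * maj_weight N w"
    unfolding desc(1) using desc(3) by (simp add: maj_weight_def)
  finally show ?thesis by (simp add: shift)
qed

lemma maj_weight_rotate_letters_funpow:
  assumes w_permutes: "w permutes {1..N}" and N_ge_2: "N \<ge> 2"
  shows "maj_weight N (long_cycle N ^^ k \<circ> w) = unity_root N ^ k * maj_weight N w"
proof (induction k)
  case (Suc k)
  have "(long_cycle N ^^ k \<circ> w) permutes {1..N}"
    by (rule permutes_compose[OF w_permutes long_cycle_funpow_permutes])
  then have "maj_weight N (long_cycle N \<circ> (long_cycle N ^^ k \<circ> w))
      = unity_root N * maj_weight N (long_cycle N ^^ k \<circ> w)"
    using N_ge_2 by (rule maj_weight_rotate_letters)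
  then show ?case using Suc by (simp only: funpow.simps o_assoc power_Suc mult.assoc)
qed simp

lemma cyclic_descents_rotate_positions:
  "bij_betw (long_cycle N) (cyclic_descents N (w \<circ> long_cycle N)) (cyclic_descents N w)"
proof -
  let ?c = "long_cycle N"
  have c_permutes: "?c permutes {1..N}" by (rule long_cycle_permutes)
  show ?thesis
    by (rule bij_betw_byWitness[where f' = "inv' ?c"])
      (auto simp: cyclic_descents_def permutes_inverses[OF c_permutes]
        permutes_in_image[OF c_permutes] permutes_in_image[OF permutes_inv[OF c_permutes]]
        simp del: atLeastAtMost_iff One_nat_def)
qed

lemma maj_weight_rotate_positions:
  "maj_weight N (w \<circ> long_cycle N) = unity_root N ^ card (cyclic_descents N w) * maj_weight N w"
proof -
  let ?D = "cyclic_descents N (w \<circ> long_cycle N)"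
  have "maj_weight N (w \<circ> long_cycle N)
      = (\<Prod>i\<in>?D. unity_root N * unity_root N ^ (N - long_cycle N i))"
    unfolding maj_weight_def by (intro prod.cong refl unity_root_shift)
      (simp add: cyclic_descents_def)
  also have "\<dots> = (\<Prod>i\<in>cyclic_descents N w. unity_root N * unity_root N ^ (N - i))"
    by (rule prod.reindex_bij_betw[OF cyclic_descents_rotate_positions])
  also have "\<dots> = unity_root N ^ card (cyclic_descents N w) * maj_weight N w"
    by (simp add: maj_weight_def prod.distrib)
  finally show ?thesis .
qed

lemma maj_weight_rotate_positions_funpow:
  "maj_weight N (w \<circ> long_cycle N ^^ k)
      = (unity_root N ^ card (cyclic_descents N w)) ^ k * maj_weight N w"
proof (induction k arbitrary: w)
  case (Suc k)
  have "w \<circ> long_cycle N ^^ Suc k = (w \<circ> long_cycle N) \<circ> long_cycle N ^^ k"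
    by (simp add: o_assoc)
  then show ?case
    using Suc[of "w \<circ> long_cycle N"] bij_betw_same_card[OF cyclic_descents_rotate_positions, of N w]
    by (simp only: maj_weight_rotate_positions power_Suc2 mult.assoc)
qed simp

lemma card_cyclic_descents_less:
  assumes w_permutes: "w permutes {1..N}" and N_pos: "N \<ge> 1"
  shows "card (cyclic_descents N w) < N"
proof -
  have first_in: "inv' w 1 \<in> {1..N}" using N_pos by (intro inv_permutes_in[OF w_permutes]) simp
  then have "w (long_cycle N (inv' w 1)) \<in> {1..N}"
    using permutes_in_image[OF w_permutes] permutes_in_image[OF long_cycle_permutes] by blast
  then have "inv' w 1 \<notin> cyclic_descents N w"
    using permutes_inverses(1)[OF w_permutes, of 1] by (auto simp: cyclic_descents_def)
  then have "cyclic_descents N w \<subset> {1..N}" using first_in cyclic_descents_subset by blast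
  then have "card (cyclic_descents N w) < card {1..N}" by (intro psubset_card_mono) auto
  then show ?thesis by simp
qed

lemma long_cycle_funpow_N:
  assumes "d \<in> {1..N}"
  shows "(long_cycle N ^^ d) N = d"
proof -
  have N_pos: "N \<ge> 1" using assms by simp
  have "(long_cycle N ^^ (d + (N - 1))) 1 = Suc ((d + (N - 1)) mod N)"
    by (rule long_cycle_funpow_1[OF N_pos])
  also have "(d + (N - 1)) mod N = ((d - 1) + N) mod N" using assms by (simp add: algebra_simps)
  also have "Suc \<dots> = d" using assms by (subst mod_add_self2, subst mod_less) auto
  finally have "(long_cycle N ^^ d) ((long_cycle N ^^ (N - 1)) 1) = d" by (simp add: funpow_add)
  then show ?thesis using long_cycle_funpow_1[OF N_pos, of "N - 1"] N_pos by simp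
qed

lemma rotation_of_card_cyclic_descents_1:
  assumes w_permutes: "w permutes {1..N}" and one: "card (cyclic_descents N w) = 1"
  obtains k where "w \<circ> long_cycle N ^^ k = id"
proof -
  let ?c = "long_cycle N"
  obtain d where descents: "cyclic_descents N w = {d}" using one by (rule card_1_singletonE)
  then have d_in: "d \<in> {1..N}" by (auto simp: cyclic_descents_def)
  define v where "v = w \<circ> ?c ^^ d"
  have rotation_permutes: "(?c ^^ d) permutes {1..N}" by (rule long_cycle_funpow_permutes)
  have v_permutes: "v permutes {1..N}" unfolding v_def using rotation_permutes w_permutes
    by (rule permutes_compose)
  have "v i < v (i + 1)" if i_in: "i \<in> {1..<N}" for i
  proof -
    have "(?c ^^ d) i \<noteq> d"
      using long_cycle_funpow_N[OF d_in] inj_eq[OF permutes_inj[OF rotation_permutes], of i N] i_in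
      by auto
    then have "(?c ^^ d) i \<notin> cyclic_descents N w" using descents by simp
    moreover have "(?c ^^ d) i \<in> {1..N}" using permutes_in_image[OF rotation_permutes, of i] i_in
      by auto
    moreover have "?c ((?c ^^ d) i) = (?c ^^ d) (i + 1)"
      using i_in by (simp add: funpow_swap1 long_cycle_eq_if)
    ultimately have "\<not> v (i + 1) < v i" by (simp add: cyclic_descents_def v_def)
    moreover have "v i \<noteq> v (i + 1)" using inj_eq[OF permutes_inj[OF v_permutes], of i "i + 1"]
      by simp
    ultimately show ?thesis by simp
  qed
  then have "v = id" by (rule increasing_permutes_id[OF v_permutes])
  then show ?thesis using that by (simp add: v_def)
qed

section \<open>The isomorphism in top degree\<close>

lemma sym_group_pow: "x [^]\<^bsub>sym_group N\<^esub> (k::nat) = x ^^ k"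
proof -
  interpret group "sym_group N" by (rule sym_group_is_group)
  show ?thesis
    by (induction k) (simp_all add: sym_group_one sym_group_mult funpow_Suc_right
      del: funpow.simps(2))
qed

lemma cyclic_subgroup_eq: "cyclic_subgroup N = range (\<lambda>k. long_cycle N ^^ k)"
proof -
  interpret group "sym_group N" by (rule sym_group_is_group)
  have "finite (carrier (sym_group N))" by (simp add: sym_group_def finite_permutations)
  then show ?thesis
    using generate_pow_on_finite_carrier[of "long_cycle N"] long_cycle_permutes
    by (auto simp: cyclic_subgroup_def sym_group_carrier sym_group_pow)
qed

lemma subgroup_cyclic_subgroup: "subgroup (cyclic_subgroup N) (sym_group N)"
proof -
  interpret group "sym_group N" by (rule sym_group_is_group)
  show ?thesis
    unfolding cyclic_subgroup_def
    by (rule generate_is_subgroup) (use long_cycle_permutes in \<open>simp add: sym_group_carrier\<close>)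
qed

lemma zeta_long_cycle_power: "N \<ge> 1 \<Longrightarrow> zeta N (long_cycle N ^^ k) = unity_root N ^ k"
  unfolding unity_root_def by (rule zeta_long_cycle_funpow)

lemma rotate_to_root_word:
  assumes g_permutes: "g permutes {1..N}" and N_pos: "N \<ge> 1"
  obtains k where "g \<circ> long_cycle N ^^ k \<in> root_words N"
proof
  have "inv' g 1 \<in> {1..N}" using N_pos by (intro inv_permutes_in[OF g_permutes]) simp
  then have "(long_cycle N ^^ (inv' g 1 - 1)) 1 = inv' g 1"
    by (subst long_cycle_funpow_1[OF N_pos]) auto
  then have "(g \<circ> long_cycle N ^^ (inv' g 1 - 1)) 1 = 1"
    using permutes_inverses(1)[OF g_permutes] by (simp only: comp_apply)
  then show "g \<circ> long_cycle N ^^ (inv' g 1 - 1) \<in> root_words N"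
    using permutes_compose[OF long_cycle_funpow_permutes g_permutes] by (simp add: root_words_def)
qed

lemma root_words_eq_if_rotation:
  assumes v_root_word: "v \<in> root_words N" and w_root_word: "w \<in> root_words N" and N_pos: "N \<ge> 1"
    and rotation: "inv' v \<circ> w = long_cycle N ^^ k"
  shows "v = w"
proof -
  have v_permutes: "v permutes {1..N}" using v_root_word by (rule root_words_permutes)
  have "(inv' v \<circ> w) 1 = 1" using w_root_word inv_root_words[OF v_root_word]
    by (simp add: root_words_def)
  then have "k mod N = 0 mod N" using long_cycle_funpow_1[OF N_pos, of k] by (simp add: rotation)
  then have "long_cycle N ^^ k = long_cycle N ^^ 0" using long_cycle_funpow_eq_iff[OF N_pos]
    by blast
  then have "v \<circ> (inv' v \<circ> w) = v" by (simp add: rotation)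
  then show ?thesis by (simp add: o_assoc permutes_inv_o[OF v_permutes])
qed

lemma left_transversal_root_words:
  assumes N_pos: "N \<ge> 1"
  shows "left_transversal (sym_group N) (cyclic_subgroup N) (root_words N)"
  unfolding left_transversal_def
proof (intro conjI ballI impI subsetI)
  show "g \<in> carrier (sym_group N)" if "g \<in> root_words N" for g
    using root_words_permutes[OF that] by (simp add: sym_group_carrier)
  show "\<exists>h\<in>cyclic_subgroup N. g \<otimes>\<^bsub>sym_group N\<^esub> h \<in> root_words N" if "g \<in> carrier (sym_group N)"
    for g
    using that rotate_to_root_word[OF _ N_pos, of g]
    by (auto simp: sym_group_carrier sym_group_mult cyclic_subgroup_eq)
  show "v = w" if v_root_word: "v \<in> root_words N" and w_root_word: "w \<in> root_words N"
    and rotation: "inv\<^bsub>sym_group N\<^esub> v \<otimes>\<^bsub>sym_group N\<^esub> w \<in> cyclic_subgroup N" for v w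
  proof -
    have "inv\<^bsub>sym_group N\<^esub> v = inv' v" using root_words_permutes[OF v_root_word]
      by (simp add: sym_group_carrier)
    then obtain k where "inv' v \<circ> w = long_cycle N ^^ k"
      using rotation by (auto simp: sym_group_mult cyclic_subgroup_eq)
    then show ?thesis by (rule root_words_eq_if_rotation[OF v_root_word w_root_word N_pos])
  qed
qed

lemma sign_char_square [simp]: "sign_char \<sigma> * sign_char \<sigma> = 1"
  unfolding sign_char_def by (simp only: sign_idempotent of_int_1 flip: of_int_mult)

lemma linear_character_sign_char: "linear_character (sym_group N) sign_char"
proof -
  have "permutation \<sigma>" if "\<sigma> permutes {1..N}" for \<sigma> using that by (auto simp: permutation_permutes)
  then show ?thesis
    by (simp add: linear_character_def sign_char_def sym_group_carrier sym_group_mult sym_group_one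
      sign_compose)
qed

definition signed_act :: "(nat \<Rightarrow> nat) \<Rightarrow> cpoly \<Rightarrow> cpoly" where
  "signed_act \<sigma> p = poly_scale (sign_char \<sigma>) (permute_vars \<sigma> p)"

lemma linear_signed_act: "Vector_Spaces.linear poly_scale poly_scale (signed_act \<sigma>)"
  unfolding Vector_Spaces.linear_iff
  by (simp add: signed_act_def vector_space_poly_scale permute_vars.subst_add
    cpoly.scale_right_distrib mult.commute)

lemma signed_act_path_poly:
  assumes "\<sigma> permutes {1..N}" "w permutes {1..N}" "N \<ge> 1"
  shows "signed_act \<sigma> (path_poly N w) = path_poly N (\<sigma> \<circ> w)"
  unfolding signed_act_def permute_vars_path_poly[OF assms] by simp

definition klyachko_element :: "nat \<Rightarrow> cpoly" where
  "klyachko_element N = (\<Sum>k<N. poly_scale (inverse (unity_root N) ^ k)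
      (path_poly N (long_cycle N ^^ k)))"

locale major_index_functional =
  fixes N :: nat and \<Lambda> :: "cpoly \<Rightarrow> complex"
  assumes N_ge_2: "N \<ge> 2"
    and linear_functional: "Vector_Spaces.linear poly_scale (*) \<Lambda>"
    and functional_path_poly: "\<And>w. w permutes {1..N} \<Longrightarrow> \<Lambda> (path_poly N w) = maj_weight N w"
begin

interpretation functional: Vector_Spaces.linear poly_scale "(*)" \<Lambda>
  by (rule linear_functional)

lemma semi_invariant:
  assumes p_in: "p \<in> cpoly.span (path_poly N ` root_words N)"
  shows "\<Lambda> (signed_act (long_cycle N ^^ k) p) = unity_root N ^ k * \<Lambda> p"
proof -
  interpret vector_space_pair poly_scale "(*) :: complex \<Rightarrow> complex \<Rightarrow> complex" ..
  let ?c = "long_cycle N ^^ k"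
  have on_paths: "\<Lambda> (signed_act ?c (path_poly N w)) = unity_root N ^ k * \<Lambda> (path_poly N w)"
    if "w \<in> root_words N" for w
  proof -
    have w_permutes: "w permutes {1..N}" using that by (rule root_words_permutes)
    have "signed_act ?c (path_poly N w) = path_poly N (?c \<circ> w)"
      using N_ge_2 by (intro signed_act_path_poly long_cycle_funpow_permutes w_permutes) simp
    then show ?thesis
      by (simp only: functional_path_poly[OF w_permutes]
        maj_weight_rotate_letters_funpow[OF w_permutes N_ge_2]
        functional_path_poly[OF permutes_compose[OF w_permutes long_cycle_funpow_permutes]])
  qed
  have rotated: "Vector_Spaces.linear poly_scale (*) (\<lambda>p. \<Lambda> (signed_act ?c p))"
    using Vector_Spaces.linear_compose[OF linear_signed_act linear_functional]
    by (simp add: comp_def)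
  have scaled: "Vector_Spaces.linear poly_scale (*) (\<lambda>p. unity_root N ^ k * \<Lambda> p)"
    using linear_functional by (rule linear_compose_scale_right)
  show ?thesis
    by (rule linear_eq_on[OF rotated scaled p_in]) (elim imageE, simp only: on_paths)
qed

lemma functional_klyachko_element:
  assumes g_permutes: "g permutes {1..N}"
  shows "\<Lambda> (signed_act g (klyachko_element N)) =
    (if card (cyclic_descents N g) = 1 then of_nat N * maj_weight N g else 0)"
proof -
  interpret signed_act: Vector_Spaces.linear poly_scale poly_scale "signed_act g"
    by (rule linear_signed_act)
  let ?r = "unity_root N ^ card (cyclic_descents N g) * inverse (unity_root N)"
  have on_rotations: "\<Lambda> (signed_act g (path_poly N (long_cycle N ^^ k)))
      = (unity_root N ^ card (cyclic_descents N g)) ^ k * maj_weight N g" for k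
  proof -
    have "signed_act g (path_poly N (long_cycle N ^^ k)) = path_poly N (g \<circ> long_cycle N ^^ k)"
      using N_ge_2 by (intro signed_act_path_poly g_permutes long_cycle_funpow_permutes) simp
    then show ?thesis
      using functional_path_poly[OF permutes_compose[OF long_cycle_funpow_permutes g_permutes]]
      by (simp only: maj_weight_rotate_positions_funpow)
  qed
  have "\<Lambda> (signed_act g (klyachko_element N)) = (\<Sum>k<N. inverse (unity_root N) ^ k *
      ((unity_root N ^ card (cyclic_descents N g)) ^ k * maj_weight N g))"
    by (simp only: klyachko_element_def signed_act.sum signed_act.scale functional.sum
      functional.scale on_rotations)
  also have "\<dots> = (\<Sum>k<N. ?r ^ k) * maj_weight N g"
    unfolding sum_distrib_right by (intro sum.cong refl) (simp only: power_mult_distrib ac_simps)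
  also have "(\<Sum>k<N. ?r ^ k) = (if card (cyclic_descents N g) = 1 then of_nat N else 0)"
    using N_ge_2 by (intro sum_unity_root_powers card_cyclic_descents_less[OF g_permutes]) simp_all
  finally show ?thesis by simp
qed

lemma functional_klyachko_element_eq_0:
  assumes g_permutes: "g permutes {1..N}" and "g \<notin> cyclic_subgroup N"
  shows "\<Lambda> (signed_act g (klyachko_element N)) = 0"
proof -
  interpret group "sym_group N" by (rule sym_group_is_group)
  have "card (cyclic_descents N g) \<noteq> 1"
  proof
    assume "card (cyclic_descents N g) = 1"
    then obtain k where rotation: "g \<circ> long_cycle N ^^ k = id"
      by (rule rotation_of_card_cyclic_descents_1[OF g_permutes])
    then have "inv\<^bsub>sym_group N\<^esub> (long_cycle N ^^ k) = g"
      using g_permutes long_cycle_funpow_permutes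
      by (intro inv_equality) (simp_all add: sym_group_carrier sym_group_mult sym_group_one)
    moreover have "long_cycle N ^^ k \<in> cyclic_subgroup N" by (simp add: cyclic_subgroup_eq)
    ultimately show False using assms(2) subgroup.m_inv_closed[OF subgroup_cyclic_subgroup] by metis
  qed
  then show ?thesis by (simp add: functional_klyachko_element[OF g_permutes])
qed

lemma functional_klyachko_element_nonzero: "\<Lambda> (klyachko_element N) \<noteq> 0"
proof -
  have "i \<in> cyclic_descents N id \<longleftrightarrow> i = N" for i
    using N_ge_2 long_cycle_eq_if[of i N] by (cases "i \<in> {1..N}") (auto simp: cyclic_descents_def)
  then have "cyclic_descents N id = {N}" by blast
  then have "\<Lambda> (signed_act id (klyachko_element N)) = of_nat N * maj_weight N id"
    by (simp add: functional_klyachko_element[OF permutes_id])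
  then show ?thesis using N_ge_2 maj_weight_nonzero[of N id]
    by (simp add: signed_act_def sign_char_def)
qed

end

lemma klyachko_element_in_V_deg: "klyachko_element (n + 1) \<in> V_deg n (n choose 2)"
  unfolding klyachko_element_def
  by (intro cpoly.subspace_sum cpoly.subspace_scale subspace_V_deg path_poly_in_V_deg
      long_cycle_funpow_permutes)

lemma rep_isomorphic_V_rep_top:
  assumes n_pos: "n \<ge> 1"
  shows "rep_isomorphic (sym_group (n + 1)) (V_rep n (n choose 2))
      (tensor_char (Lie_rep n) sign_char)"
proof (rule rep_isomorphic_tensor_char_right[where \<psi> = sign_char])
  let ?N = "n + 1" and ?R = "tensor_char (V_rep n (n choose 2)) sign_char"
  have twisted_simps: "rep_scale ?R = poly_scale" "rep_space ?R = V_deg n (n choose 2)"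
    "rep_act ?R = signed_act"
    by (simp_all add: tensor_char_def V_rep_def signed_act_def fun_eq_iff)
  have one_le: "?N \<ge> 1" and two_le: "?N \<ge> 2" using n_pos by simp_all
  obtain \<Lambda> where lin: "Vector_Spaces.linear poly_scale (*) \<Lambda>"
    and path: "\<And>w. w permutes {1..?N} \<Longrightarrow> \<Lambda> (path_poly ?N w) = maj_weight ?N w"
    using exists_major_index_functional[OF one_le] by blast
  interpret major_index_functional ?N \<Lambda>
    by (rule major_index_functional.intro[OF two_le lin path])
  have frobenius: "semi_invariant_functional (sym_group ?N) ?R (cyclic_subgroup ?N) (zeta ?N) \<Lambda>"
  proof (rule semi_invariant_functional.intro)
    show "representation (sym_group ?N) ?R"
      by (rule representation_tensor_char[OF representation_V_rep linear_character_sign_char])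
    show "\<Lambda> (rep_act ?R h p) = zeta ?N h * \<Lambda> p" if "h \<in> cyclic_subgroup ?N" "p \<in> rep_space ?R"
      for h p
      using that semi_invariant zeta_long_cycle_power[OF one_le]
      by (auto simp: twisted_simps cyclic_subgroup_eq V_deg_top_eq_span_paths)
  qed (simp_all add: twisted_simps linear_signed_act linear_functional subgroup_cyclic_subgroup)
  show "rep_isomorphic (sym_group ?N) ?R (Lie_rep n)"
    unfolding Lie_rep_def
  proof (rule semi_invariant_functional.rep_isomorphic_induced[OF frobenius])
    show "left_transversal (sym_group ?N) (cyclic_subgroup ?N) (root_words ?N)"
      by (rule left_transversal_root_words[OF one_le])
    show "klyachko_element ?N \<in> rep_space ?R"
      by (simp only: twisted_simps klyachko_element_in_V_deg)
    show "\<Lambda> (klyachko_element ?N) \<noteq> 0" by (rule functional_klyachko_element_nonzero)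
    show "\<Lambda> (rep_act ?R g (klyachko_element ?N)) = 0"
      if "g \<in> carrier (sym_group ?N)" "g \<notin> cyclic_subgroup ?N" for g
      using that unfolding twisted_simps sym_group_carrier
      by (rule functional_klyachko_element_eq_0)
    show "rep_space ?R = module.span (rep_scale ?R) (path_poly ?N ` root_words ?N)"
      by (simp only: twisted_simps V_deg_top_eq_span_paths)
    show "card (path_poly ?N ` root_words ?N) \<le> card (root_words ?N)" by (simp add: card_image_le)
  qed simp_all
qed (simp_all add: representation_V_rep[simplified] linear_character_sign_char)

theorem theorem2:
  fixes n :: nat
  assumes "n \<ge> 1"
  shows
    "rep_isomorphic (sym_group (n + 1)) (V_rep n 0) (char_rep (\<lambda>_. 1)) \<and>
     (n \<ge> 2 \<longrightarrow>
        rep_isomorphic (sym_group (n + 1)) (V_rep n 1) (reflection_rep (n + 1)) \<and>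
        rep_isomorphic (sym_group (n + 1)) (V_rep n 1) (specht_rep [n, 1]) \<and>
        irreducible_rep (sym_group (n + 1)) (V_rep n 1)) \<and>
     (\<forall>k<n. V_deg n k =
        module.span poly_scale {(\<Prod>i<k. f i) |f. \<forall>i<k. f i \<in> V_deg n 1}) \<and>
     (\<forall>k>n choose 2. V_deg n k = {0}) \<and>
     rep_isomorphic (sym_group (n + 1)) (V_rep n (n choose 2))
       (tensor_char (Lie_rep n) sign_char)"
proof (intro conjI allI impI)
  assume n_ge_2: "n \<ge> 2"
  show reflection: "rep_isomorphic (sym_group (n + 1)) (V_rep n 1) (reflection_rep (n + 1))"
    by (rule rep_isomorphic_sym[OF rep_isomorphic_reflection_V_rep[OF n_ge_2]])
  show "rep_isomorphic (sym_group (n + 1)) (V_rep n 1) (specht_rep [n, 1])"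
    by (rule rep_isomorphic_trans[OF reflection rep_isomorphic_reflection_specht[OF assms]])
  show "irreducible_rep (sym_group (n + 1)) (V_rep n 1)"
    by (rule irreducible_rep_isomorphic[OF reflection irreducible_reflection_rep])
      (use n_ge_2 in simp)
next
  show "rep_isomorphic (sym_group (n + 1)) (V_rep n 0) (char_rep (\<lambda>_. 1))"
    by (rule rep_isomorphic_V_rep_0[OF assms])
  show "rep_isomorphic (sym_group (n + 1)) (V_rep n (n choose 2))
      (tensor_char (Lie_rep n) sign_char)"
    by (rule rep_isomorphic_V_rep_top[OF assms])
qed (erule V_deg_eq_span_products V_deg_above_top)+

end
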